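(* For a prime $q$ let $f_q(x)=\sum_{n=1}^\infty \frac{\left(\frac{n}{q}\right)\sin 2\pi n x}{n^2}$, where $\left(\frac{\cdot}{q}\right)$ is the Legendre symbol modulo $q$. If $f_q(x)\geqslant 0$ for all $0\leqslant x\leqslant 1/4$ and all primes $q$ congruent to $3$ modulo $8$, then the Riemann Hypothesis (for the Riemann zeta-function) is true.
   Context: The Legendre symbol $\left(\frac{n}{q}\right)$ is $0$ if $q\mid n$, $+1$ if $n$ is a nonzero square modulo $q$, and $-1$ if $n$ is not a square modulo $q$. *)

theory Defs
  imports "HOL-Complex_Analysis.Complex_Analysis" "HOL-Number_Theory.Number_Theory"
begin

definition legendre_sine_series :: "nat \<Rightarrow> real \<Rightarrow> real" where
  "legendre_sine_series q x =
     (\<Sum>n. real_of_int (Legendre (int (Suc n)) (int q)) * sin (2 * pi * real (Suc n) * x)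
             / real (Suc n) ^ 2)"

(* The defining series converges absolutely, so the infinite sum above is a genuine one. *)
lemma summable_legendre_sine_series:
  "summable (\<lambda>n. norm (real_of_int (Legendre (int (Suc n)) (int q))
      * sin (2 * pi * real (Suc n) * x) / real (Suc n) ^ 2))"
proof (rule summable_comparison_test')
  show "summable (\<lambda>n. inverse (real (Suc n) ^ 2))"
    by (subst summable_Suc_iff) (rule inverse_power_summable, simp)
next
  fix n :: nat
  have "\<bar>real_of_int (Legendre (int (Suc n)) (int q))\<bar> \<le> 1"
    by (simp add: Legendre_def)
  hence "\<bar>real_of_int (Legendre (int (Suc n)) (int q))\<bar> * \<bar>sin (2 * pi * real (Suc n) * x)\<bar> \<le> 1 * 1"
    by (intro mult_mono) auto
  thus "norm (norm (real_of_int (Legendre (int (Suc n)) (int q))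
      * sin (2 * pi * real (Suc n) * x) / real (Suc n) ^ 2)) \<le> inverse (real (Suc n) ^ 2)"
    by (simp add: abs_mult divide_inverse mult_right_mono del: of_nat_Suc)
qed

(* The analytic continuation of the Dirichlet series to the complex plane without the pole at 1.
   The value 0 at the pole is a dummy that makes the description unique; existence and
   uniqueness are proved below. *)
definition is_zeta_continuation :: "(complex \<Rightarrow> complex) \<Rightarrow> bool" where
  "is_zeta_continuation f \<longleftrightarrow>
     f holomorphic_on (- {1}) \<and>
     (\<forall>s. Re s > 1 \<longrightarrow> f s = (\<Sum>n. 1 / of_nat (Suc n) powr s)) \<and>
     f 1 = 0"

definition zeta :: "complex \<Rightarrow> complex" where
  "zeta = (THE f. is_zeta_continuation f)"

definition Riemann_Hypothesis :: bool where
  "Riemann_Hypothesis \<longleftrightarrow>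
     (\<forall>s. s \<noteq> 1 \<longrightarrow> zeta s = 0 \<longrightarrow> (\<nexists>n::nat. s = - 2 * of_nat (Suc n)) \<longrightarrow> Re s = 1 / 2)"

subsection \<open>Existence and uniqueness of the continuation\<close>

lemma is_zeta_continuation_unique:
  assumes "is_zeta_continuation f" "is_zeta_continuation g"
  shows "f = g"
proof
  fix s :: complex
  show "f s = g s"
  proof (cases "s = 1")
    case False
    show ?thesis
    proof (rule analytic_continuation_open[where f = f and g = g and s = "{s. Re s > 1}" and s' = "- {1}"])
      show "{s. Re s > 1} \<noteq> {}" by (auto intro!: exI[of _ 2])
      show "connected (- {1 :: complex})"
        by (rule connected_punctured_universe) simp
    qed (use assms False in \<open>auto simp: is_zeta_continuation_def open_halfspace_Re_gt\<close>)
  qed (use assms in \<open>simp add: is_zeta_continuation_def\<close>)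
qed

lemma holomorphic_on_suminf_local:
  fixes f :: "nat \<Rightarrow> complex \<Rightarrow> complex"
  assumes "open S" "\<And>n. f n holomorphic_on S"
    and "\<And>x. x \<in> S \<Longrightarrow> \<exists>d h. 0 < d \<and> summable h \<and> (\<forall>n. \<forall>y\<in>ball x d \<inter> S. norm (f n y) \<le> h n)"
  shows "(\<lambda>z. \<Sum>n. f n z) holomorphic_on S"
proof -
  have 1: "(f n has_field_derivative deriv (f n) x) (at x)" if "x \<in> S" for n x
    using assms(1,2) that by (meson holomorphic_derivI)
  have 2: "\<exists>d h. 0 < d \<and> summable h \<and> (\<forall>\<^sub>F n in sequentially. \<forall>y\<in>ball x d \<inter> S. norm (f n y) \<le> h n)"
    if "x \<in> S" for x
  proof -
    obtain d h where "0 < d" "summable h" "\<forall>n. \<forall>y\<in>ball x d \<inter> S. norm (f n y) \<le> h n"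
      using assms(3)[OF \<open>x \<in> S\<close>] by blast
    thus ?thesis by (intro exI[of _ d] exI[of _ h] conjI always_eventually)
  qed
  obtain g g' where g: "\<forall>x\<in>S. ((\<lambda>n. f n x) sums g x) \<and> ((\<lambda>n. deriv (f n) x) sums g' x)
      \<and> (g has_field_derivative g' x) (at x)"
    using series_and_derivative_comparison_local[of S f "\<lambda>n. deriv (f n)", OF assms(1) 1 2] by blast
  hence "g holomorphic_on S"
    by (metis DERIV_subset UNIV_I field_differentiable_def holomorphic_on_def subsetI)
  moreover have "(\<Sum>n. f n x) = g x" if "x \<in> S" for x
    using g that sums_unique by metis
  ultimately show ?thesis
    using holomorphic_transform by metis
qed

lemma summable_shifted_powr:
  assumes "r < -1"
  shows "summable (\<lambda>n. real (n + m) powr r)"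
  using assms by (subst summable_iff_shift) (simp add: summable_real_powr_iff)

definition zeta_tail :: "complex \<Rightarrow> complex" where
  "zeta_tail s = (\<Sum>n. of_nat (n + 2) powr (- s))"

lemma summable_zeta_tail:
  assumes "Re s > 1"
  shows "summable (\<lambda>n. of_nat (n + 2) powr (- s) :: complex)"
proof (rule summable_norm_cancel)
  have "norm (of_nat (n + 2) powr (- s) :: complex) = real (n + 2) powr (- Re s)" for n
    by (subst norm_powr_real_powr) auto
  thus "summable (\<lambda>n. norm (of_nat (n + 2) powr (- s) :: complex))"
    using summable_shifted_powr[of "- Re s" 2] assms by simp
qed

lemma holomorphic_zeta_tail: "zeta_tail holomorphic_on {s. Re s > 1}"
proof -
  have "(\<lambda>s. \<Sum>n. of_nat (n + 2) powr (- s) :: complex) holomorphic_on {s. Re s > 1}"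
  proof (rule holomorphic_on_suminf_local)
    fix x assume "x \<in> {s. Re s > 1}"
    define d where "d = (Re x - 1) / 2"
    have d: "d > 0" using \<open>x \<in> _\<close> by (simp add: d_def)
    have "norm (of_nat (n + 2) powr (- y) :: complex) \<le> real (n + 2) powr (- 1 - d)"
      if "y \<in> ball x d" for n y
    proof -
      have "\<bar>Re (x - y)\<bar> < d"
        using that abs_Re_le_cmod[of "x - y"] by (simp add: dist_norm)
      moreover have "Re x = 1 + 2 * d" by (simp add: d_def field_simps)
      ultimately have "- Re y \<le> - 1 - d" by simp
      hence "real (n + 2) powr (- Re y) \<le> real (n + 2) powr (- 1 - d)"
        by (intro powr_mono) auto
      thus ?thesis by (subst norm_powr_real_powr) auto
    qed
    thus "\<exists>d h. 0 < d \<and> summable h \<and>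
        (\<forall>n. \<forall>y\<in>ball x d \<inter> {s. Re s > 1}. norm (of_nat (n + 2) powr (- y) :: complex) \<le> h n)"
      using d summable_shifted_powr[of "- 1 - d" 2]
      by (intro exI[of _ d] exI[of _ "\<lambda>n. real (n + 2) powr (- 1 - d)"]) auto
  qed (auto intro!: holomorphic_intros open_halfspace_Re_gt simp: add_eq_0_iff)
  thus ?thesis by (simp add: zeta_tail_def [abs_def])
qed

definition zeta_rem :: "nat \<Rightarrow> nat \<Rightarrow> complex \<Rightarrow> complex" where
  "zeta_rem K n s = of_nat (n + 1) powr (1 - s)
     - (\<Sum>k\<le>K. ((1 - s) gchoose k) * (- 1) ^ k * of_nat (n + 2) powr (1 - s - of_nat k))"

lemma norm_pochhammer_le:
  fixes a :: complex
  assumes "norm a \<le> M"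
  shows "norm (pochhammer a k) \<le> pochhammer M k"
proof (induction k)
  case (Suc k)
  have "norm (a + of_nat k) \<le> M + real k"
    using assms norm_triangle_ineq[of a "of_nat k"] by simp
  thus ?case using Suc
    by (simp add: pochhammer_Suc norm_mult) (intro mult_mono; use norm_ge_zero order_trans in blast)
qed simp

lemma norm_gchoose_le:
  fixes a :: complex
  assumes "norm a \<le> M"
  shows "norm (a gchoose k) \<le> pochhammer M k / fact k"
  using norm_pochhammer_le[of "- a" M k] assms
  by (simp add: gbinomial_pochhammer norm_mult norm_divide norm_power divide_right_mono)

lemma summable_pochhammer_half:
  fixes M :: real
  shows "summable (\<lambda>k. pochhammer M k / fact k * (1/2) ^ k)"
proof -
  have "(\<lambda>k. ((- M) gchoose k) * (- 1 / 2) ^ k) sums (1 + (- 1 / 2)) powr (- M)"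
    by (rule gen_binomial_real) simp
  also have "(\<lambda>k. ((- M) gchoose k) * (- 1 / 2) ^ k) = (\<lambda>k. pochhammer M k / fact k * (1/2) ^ k)"
  proof
    fix k
    have "(- 1 :: real) ^ k * (- 1 / 2) ^ k = (1/2) ^ k"
      by (subst power_mult_distrib [symmetric]) simp
    thus "((- M) gchoose k) * (- 1 / 2) ^ k = pochhammer M k / fact k * (1/2) ^ k"
      by (simp add: gbinomial_pochhammer field_simps)
  qed
  finally show ?thesis by (rule sums_summable)
qed

lemma norm_zeta_rem_le:
  fixes s :: complex and M :: real and K n :: nat
  assumes "norm (1 - s) \<le> M"
  defines "C \<equiv> 2 ^ Suc K * (\<Sum>k. pochhammer M k / fact k * (1/2) ^ k)"
  shows "norm (zeta_rem K n s) \<le> C * real (n + 2) powr (- Re s - real K)"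
proof -
  define t where "t = (\<lambda>k. ((1 - s) gchoose k) * (- 1) ^ k * of_nat (n + 2) powr (1 - s - of_nat k))"
  define p where "p = (\<lambda>k. pochhammer M k / fact k * (1/2 :: real) ^ k)"
  have M: "M \<ge> 0" using assms(1) norm_ge_zero order_trans by blast
  have p: "summable p" unfolding p_def by (rule summable_pochhammer_half)
  have p0: "p k \<ge> 0" for k
    using M by (simp add: p_def pochhammer_prod prod_nonneg)
  have "t sums of_nat (n + 1) powr (1 - s)"
    using gen_binomial_complex'[of "- 1" "real (n + 2)" "1 - s"] by (simp add: t_def add_ac)
  hence "(\<lambda>k. t (k + Suc K)) sums (of_nat (n + 1) powr (1 - s) - (\<Sum>k<Suc K. t k))"
    by (subst sums_iff_shift) simp
  hence sums: "(\<lambda>k. t (k + Suc K)) sums zeta_rem K n s"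
    by (simp only: zeta_rem_def t_def lessThan_Suc_atMost)
  define B where "B = 2 ^ Suc K * real (n + 2) powr (- Re s - real K)"
  have bound: "norm (t (k + Suc K)) \<le> B * p (k + Suc K)" for k
  proof -
    have "real (n + 2) powr (1 - Re s - real (k + Suc K))
        = real (n + 2) powr (- Re s - real K) * real (n + 2) powr (- real k)"
      by (subst powr_add [symmetric]) (simp add: algebra_simps)
    also have "real (n + 2) powr (- real k) \<le> 2 powr (- real k)"
      by (intro powr_mono2') auto
    also have "2 powr (- real k) = (1/2) ^ k"
      by (simp add: powr_minus powr_realpow power_divide field_simps)
    finally have "real (n + 2) powr (1 - Re s - real (k + Suc K)) \<le> B * (1/2) ^ (k + Suc K)"
      by (simp add: B_def mult_left_mono power_add field_simps)
    hence "norm (of_nat (n + 2) powr (1 - s - of_nat (k + Suc K)) :: complex) \<le> B * (1/2) ^ (k + Suc K)"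
      by (subst norm_powr_real_powr) auto
    moreover have "norm ((1 - s) gchoose (k + Suc K)) \<le> pochhammer M (k + Suc K) / fact (k + Suc K)"
      by (rule norm_gchoose_le) fact
    ultimately have "norm ((1 - s) gchoose (k + Suc K)) *
          norm (of_nat (n + 2) powr (1 - s - of_nat (k + Suc K)) :: complex)
        \<le> pochhammer M (k + Suc K) / fact (k + Suc K) * (B * (1/2) ^ (k + Suc K))"
      by (intro mult_mono) (use norm_ge_zero order_trans in blast)+
    thus ?thesis
      by (simp only: t_def p_def norm_mult norm_power norm_minus_cancel norm_one power_one mult_1_right mult_ac)
  qed
  have "summable (\<lambda>k. p (k + Suc K))"
    by (subst summable_iff_shift) (rule p)
  hence Bp: "summable (\<lambda>k. B * p (k + Suc K))" by (rule summable_mult)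
  have "norm (zeta_rem K n s) = norm (\<Sum>k. t (k + Suc K))"
    using sums by (simp add: sums_iff)
  also have "\<dots> \<le> (\<Sum>k. B * p (k + Suc K))"
    by (rule norm_suminf_le[OF bound Bp])
  also have "\<dots> = B * (\<Sum>k. p (k + Suc K))"
    by (rule suminf_mult) fact
  also have "\<dots> \<le> B * (\<Sum>k. p k)"
    using suminf_split_initial_segment[OF p, of "Suc K"] sum_nonneg[of "{..<Suc K}" p] p0
    by (intro mult_left_mono) (auto simp: B_def)
  also have "\<dots> = C * real (n + 2) powr (- Re s - real K)"
    by (simp add: B_def C_def p_def)
  finally show ?thesis .
qed

lemma zeta_rem_holomorphic: "(\<lambda>s. \<Sum>n. zeta_rem K n s) holomorphic_on {s. Re s > 1 - real K}"
proof (rule holomorphic_on_suminf_local)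
  show "open {s. Re s > 1 - real K}" by (rule open_halfspace_Re_gt)
  have *: "of_nat (n + 2) \<noteq> (0 :: complex)" "of_nat (n + 1) \<noteq> (0 :: complex)" for n
    by (simp_all only: of_nat_eq_0_iff)
  show "zeta_rem K n holomorphic_on {s. Re s > 1 - real K}" for n
    unfolding zeta_rem_def [abs_def] gbinomial_prod_rev
    by (intro holomorphic_intros) (use * in auto)
next
  fix x assume "x \<in> {s. Re s > 1 - real K}"
  define d where "d = (Re x - 1 + real K) / 2"
  have d: "d > 0" using \<open>x \<in> _\<close> by (simp add: d_def)
  define M where "M = norm (1 - x) + d"
  define C where "C = 2 ^ Suc K * (\<Sum>k. pochhammer M k / fact k * (1/2) ^ k)"
  have M: "M \<ge> 0" using d by (simp add: M_def)
  have C: "C \<ge> 0"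
    unfolding C_def using M
    by (intro mult_nonneg_nonneg suminf_nonneg summable_pochhammer_half)
       (auto simp: pochhammer_prod prod_nonneg)
  have "norm (zeta_rem K n y) \<le> C * real (n + 2) powr (- 1 - d)" if y: "y \<in> ball x d" for n y
  proof -
    have "\<bar>Re (x - y)\<bar> < d"
      using that abs_Re_le_cmod[of "x - y"] by (simp add: dist_norm)
    moreover have "Re x = 1 - real K + 2 * d" by (simp add: d_def field_simps)
    ultimately have "- Re y - real K \<le> - 1 - d" by simp
    hence *: "real (n + 2) powr (- Re y - real K) \<le> real (n + 2) powr (- 1 - d)"
      by (intro powr_mono) auto
    have "norm (1 - y) \<le> norm (1 - x) + norm (x - y)"
      using norm_triangle_ineq[of "1 - x" "x - y"] by simp
    hence "norm (1 - y) \<le> M" using y by (simp add: M_def dist_norm)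
    from norm_zeta_rem_le[OF this, of K n] show ?thesis
      using mult_left_mono[OF * C] by (simp only: C_def)
  qed
  thus "\<exists>d h. 0 < d \<and> summable h \<and>
      (\<forall>n. \<forall>y\<in>ball x d \<inter> {s. Re s > 1 - real K}. norm (zeta_rem K n y) \<le> h n)"
    using d summable_mult[OF summable_shifted_powr[of "- 1 - d" 2], of C]
    by (intro exI[of _ d] exI[of _ "\<lambda>n. C * real (n + 2) powr (- 1 - d)"]) auto
qed

lemma suminf_zeta_rem:
  assumes s: "Re s > 1"
  shows "(\<Sum>n. zeta_rem K n s) =
    1 - (\<Sum>k=1..K. ((1 - s) gchoose k) * (- 1) ^ k * zeta_tail (s + of_nat k - 1))"
proof -
  have lim: "(\<lambda>n. of_nat (n + 1) powr (1 - s) :: complex) \<longlonglongrightarrow> 0"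
    using s by (intro tendsto_neg_powr_complex_of_nat filterlim_add_const_nat_at_top) auto
  have "(\<lambda>n. of_nat (n + 1) powr (1 - s) - of_nat (Suc n + 1) powr (1 - s) :: complex) sums
      (of_nat (0 + 1) powr (1 - s) - 0)"
    using lim by (rule telescope_sums')
  hence 1: "(\<lambda>n. of_nat (n + 1) powr (1 - s) - of_nat (n + 2) powr (1 - s) :: complex) sums 1"
    by simp
  have 2: "(\<lambda>n. of_nat (n + 2) powr (1 - s - of_nat k) :: complex) sums zeta_tail (s + of_nat k - 1)"
    if "k \<in> {1..K}" for k
  proof -
    have "Re (s + of_nat k - 1) > 1" using s that by auto
    from summable_zeta_tail[OF this]
    have "(\<lambda>n. of_nat (n + 2) powr (- (s + of_nat k - 1)) :: complex) sums zeta_tail (s + of_nat k - 1)"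
      unfolding zeta_tail_def by (rule summable_sums)
    also have "- (s + of_nat k - 1) = 1 - s - of_nat k" by simp
    finally show ?thesis .
  qed
  have eq: "zeta_rem K n s = of_nat (n + 1) powr (1 - s) - of_nat (n + 2) powr (1 - s)
      - (\<Sum>k=1..K. ((1 - s) gchoose k) * (- 1) ^ k * of_nat (n + 2) powr (1 - s - of_nat k))" for n
  proof -
    have "{..K} = insert 0 {1..K}" by auto
    thus ?thesis by (simp add: zeta_rem_def)
  qed
  have "(\<lambda>n. zeta_rem K n s) sums
    (1 - (\<Sum>k=1..K. ((1 - s) gchoose k) * (- 1) ^ k * zeta_tail (s + of_nat k - 1)))"
    unfolding eq by (intro sums_diff 1 sums_sum sums_mult 2)
  thus ?thesis by (rule sums_unique [symmetric])
qed

lemma zeta_tail_continuation_halfplane: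
  "\<exists>G. G holomorphic_on {s. Re s > 1 - real m} \<and> (\<forall>s. Re s > 1 \<longrightarrow> G s = (s - 1) * zeta_tail s)"
proof (induction m)
  case 0
  show ?case
    using holomorphic_zeta_tail
    by (intro exI[of _ "\<lambda>s. (s - 1) * zeta_tail s"]) (auto intro!: holomorphic_intros)
next
  case (Suc m)
  then obtain G where G: "G holomorphic_on {s. Re s > 1 - real m}"
    and G_eq: "\<And>s. Re s > 1 \<Longrightarrow> G s = (s - 1) * zeta_tail s" by blast
  define e :: "nat \<Rightarrow> complex \<Rightarrow> complex" where "e = (\<lambda>k s. pochhammer (s - 1) (k - 1) / fact k)"
  define H where "H = (\<lambda>s. 1 - (\<Sum>n. zeta_rem (Suc m) n s)
                         - (\<Sum>k=2..Suc m. e k s * G (s + of_nat k - 1)))"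
  have "(\<lambda>s. G (s + of_nat k - 1)) holomorphic_on {s. Re s > 1 - real (Suc m)}"
    if "k \<in> {2..Suc m}" for k
  proof -
    have "(G \<circ> (\<lambda>s. s + of_nat k - 1)) holomorphic_on {s. Re s > 1 - real (Suc m)}"
      using that by (intro holomorphic_on_compose_gen[OF _ G] holomorphic_intros) auto
    thus ?thesis by (simp only: o_def)
  qed
  hence "H holomorphic_on {s. Re s > 1 - real (Suc m)}"
    unfolding H_def e_def pochhammer_prod
    by (intro holomorphic_intros zeta_rem_holomorphic) auto
  moreover have "H s = (s - 1) * zeta_tail s" if s: "Re s > 1" for s
  proof -
    have *: "e k s * G (s + of_nat k - 1)
        = ((1 - s) gchoose k) * (- 1) ^ k * zeta_tail (s + of_nat k - 1)" if "k \<in> {2..Suc m}" for k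
    proof -
      obtain j where j: "k = Suc j" using \<open>k \<in> {2..Suc m}\<close> by (cases k) auto
      have "Re (s + of_nat k - 1) > 1" using s \<open>k \<in> {2..Suc m}\<close> by auto
      hence "G (s + of_nat k - 1) = (s - 1 + of_nat j) * zeta_tail (s + of_nat k - 1)"
        by (subst G_eq) (auto simp: j algebra_simps)
      moreover have "((1 - s) gchoose k) * (- 1) ^ k = pochhammer (s - 1) k / fact k"
        by (simp add: gbinomial_pochhammer mult_ac flip: power_mult_distrib)
      hence "((1 - s) gchoose k) * (- 1) ^ k = e k s * (s - 1 + of_nat j)"
        by (simp add: e_def j pochhammer_Suc)
      ultimately show ?thesis by simp
    qed
    have "{1..Suc m} = insert 1 {2..Suc m}" by auto
    thus ?thesis
      unfolding H_def suminf_zeta_rem[OF s] by (simp add: * algebra_simps)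
  qed
  ultimately show ?case by blast
qed

lemma is_zeta_continuation_exists: "\<exists>f. is_zeta_continuation f"
proof -
  obtain G where G: "\<And>m. G m holomorphic_on {s. Re s > 1 - real m}"
    and G_eq: "\<And>m s. Re s > 1 \<Longrightarrow> G m s = (s - 1) * zeta_tail s"
    using zeta_tail_continuation_halfplane by metis
  have agree: "G m s = G n s" if "m \<le> n" "Re s > 1 - real m" for m n s
  proof (rule analytic_continuation_open[where f = "G m" and g = "G n" and s = "{s. Re s > 1}"
        and s' = "{s. Re s > 1 - real m}"])
    show "{s. Re s > 1} \<noteq> {}" by (auto intro!: exI[of _ 2])
    show "connected {s. Re s > 1 - real m}"
      by (intro convex_connected convex_halfspace_Re_gt)
    show "G n holomorphic_on {s. Re s > 1 - real m}"
      using G[of n] by (rule holomorphic_on_subset) (use that in auto)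
  qed (use G G_eq that in \<open>auto simp: open_halfspace_Re_gt\<close>)
  define N where "N = (\<lambda>s. nat \<lceil>2 - Re s\<rceil>)"
  have N: "Re s > 1 - real (N s)" for s unfolding N_def by linarith
  define F where "F = (\<lambda>s. G (N s) s)"
  have F: "F s = G m s" if "Re s > 1 - real m" for m s
    unfolding F_def using agree N that by (metis linorder_le_cases)
  have F_hol: "F holomorphic_on UNIV"
  proof -
    have "F field_differentiable (at s)" for s
    proof -
      have "F holomorphic_on {z. Re z > 1 - real (N s)}"
        using G[of "N s"] by (rule holomorphic_transform) (simp add: F)
      thus ?thesis
        using N[of s] by (intro holomorphic_on_imp_differentiable_at) (auto simp: open_halfspace_Re_gt)
    qed
    thus ?thesis
      using field_differentiable_at_within holomorphic_on_def by blast
  qed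
  define f where "f = (\<lambda>s. if s = 1 then 0 else 1 + F s / (s - 1))"
  have "(\<lambda>s. 1 + F s / (s - 1)) holomorphic_on - {1}"
    by (intro holomorphic_intros holomorphic_on_subset[OF F_hol]) auto
  hence "f holomorphic_on - {1}"
    by (rule holomorphic_transform) (simp add: f_def)
  moreover have "f s = (\<Sum>n. 1 / of_nat (Suc n) powr s)" if s: "Re s > 1" for s
  proof -
    have "s \<noteq> 1" using s by auto
    moreover have "F s = (s - 1) * zeta_tail s" using F[of 0 s] G_eq[of s 0] s by simp
    ultimately have f: "f s = 1 + zeta_tail s" by (simp add: f_def)
    have eq: "(\<lambda>n. 1 / of_nat (Suc n) powr s) = (\<lambda>n. of_nat (n + 1) powr (- s) :: complex)"
      by (simp add: powr_minus field_simps)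
    have shift: "(\<lambda>n. of_nat (Suc n + 1) powr (- s) :: complex) = (\<lambda>n. of_nat (n + 2) powr (- s))"
      by simp
    have "(\<lambda>n. of_nat (Suc n + 1) powr (- s) :: complex) sums zeta_tail s"
      unfolding shift zeta_tail_def by (rule summable_sums[OF summable_zeta_tail[OF s]])
    hence "(\<lambda>n. of_nat (n + 1) powr (- s) :: complex) sums (zeta_tail s + of_nat (0 + 1) powr (- s))"
      by (rule sums_Suc)
    thus ?thesis unfolding eq f by (simp add: sums_iff)
  qed
  ultimately show ?thesis
    unfolding is_zeta_continuation_def by (intro exI[of _ f]) (simp add: f_def)
qed

theorem is_zeta_continuation_zeta: "is_zeta_continuation zeta"
  unfolding zeta_def
  using is_zeta_continuation_exists is_zeta_continuation_unique by (metis the_equality)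

end

theory Submission
  imports Defs
begin

text \<open>
  There are primes \<open>q\<close> congruent to 3 modulo 8 for which every prime up to a given bound is a
  nonresidue, so that the Legendre symbol modulo \<open>q\<close> agrees with the Liouville function
  $\lambda$ on a long initial segment: with quadratic reciprocity this prescribes the values at
  \<open>q\<close> of finitely many independent real characters, and it needs only $L(1,\chi) \neq 0$ for
  real $\chi$. In the limit, the hypothesis gives
  $f(x) = \sum \lambda(n) \sin(2\pi n x)/n^2 \geq 0$ on $[0,1/4]$.

  The Mellin transform of $f$ is $\int_0^\infty f(x) x^{-w}\,dx =
  S(w) (2\pi)^{w-1} \zeta(6-2w)/\zeta(3-w)$ with an explicit Gamma quotient $S(w)$. The part over
  $[1/4,\infty)$ is holomorphic for $\mathrm{Re}\,w > 1$, and the right-hand side has no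
  singularity on the real segment $1 < w < 5/2$ because $\zeta < 0$ on $(0,1)$. By Landau's lemma
  the integral of the nonnegative function $f(x) x^{-w}$ over $(0,1/4)$ converges for $\mathrm{Re}\,w < 5/2$, which excludes zeros of
  $\zeta$ with real part above $1/2$. The functional equation, obtained by the same transform from
  the Fourier series of the periodic Bernoulli polynomial $B_3$, takes care of the other half plane.
\<close>

subsection \<open>Legendre symbols\<close>

text \<open>The transform of f is directly available only for real w with 1 < w < 2: boundedness of
  f gives convergence at infinity for w > 1, and the summability of n^(w-3) permits termwise
  integration for w < 2. Every complex identity is therefore proved on a real interval and carried
  over by the identity theorem. At w = 2 the pole of Gamma(1 - w/2) in S(w) meets the pole of zeta(3
  - w) in the denominator. To avoid dividing there, the identity is kept in product form, with
  reciprocal Gamma functions and (s - 1) zeta(s). The bound 5/2 is where 6 - 2w reaches the pole of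
  zeta; s = 3 - w turns it into 1/2. The congruence q = 3 mod 8 does two jobs: it makes 2 a
  nonresidue, and its consequence q = 3 mod 4 fixes the sign in quadratic reciprocity. B_3 is the
  first Bernoulli polynomial of odd order whose sine series converges absolutely, so the transform
  computed for f applies to it; for real -2 < s < -1 this transform and the Euler-Maclaurin formula
  of order three are both valid.\<close>

lemma Legendre_values: "Legendre a p \<in> {-1, 0, 1}"
  by (auto simp: Legendre_def)

lemma Legendre_cong:
  assumes "[a = b] (mod p)"
  shows "Legendre a p = Legendre b p"
proof -
  have "[a = 0] (mod p) \<longleftrightarrow> [b = 0] (mod p)" "QuadRes p a \<longleftrightarrow> QuadRes p b"
    using assms unfolding QuadRes_def by (meson cong_sym cong_trans)+
  thus ?thesis by (simp add: Legendre_def)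
qed

text \<open>Two such values differ by at most 2, which is less than the modulus. This turns
  congruences coming from Euler's criterion into equalities of symbols.\<close>

lemma cong_values_imp_eq:
  fixes x y p :: int
  assumes "[x = y] (mod p)" "p > 2" "x \<in> {-1, 0, 1}" "y \<in> {-1, 0, 1}"
  shows "x = y"
proof -
  have "p dvd x - y" using assms(1) by (simp add: cong_iff_dvd_diff)
  moreover have "\<bar>x - y\<bar> < p" using assms by auto
  ultimately show ?thesis using zdvd_not_zless[of "\<bar>x - y\<bar>" p] by auto
qed

lemma Legendre_mult:
  assumes "prime p" "2 < p"
  shows "Legendre (a * b) (int p) = Legendre a (int p) * Legendre b (int p)"
proof (rule cong_values_imp_eq)
  have "[Legendre (a * b) (int p) = (a * b) ^ ((p - 1) div 2)] (mod int p)"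
    by (rule euler_criterion[OF assms])
  also have "(a * b) ^ ((p - 1) div 2) = a ^ ((p - 1) div 2) * b ^ ((p - 1) div 2)"
    by (rule power_mult_distrib)
  also have "[\<dots> = Legendre a (int p) * Legendre b (int p)] (mod int p)"
    by (intro cong_mult cong_sym[OF euler_criterion[OF assms]])
  finally show "[Legendre (a * b) (int p) = Legendre a (int p) * Legendre b (int p)] (mod int p)" .
  show "Legendre a (int p) * Legendre b (int p) \<in> {-1, 0, 1}"
    using Legendre_values[of a p] Legendre_values[of b p] by auto
qed (use assms Legendre_values in auto)

lemma Legendre_one: "1 < p \<Longrightarrow> Legendre 1 p = 1"
  by (auto simp: Legendre_def QuadRes_def cong_def intro: exI[of _ 1])

text \<open>Gauss's lemma with q = 8m + 3: the doubles 2k, 1 <= k <= 4m + 1, are already reduced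
  modulo q, and they exceed (q - 1)/2 = 4m + 1 exactly for k >= 2m + 1. That is an odd number, 2m +
  1, of values.\<close>

lemma Legendre_two_3_mod_8:
  assumes "prime q" "[q = 3] (mod 8)"
  shows "Legendre 2 (int q) = -1"
proof -
  define m where "m = q div 8"
  have m: "q = 8 * m + 3"
    using assms(2) by (simp add: m_def cong_def) presburger
  interpret GAUSS q 2
    using assms m by unfold_locales (auto simp: cong_def)
  have half: "(int q - 1) div 2 = 4 * int m + 1" by (simp add: m)
  have A: "A = {0<..4 * int m + 1}" by (simp only: A_def half)
  have B: "x \<in> B \<longleftrightarrow> (\<exists>k. 0 < k \<and> k \<le> 4 * int m + 1 \<and> x = 2 * k)" for x
    by (auto simp: B_def A)
  have "C = (\<lambda>x. x) ` B" unfolding C_def 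
  proof (intro image_cong refl)
    fix x assume "x \<in> B"
    then obtain k where "0 < k" "k \<le> 4 * int m + 1" "x = 2 * k" using B by blast
    hence "0 \<le> x" "x < int q" using m by auto
    thus "x mod int q = x" by simp
  qed
  hence C: "C = B" by simp
  have "E = (\<lambda>k. 2 * k) ` {2 * int m + 1..4 * int m + 1}"
    unfolding E_def C half by (auto simp: B image_iff)
  hence "card E = card {2 * int m + 1..4 * int m + 1}"
    by (simp add: card_image inj_on_def)
  hence "card E = 2 * m + 1" by simp
  thus ?thesis using gauss_lemma by simp
qed

text \<open>Squaring on the nonzero residues sends 1 and p - 1 to the same value, so on this finite
  set it is not injective and hence misses some residue.\<close>

lemma Legendre_minus_one_exists:
  assumes "prime p" "2 < p"
  obtains b :: nat where "coprime b p" "Legendre (int b) (int p) = -1"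
proof -
  define S where "S = {1..<p}"
  define f where "f = (\<lambda>x::nat. x ^ 2 mod p)"
  have p: "p > 1" using assms by simp
  have "f ` S \<subseteq> S"
  proof -
    have "\<not> p dvd x ^ 2" if "x \<in> S" for x
      using that assms by (auto simp: S_def prime_dvd_power_iff dest: dvd_imp_le)
    thus ?thesis using p by (force simp: S_def f_def dvd_eq_mod_eq_0)
  qed
  moreover have "\<not> inj_on f S"
  proof
    assume inj: "inj_on f S"
    have "[int (p - 1) ^ 2 = (-1) ^ 2] (mod int p)"
      using p by (intro cong_pow) (auto simp: cong_iff_dvd_diff of_nat_diff)
    hence "[int ((p - 1) ^ 2) = int (1 ^ 2)] (mod int p)" by simp
    hence "f (p - 1) = f 1" unfolding f_def using cong_int_iff cong_def by blast
    with inj have "p - 1 = 1" using assms by (auto simp: inj_on_def S_def)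
    thus False using assms by simp
  qed
  ultimately have "f ` S \<noteq> S" using eq_card_imp_inj_on[of S f] by (auto simp: S_def)
  with \<open>f ` S \<subseteq> S\<close> obtain b where b: "b \<in> S" "b \<notin> f ` S" by blast
  have ndvd: "\<not> p dvd b" using b by (auto simp: S_def dest: dvd_imp_le)
  have "\<not> QuadRes (int p) (int b)"
  proof
    assume "QuadRes (int p) (int b)"
    then obtain y where y: "[y ^ 2 = int b] (mod int p)" by (auto simp: QuadRes_def)
    define z where "z = nat (y mod int p)"
    have z: "int z = y mod int p" using p by (simp add: z_def)
    have "[int z ^ 2 = int b] (mod int p)" using y by (simp add: z cong_def power_mod)
    hence "[z ^ 2 = b] (mod p)" by (metis cong_int_iff of_nat_power)
    hence fz: "f z = b" using b by (simp add: f_def cong_def S_def)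
    have "z < p" using z p by (metis of_nat_less_iff of_nat_0_less_iff pos_mod_bound less_trans zero_less_one)
    moreover have "z \<noteq> 0" using fz b by (auto simp: f_def S_def)
    ultimately show False using fz b(2) by (auto simp: S_def)
  qed
  moreover have "\<not> [int b = 0] (mod int p)" using ndvd by (simp add: cong_0_iff)
  ultimately have "Legendre (int b) (int p) = -1" by (simp add: Legendre_def)
  moreover have "coprime b p" using ndvd assms(1) by (metis coprime_commute prime_imp_coprime)
  ultimately show ?thesis using that by blast
qed

subsection \<open>Real characters and Dirichlet series\<close>

text \<open>The pair (a, b) is recorded as its product together with the divisor a. This regrouping
  yields both the Lambert series and products of Dirichlet series.\<close>

lemma has_sum_divisors:
  fixes F :: "nat \<Rightarrow> nat \<Rightarrow> 'a::{topological_comm_monoid_add, t3_space}"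
  assumes "((\<lambda>(a, b). F a b) has_sum S) ({0<..} \<times> {0<..})"
  shows "((\<lambda>m. \<Sum>d | d dvd m. F d (m div d)) has_sum S) {0<..}"
proof -
  have "((\<lambda>(a, b). F a b) has_sum S) ({0<..} \<times> {0<..}) \<longleftrightarrow>
        ((\<lambda>(m, d). F d (m div d)) has_sum S) (Sigma {0<..} (\<lambda>m. {d. d dvd m}))"
    by (rule has_sum_reindex_bij_witness[of _ "\<lambda>(m, d). (d, m div d)" "\<lambda>(a, b). (a * b, a)"])
       (auto elim!: dvdE)
  hence "((\<lambda>(m, d). F d (m div d)) has_sum S) (Sigma {0<..} (\<lambda>m. {d. d dvd m}))"
    using assms by simp
  thus ?thesis
    by (rule has_sum_SigmaD) (auto intro!: has_sum_finite)
qed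

lemma has_sum_Times_mult:
  fixes f g :: "nat \<Rightarrow> 'a::{real_normed_field, banach}"
  assumes "(\<lambda>n. norm (f n)) summable_on A" "(\<lambda>n. norm (g n)) summable_on B"
  shows "((\<lambda>(a, b). f a * g b) has_sum (infsum f A * infsum g B)) (A \<times> B)"
proof -
  have "(\<lambda>(a, b). f a * g b) abs_summable_on (A \<times> B)"
    using assms by (intro Infinite_Sum.abs_summable_on_Sigma_iff[THEN iffD2])
      (auto simp: norm_mult abs_mult infsum_nonneg infsum_cmult_right' infsum_cmult_left' intro!: summable_on_cmult_right summable_on_cmult_left)
  hence *: "(\<lambda>(a, b). f a * g b) summable_on (A \<times> B)"
    by (rule abs_summable_summable)
  have "infsum (\<lambda>(a, b). f a * g b) (A \<times> B) = infsum f A * infsum g B"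
    using * by (simp add: infsum_Sigma'_banach[symmetric] infsum_cmult_right' infsum_cmult_left')
  with * show ?thesis by (metis has_sum_infsum)
qed

section \<open>Summation by parts and Dirichlet's test\<close>

text \<open>After summation by parts the boundary terms contribute at most B (g a + g b) and the
  telescoping differences at most B (g a - g b), which explains the factor 2.\<close>

lemma abel_summation_bound:
  fixes c g :: "nat \<Rightarrow> real"
  assumes B: "\<And>N. \<bar>\<Sum>n<N. c n\<bar> \<le> B"
    and mono: "\<And>n. n \<ge> a \<Longrightarrow> g (Suc n) \<le> g n" and nonneg: "\<And>n. n \<ge> a \<Longrightarrow> 0 \<le> g n"
    and "a \<le> b"
  shows "\<bar>\<Sum>n=a..<b. c n * g n\<bar> \<le> 2 * B * g a"
proof -
  define C where "C = (\<lambda>N. \<Sum>n<N. c n)"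
  have C: "\<bar>C N\<bar> \<le> B" for N using B by (simp add: C_def)
  have B0: "0 \<le> B" using C[of 0] by linarith
  have eq: "(\<Sum>n=a..<b. c n * g n) = C b * g b - C a * g a + (\<Sum>n=a..<b. C (Suc n) * (g n - g (Suc n)))"
    using \<open>a \<le> b\<close> by (induction b rule: dec_induct) (simp_all add: C_def algebra_simps)
  have "\<bar>\<Sum>n=a..<b. C (Suc n) * (g n - g (Suc n))\<bar> \<le> (\<Sum>n=a..<b. \<bar>C (Suc n) * (g n - g (Suc n))\<bar>)"
    by (rule sum_abs)
  also have "\<dots> \<le> (\<Sum>n=a..<b. B * (g n - g (Suc n)))"
    using mono C by (intro sum_mono) (auto simp: abs_mult intro!: mult_mono B0)
  also have "\<dots> = B * (g a - g b)"
    using \<open>a \<le> b\<close> by (induction b rule: dec_induct) (simp_all add: algebra_simps)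
  finally have 1: "\<bar>\<Sum>n=a..<b. C (Suc n) * (g n - g (Suc n))\<bar> \<le> B * (g a - g b)" .
  have "\<bar>C b * g b\<bar> \<le> B * g b" "\<bar>C a * g a\<bar> \<le> B * g a"
    using C nonneg \<open>a \<le> b\<close> by (auto simp: abs_mult intro!: mult_right_mono)
  with 1 show ?thesis unfolding eq by (simp add: algebra_simps)
qed

text \<open>Monotonicity starts only at \<open>a\<close> because the weights misbehave at first:
  \<open>real n powr (- s)\<close> is 0 at n = 0, and the weights with a logarithm are treated from
  n = 3 on.\<close>

lemma dirichlet_test:
  fixes c g :: "nat \<Rightarrow> real"
  assumes B: "\<And>N. \<bar>\<Sum>n<N. c n\<bar> \<le> B"
    and mono: "\<And>n. n \<ge> a \<Longrightarrow> g (Suc n) \<le> g n" and lim: "g \<longlonglongrightarrow> 0"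
  shows "summable (\<lambda>n. c n * g n)"
    and "k \<ge> a \<Longrightarrow> \<bar>(\<Sum>n. c n * g n) - (\<Sum>n<k. c n * g n)\<bar> \<le> 2 * B * g k"
proof -
  have anti: "g m \<le> g n" if "a \<le> n" "n \<le> m" for m n
    using that(2,1) by (induction m rule: dec_induct) (auto intro: order_trans[OF mono])
  have nonneg: "0 \<le> g n" if "n \<ge> a" for n
    by (rule tendsto_upperbound[OF lim]) (use anti that eventually_ge_at_top in \<open>auto intro!: eventually_sequentiallyI\<close>)
  have bd: "\<bar>\<Sum>n=k..<m. c n * g n\<bar> \<le> 2 * B * g k" if "a \<le> k" "k \<le> m" for k m
    using that by (intro abel_summation_bound[OF B] mono nonneg) auto
  show sm: "summable (\<lambda>n. c n * g n)"
    unfolding summable_Cauchy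
  proof (intro allI impI)
    fix e :: real assume e: "e > 0"
    have "(\<lambda>n. 2 * B * g n) \<longlonglongrightarrow> 0" using tendsto_mult_left[OF lim, of "2 * B"] by simp
    hence "eventually (\<lambda>n. 2 * B * g n < e) sequentially" using e by (rule order_tendstoD)
    then obtain N where N: "\<And>n. n \<ge> N \<Longrightarrow> 2 * B * g n < e" by (auto simp: eventually_sequentially)
    show "\<exists>N. \<forall>m\<ge>N. \<forall>n. norm (\<Sum>n=m..<n. c n * g n) < e"
    proof (intro exI[of _ "max a N"] allI impI)
      fix m n assume m: "m \<ge> max a N"
      show "norm (\<Sum>n=m..<n. c n * g n) < e"
        using bd[of m n] N[of m] m e by (cases "m \<le> n") auto
    qed
  qed
  assume k: "k \<ge> a"
  have "(\<lambda>m. \<bar>(\<Sum>n<m. c n * g n) - (\<Sum>n<k. c n * g n)\<bar>) \<longlonglongrightarrow> \<bar>(\<Sum>n. c n * g n) - (\<Sum>n<k. c n * g n)\<bar>"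
    by (intro tendsto_intros summable_LIMSEQ sm)
  moreover have "eventually (\<lambda>m. \<bar>(\<Sum>n<m. c n * g n) - (\<Sum>n<k. c n * g n)\<bar> \<le> 2 * B * g k) sequentially"
    using eventually_ge_at_top[of k]
  proof eventually_elim
    case (elim m)
    have "(\<Sum>n<m. c n * g n) - (\<Sum>n<k. c n * g n) = (\<Sum>n=k..<m. c n * g n)"
      using elim by (simp add: lessThan_atLeast0 sum_diff_nat_ivl)
    thus ?case using bd[OF k elim] by simp
  qed
  ultimately show "\<bar>(\<Sum>n. c n * g n) - (\<Sum>n<k. c n * g n)\<bar> \<le> 2 * B * g k"
    by (rule tendsto_upperbound) simp
qed

section \<open>Real characters to a modulus\<close>

text \<open>Zeros are not prescribed at arguments sharing a factor with the modulus, so the same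
  function is also a character to every positive multiple of \<open>M\<close>. This allows a common
  modulus for all characters at once.\<close>

definition real_character :: "nat \<Rightarrow> (nat \<Rightarrow> real) \<Rightarrow> bool" where
  "real_character M \<xi> \<longleftrightarrow> 0 < M \<and> \<xi> 1 = 1 \<and> (\<forall>a b. \<xi> (a * b) = \<xi> a * \<xi> b) \<and>
     (\<forall>a. \<xi> (a + M) = \<xi> a) \<and> (\<forall>a. \<xi> a \<in> {-1, 0, 1})"

lemma real_character_mult: "real_character M \<xi> \<Longrightarrow> \<xi> (a * b) = \<xi> a * \<xi> b"
  and real_character_pos: "real_character M \<xi> \<Longrightarrow> 0 < M"
  and real_character_one: "real_character M \<xi> \<Longrightarrow> \<xi> 1 = 1"
  and real_character_values: "real_character M \<xi> \<Longrightarrow> \<xi> a \<in> {-1, 0, 1}"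
  by (auto simp: real_character_def)

lemma real_character_abs_le: "real_character M \<xi> \<Longrightarrow> \<bar>\<xi> a\<bar> \<le> 1"
  using real_character_values[of M \<xi> a] by auto

lemma real_character_power: "real_character M \<xi> \<Longrightarrow> \<xi> (a ^ k) = \<xi> a ^ k"
  by (induction k) (simp_all add: real_character_mult real_character_one[simplified])

lemma real_character_add_mult:
  assumes "real_character M \<xi>"
  shows "\<xi> (a + k * M) = \<xi> a"
proof (induction k)
  case (Suc k)
  have "\<xi> (a + Suc k * M) = \<xi> ((a + k * M) + M)" by (simp add: algebra_simps)
  also have "\<dots> = \<xi> a" using assms Suc by (simp add: real_character_def)
  finally show ?case .
qed simp

lemma real_character_mod:
  assumes "real_character M \<xi>"
  shows "\<xi> (a mod M) = \<xi> a"
  using real_character_add_mult[OF assms, of "a mod M" "a div M"] by simp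

lemma real_character_cong:
  assumes "real_character M \<xi>" "[a = b] (mod M)"
  shows "\<xi> a = \<xi> b"
  using real_character_mod[OF assms(1)] assms(2) by (metis cong_def)

lemma real_character_coprime_nonzero:
  assumes "real_character M \<xi>" "coprime a M"
  shows "\<xi> a \<noteq> 0"
proof
  assume 0: "\<xi> a = 0"
  obtain b where "[a * b = 1] (mod M)"
    using cong_solve_coprime_nat[OF assms(2)] by auto
  hence "\<xi> a * \<xi> b = 1"
    using real_character_cong[OF assms(1)] by (metis real_character_mult real_character_one assms(1))
  thus False using 0 by simp
qed

lemma real_character_prod:
  assumes "finite T" "0 < M" "\<And>j. j \<in> T \<Longrightarrow> real_character M (\<psi> j)"
  shows "real_character M (\<lambda>n. \<Prod>j\<in>T. \<psi> j n)"
  using assms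
proof (induction T rule: finite_induct)
  case (insert j T)
  hence j: "real_character M (\<psi> j)" and T: "real_character M (\<lambda>n. \<Prod>j\<in>T. \<psi> j n)" by auto
  have "\<psi> j a * (\<Prod>j\<in>T. \<psi> j a) \<in> {-1, 0, 1}" for a
    using real_character_values[OF j, of a] real_character_values[OF T, of a] by auto
  hence "real_character M (\<lambda>n. \<psi> j n * (\<Prod>j\<in>T. \<psi> j n))"
    using j T unfolding real_character_def by (simp add: mult_ac del: insert_iff)
  moreover have "(\<lambda>n. \<Prod>j\<in>insert j T. \<psi> j n) = (\<lambda>n. \<psi> j n * (\<Prod>j\<in>T. \<psi> j n))"
    using insert(1,2) by (intro ext) (rule prod.insert)
  ultimately show ?case by simp
qed (auto simp: real_character_def)

text \<open>Multiplication by \<open>n0\<close> permutes the residues modulo \<open>M\<close> and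
  negates every value, so the sum equals its own negative.\<close>

lemma real_character_period_sum:
  assumes "real_character M \<xi>" "coprime n0 M" "\<xi> n0 = -1"
  shows "(\<Sum>n<M. \<xi> n) = 0"
proof -
  have M: "M > 0" using assms real_character_pos by blast
  have inj: "inj_on (\<lambda>n. n0 * n mod M) {..<M}"
  proof (rule inj_onI)
    fix x y assume xy: "x \<in> {..<M}" "y \<in> {..<M}" "n0 * x mod M = n0 * y mod M"
    hence "[n0 * x = n0 * y] (mod M)" by (simp add: cong_def)
    hence "[x = y] (mod M)" using assms(2) by (simp add: cong_mult_lcancel_nat)
    thus "x = y" using xy by (simp add: cong_def)
  qed
  have "(\<lambda>n. n0 * n mod M) ` {..<M} = {..<M}"
    by (rule endo_inj_surj[OF _ _ inj]) (use M in auto)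
  hence "(\<Sum>n<M. \<xi> n) = (\<Sum>n<M. \<xi> (n0 * n mod M))"
    using sum.reindex[OF inj, of \<xi>] by simp
  also have "\<dots> = (\<Sum>n<M. - \<xi> n)"
    using assms(1,3) by (simp add: real_character_mod real_character_mult)
  finally show ?thesis by (simp add: sum_negf)
qed

text \<open>Complete periods cancel, and fewer than \<open>M\<close> terms of absolute value at most
  1 are left.\<close>

lemma real_character_partial_sum_le:
  assumes "real_character M \<xi>" "coprime n0 M" "\<xi> n0 = -1"
  shows "\<bar>\<Sum>n<N. \<xi> n\<bar> \<le> real M"
proof -
  have M: "M > 0" using assms real_character_pos by blast
  have block: "(\<Sum>n = k * M..<k * M + l. \<xi> n) = (\<Sum>n<l. \<xi> n)" for k l
    using sum.shift_bounds_nat_ivl[of \<xi> 0 "k * M" l] real_character_add_mult[OF assms(1)]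
    by (simp add: lessThan_atLeast0 add_ac)
  have "(\<Sum>n<N. \<xi> n) = (\<Sum>n<(N div M) * M. \<xi> n) + (\<Sum>n = (N div M) * M..<(N div M) * M + N mod M. \<xi> n)"
    by (simp add: lessThan_atLeast0 sum.atLeastLessThan_concat)
  also have "(\<Sum>n<(N div M) * M. \<xi> n) = 0"
    unfolding sum.nat_group[symmetric] block by (simp add: real_character_period_sum[OF assms])
  also have "(\<Sum>n = (N div M) * M..<(N div M) * M + N mod M. \<xi> n) = (\<Sum>n<N mod M. \<xi> n)"
    by (rule block)
  also have "\<bar>0 + (\<Sum>n<N mod M. \<xi> n)\<bar> \<le> (\<Sum>n<N mod M. 1)"
    unfolding add_0_left using real_character_abs_le[OF assms(1)] by (intro order_trans[OF sum_abs] sum_mono)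
  also have "\<dots> \<le> real M" using M by (simp add: less_imp_le)
  finally show ?thesis .
qed

section \<open>Divisor sums of characters\<close>

text \<open>Splitting a divisor into its p-part and the rest is the induction step for divisor sums,
  both of characters and of the Liouville function.\<close>

lemma sum_divisors_prime_power_mult:
  fixes h :: "nat \<Rightarrow> 'a::comm_monoid_add"
  assumes "prime p" "\<not> p dvd m"
  shows "(\<Sum>d | d dvd p ^ k * m. h d) = (\<Sum>i\<le>k. \<Sum>d | d dvd m. h (p ^ i * d))"
proof -
  have m: "m \<noteq> 0" using assms by (metis dvd_0_right)
  have p: "p \<noteq> 0" "\<not> is_unit p" using assms by auto
  have mult: "multiplicity p d = 0" if "d dvd m" for d
    using that assms(2) by (meson dvd_trans not_dvd_imp_multiplicity_0)
  have "(\<Sum>d | d dvd p ^ k * m. h d) = (\<Sum>(i, d)\<in>{..k} \<times> {d. d dvd m}. h (p ^ i * d))"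
  proof (rule sum.reindex_bij_witness[of _ "\<lambda>(i, d). p ^ i * d"
        "\<lambda>e. (multiplicity p e, e div p ^ multiplicity p e)"], goal_cases)
    case (1 e)
    thus ?case by (simp add: multiplicity_dvd)
  next
    case (2 e)
    hence e: "e dvd p ^ k * m" by simp
    hence e0: "e \<noteq> 0" using m p by (metis dvd_0_left_iff mult_eq_0_iff power_not_zero)
    obtain y where y: "e = p ^ multiplicity p e * y" "\<not> p dvd y"
      using multiplicity_decompose'[OF e0 p(2)] by blast
    have "multiplicity p e \<le> multiplicity p (p ^ k * m)"
      using e m p by (intro dvd_imp_multiplicity_le) auto
    also have "\<dots> = k"
      using assms m p mult[of m] by (subst prime_elem_multiplicity_mult_distrib) (auto simp: multiplicity_same_power)
    finally have 1: "multiplicity p e \<le> k" .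
    have "y dvd p ^ k * m" using e y by (metis dvd_mult_right)
    moreover have "coprime y (p ^ k)"
      using y(2) assms(1) by (metis coprime_commute coprime_power_right_iff prime_imp_coprime)
    ultimately have "y dvd m" by (simp add: coprime_dvd_mult_right_iff)
    moreover have "e div p ^ multiplicity p e = y" using y(1) p by (metis nonzero_mult_div_cancel_left power_not_zero)
    ultimately show ?case using 1 by simp
  next
    case (3 x)
    obtain i d where x: "x = (i, d)" by force
    have d: "d dvd m" using 3 x by simp
    hence "d \<noteq> 0" using m by auto
    hence "multiplicity p (p ^ i * d) = i"
      using assms p mult[OF d] by (subst prime_elem_multiplicity_mult_distrib) (auto simp: multiplicity_same_power)
    thus ?case using p by (simp add: x)
  next
    case (4 x)
    thus ?case by (auto intro!: mult_dvd_mono le_imp_power_dvd)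
  next
    case (5 e)
    thus ?case by (simp add: multiplicity_dvd)
  qed
  thus ?thesis by (simp add: sum.cartesian_product)
qed

lemma sum_power_character:
  assumes "x \<in> {-1, 0, 1 :: real}"
  shows "0 \<le> (\<Sum>i\<le>k. x ^ i)" "even k \<Longrightarrow> 1 \<le> (\<Sum>i\<le>k. x ^ i)"
proof -
  have "(\<Sum>i\<le>k. (-1 :: real) ^ i) = (if even k then 1 else 0)" by (induction k) auto
  moreover have "(\<Sum>i\<le>k. (0 :: real) ^ i) = 1" by (induction k) auto
  ultimately show "0 \<le> (\<Sum>i\<le>k. x ^ i)" "even k \<Longrightarrow> 1 \<le> (\<Sum>i\<le>k. x ^ i)"
    using assms by auto
qed

text \<open>The divisor sum is multiplicative, and a prime power p^k contributes the sum of
  \<xi>(p)^i for i <= k. This is nonnegative for each of the three values of \<xi>(p), and at least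
  1 when k is even; in a square all exponents are even.\<close>

lemma real_character_divisor_sum:
  assumes "real_character M \<xi>" "m > 0"
  shows "0 \<le> (\<Sum>d | d dvd m. \<xi> d) \<and> ((\<exists>j. m = j ^ 2) \<longrightarrow> 1 \<le> (\<Sum>d | d dvd m. \<xi> d))"
  using assms(2)
proof (induction m rule: less_induct)
  case (less m)
  show ?case
  proof (cases "m = 1")
    case True
    thus ?thesis using real_character_one[OF assms(1)] by simp
  next
    case False
    then obtain p where p: "prime p" "p dvd m" using prime_factor_nat by blast
    have u: "\<not> is_unit p" using p by auto
    obtain y where y: "m = p ^ multiplicity p m * y" "\<not> p dvd y"
      using multiplicity_decompose'[of m p] less.prems u by auto
    define k where "k = multiplicity p m"
    have k: "k > 0" using p less.prems u by (auto simp: k_def multiplicity_gt_zero_iff)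
    have y0: "y > 0" using y less.prems by (auto intro: Nat.gr0I)
    have "p ^ k > 1" using k p by (metis one_less_power prime_gt_1_nat)
    hence "y < m" using y(1) y0 unfolding k_def[symmetric] by (metis mult_less_cancel2 nat_mult_1)
    note IH = less.IH[OF this y0]
    have eq: "(\<Sum>d | d dvd m. \<xi> d) = (\<Sum>i\<le>k. \<xi> p ^ i) * (\<Sum>d | d dvd y. \<xi> d)"
      unfolding y(1)[folded k_def] sum_divisors_prime_power_mult[OF p(1) y(2)]
      by (simp add: real_character_mult[OF assms(1)] real_character_power[OF assms(1)] sum_product)
    have "1 \<le> (\<Sum>d | d dvd m. \<xi> d)" if "m = j ^ 2" for j
    proof -
      have j0: "j \<noteq> 0" using that less.prems by (metis power_zero_numeral less_irrefl)
      have "k = 2 * multiplicity p j"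
        using j0 p unfolding k_def that by (subst prime_elem_multiplicity_power_distrib) auto
      moreover have "\<exists>i. y = i ^ 2"
      proof -
        obtain i where i: "j = p ^ multiplicity p j * i"
          using multiplicity_decompose'[OF j0 u] by blast
        have "p ^ k * y = p ^ k * i ^ 2"
          using y(1)[folded k_def] that i \<open>k = 2 * multiplicity p j\<close>
          by (metis power_mult power_mult_distrib mult.commute)
        moreover have "p ^ k \<noteq> 0" using \<open>1 < p ^ k\<close> by linarith
        ultimately show ?thesis by auto
      qed
      ultimately have "1 \<le> (\<Sum>i\<le>k. \<xi> p ^ i)" "1 \<le> (\<Sum>d | d dvd y. \<xi> d)"
        using IH sum_power_character(2)[OF real_character_values[OF assms(1)]] by auto
      thus ?thesis unfolding eq using mult_mono[of 1 _ 1] by fastforce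
    qed
    moreover have "0 \<le> (\<Sum>d | d dvd m. \<xi> d)"
      unfolding eq using IH sum_power_character(1)[OF real_character_values[OF assms(1)]] by simp
    ultimately show ?thesis by blast
  qed
qed

text \<open>Pairing the terms $x^i$ and $x^{n-1-i}$ with $x = y^2$.\<close>
lemma geometric_sum_ge:
  fixes y :: real
  assumes "0 \<le> y" "y \<le> 1"
  shows "(\<Sum>i<n. (y ^ 2) ^ i) \<ge> real n * y ^ n"
proof -
  have "2 * (\<Sum>i<n. (y ^ 2) ^ i) = (\<Sum>i<n. (y ^ 2) ^ i) + (\<Sum>i<n. (y ^ 2) ^ (n - Suc i))"
    by (subst sum.nat_diff_reindex) simp
  also have "\<dots> = (\<Sum>i<n. (y ^ i) ^ 2 + (y ^ (n - Suc i)) ^ 2)"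
    by (simp add: sum.distrib power_mult[symmetric] mult.commute)
  also have "\<dots> \<ge> (\<Sum>i<n. 2 * y ^ n)"
  proof (rule sum_mono)
    fix i assume i: "i \<in> {..<n}"
    have "y ^ n \<le> y ^ (n - 1)" using assms by (intro power_decreasing) auto
    also have "\<dots> = y ^ i * y ^ (n - Suc i)" using i by (simp flip: power_add)
    finally have "2 * y ^ n \<le> 2 * (y ^ i * y ^ (n - Suc i))" by simp
    also have "\<dots> \<le> (y ^ i) ^ 2 + (y ^ (n - Suc i)) ^ 2"
      using sum_squares_bound[of "y ^ i" "y ^ (n - Suc i)"] by (simp add: mult_ac)
    finally show "2 * y ^ n \<le> (y ^ i) ^ 2 + (y ^ (n - Suc i)) ^ 2" .
  qed
  finally show ?thesis by simp
qed

text \<open>With A the sum of x^i for i < n and B the sum for i <= n, clearing denominators reduces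
  the claim to n (n + 1) x^n <= A B. For y = sqrt x, pairing opposite terms gives A >= n y^n and B
  >= (n + 1) y^n, and the product of these bounds is n (n + 1) x^n.\<close>

lemma monsky_decreasing:
  fixes x :: real
  assumes x: "0 < x" "x < 1" and n: "n > 0"
  shows "1 / (real (Suc n) * (1 - x)) - x ^ Suc n / (1 - x ^ Suc n) \<le> 1 / (real n * (1 - x)) - x ^ n / (1 - x ^ n)"
proof -
  define y where "y = sqrt x"
  have y: "0 < y" "y < 1" "y ^ 2 = x" using x by (auto simp: y_def)
  define A where "A = (\<Sum>i<n. x ^ i)"
  define B where "B = (\<Sum>i<Suc n. x ^ i)"
  have A: "A \<ge> real n * y ^ n" and B: "B \<ge> real (Suc n) * y ^ n"
  proof -
    show "A \<ge> real n * y ^ n" using geometric_sum_ge[of y n] y by (simp add: A_def)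
    have "B = x ^ n + A" by (simp add: A_def B_def)
    have "2 * B = (\<Sum>i<Suc n. x ^ i) + (\<Sum>i<Suc n. x ^ (Suc n - Suc i))"
      unfolding B_def by (subst sum.nat_diff_reindex) simp
    also have "\<dots> = (\<Sum>i<Suc n. (y ^ i) ^ 2 + (y ^ (n - i)) ^ 2)"
      by (simp add: sum.distrib power_mult[symmetric] mult.commute flip: y(3))
    also have "\<dots> \<ge> (\<Sum>i<Suc n. 2 * y ^ n)"
    proof (rule sum_mono)
      fix i assume i: "i \<in> {..<Suc n}"
      hence "2 * y ^ n = 2 * (y ^ i * y ^ (n - i))" by (simp flip: power_add)
      thus "2 * y ^ n \<le> (y ^ i) ^ 2 + (y ^ (n - i)) ^ 2"
        using sum_squares_bound[of "y ^ i" "y ^ (n - i)"] by (simp add: mult_ac)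
    qed
    finally show "B \<ge> real (Suc n) * y ^ n" by simp
  qed
  have "real n * real (Suc n) * x ^ n = (real n * y ^ n) * (real (Suc n) * y ^ n)"
    by (simp add: power_mult[symmetric] power2_eq_square power_mult_distrib flip: y(3))
  also have "\<dots> \<le> A * B" using A B y by (intro mult_mono) (auto intro: order_trans[rotated])
  finally have AB: "real n * real (Suc n) * x ^ n \<le> A * B" .
  have pos: "A > 0" "B > 0" using A B y n by (auto intro: less_le_trans[rotated])
  have eqA: "1 - x ^ n = (1 - x) * A" unfolding A_def by (rule one_diff_power_eq)
  have eqB: "1 - x ^ Suc n = (1 - x) * B" unfolding B_def by (rule one_diff_power_eq)
  have ne: "1 - x \<noteq> 0" using x by simp
  have "x ^ n / (1 - x ^ n) - x ^ Suc n / (1 - x ^ Suc n) = x ^ n * (1 - x) / ((1 - x ^ n) * (1 - x ^ Suc n))"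
  proof -
    have "1 - x ^ n \<noteq> 0" "1 - x ^ Suc n \<noteq> 0" unfolding eqA eqB using pos ne by simp_all
    thus ?thesis by (subst diff_frac_eq) (simp_all add: algebra_simps)
  qed
  also have "\<dots> = (x ^ n / (A * B)) / (1 - x)" 
  proof -
    have "x ^ n * u / (u * A * (u * B)) = x ^ n / (A * B) / u" if "u \<noteq> 0" for u
      using pos that by (simp add: field_simps)
    from this[OF ne] show ?thesis unfolding eqA eqB .
  qed
  also have "\<dots> \<le> (1 / (real n * real (Suc n))) / (1 - x)"
    using AB pos x n by (intro divide_right_mono) (simp_all add: divide_simps mult_ac)
  also have "\<dots> = 1 / (real n * (1 - x)) - 1 / (real (Suc n) * (1 - x))"
    using ne n by (simp add: divide_simps)
  finally show ?thesis by simp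
qed

section \<open>The L-series of a nonprincipal character at 1\<close>

text \<open>The index n = 0 is harmless because \<open>0 powr (- s) = 0\<close>.\<close>

definition char_L :: "(nat \<Rightarrow> real) \<Rightarrow> real \<Rightarrow> real" where
  "char_L \<xi> s = (\<Sum>n. \<xi> n * real n powr (- s))"

lemma tendsto_powr_minus_nat:
  assumes "s > 0"
  shows "(\<lambda>n. real n powr (- s)) \<longlonglongrightarrow> 0"
  using assms by (intro tendsto_neg_powr filterlim_real_sequentially) auto

lemma powr_minus_Suc_le: "n \<ge> 1 \<Longrightarrow> s \<ge> 0 \<Longrightarrow> real (Suc n) powr (- s) \<le> real n powr (- s)"
  by (intro powr_mono2') auto

locale nonprincipal_character =
  fixes M :: nat and \<xi> :: "nat \<Rightarrow> real" and n0 :: nat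
  assumes character: "real_character M \<xi>"
    and coprime_n0: "coprime n0 M" and n0: "\<xi> n0 = -1"
begin

lemmas partial_sum_le = real_character_partial_sum_le[OF character coprime_n0 n0]

lemma char_L_tail:
  assumes "s > 0" "k \<ge> 1"
  shows "\<bar>char_L \<xi> s - (\<Sum>n<k. \<xi> n * real n powr (- s))\<bar> \<le> 2 * real M * real k powr (- s)"
  unfolding char_L_def
  by (rule dirichlet_test(2)[OF partial_sum_le, of 1])
     (use assms powr_minus_Suc_le tendsto_powr_minus_nat in auto)

text \<open>The tail bound at s = 1 dominates those at all larger s, so convergence is uniform up to
  and including the point 1.\<close>

lemma continuous_char_L: "continuous_on {1..} (char_L \<xi>)"
proof (rule uniform_limit_theorem)
  show "uniform_limit {1..} (\<lambda>k s. \<Sum>n<k. \<xi> n * real n powr (- s)) (char_L \<xi>) sequentially"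
  proof (rule uniform_limitI)
    fix e :: real assume e: "e > 0"
    have "(\<lambda>k. 2 * real M * real k powr (- 1)) \<longlonglongrightarrow> 0"
      using tendsto_mult_left[OF tendsto_powr_minus_nat[of 1], of "2 * real M"] by simp
    hence "eventually (\<lambda>k. 2 * real M * real k powr (- 1) < e) sequentially"
      using e by (rule order_tendstoD)
    thus "\<forall>\<^sub>F k in sequentially. \<forall>s\<in>{1..}. dist (\<Sum>n<k. \<xi> n * real n powr (- s)) (char_L \<xi> s) < e"
      using eventually_ge_at_top[of 1]
    proof eventually_elim
      case (elim k)
      show ?case
      proof
        fix s :: real assume s: "s \<in> {1..}"
        have "real k powr (- s) \<le> real k powr (- 1)"
          using s elim by (intro powr_mono) auto
        hence "2 * real M * real k powr (- s) \<le> 2 * real M * real k powr (- 1)"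
          by (intro mult_left_mono) auto
        thus "dist (\<Sum>n<k. \<xi> n * real n powr (- s)) (char_L \<xi> s) < e"
          using char_L_tail[of s k] s elim by (simp add: dist_real_def abs_minus_commute)
      qed
    qed
  qed
  show "\<forall>\<^sub>F k in sequentially. continuous_on {1..} (\<lambda>s. \<Sum>n<k. \<xi> n * real n powr (- s))"
  proof (intro always_eventually allI continuous_on_sum)
    show "continuous_on {1..} (\<lambda>s. \<xi> n * real n powr (- s))" for n
    proof (cases "n = 0")
      case False
      thus ?thesis
        by (intro continuous_on_mult continuous_on_const continuous_on_powr continuous_on_minus continuous_on_id) auto
    qed simp
  qed
qed simp

text \<open>Each x^n / (1 - x^n) is the geometric series of x^(nk) over k >= 1; collecting the
  double series by m = nk produces the divisor sums.\<close>

lemma lambert_series_sums: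
  assumes x: "0 < x" "x < 1"
  shows "((\<lambda>m. (\<Sum>d | d dvd m. \<xi> d) * x ^ m) has_sum (\<Sum>\<^sub>\<infinity>n\<in>{0<..}. \<xi> n * (x ^ n / (1 - x ^ n)))) {0<..}"
    and "(\<lambda>n. \<xi> n * (x ^ n / (1 - x ^ n))) summable_on {0<..}"
proof -
  have inner: "((\<lambda>k. x ^ (n * k)) has_sum (x ^ n / (1 - x ^ n))) {0<..}" if "n > 0" for n :: nat
  proof -
    have xn: "x ^ n < 1" using x that by (simp add: power_less_one_iff)
    have "((\<lambda>k. (x ^ n) ^ k) has_sum 1 / (1 - x ^ n)) UNIV"
      using geometric_sums[of "x ^ n"] xn x by (intro sums_nonneg_imp_has_sum) auto
    hence "((\<lambda>k. x ^ n * (x ^ n) ^ k) has_sum x ^ n * (1 / (1 - x ^ n))) UNIV"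
      by (rule has_sum_cmult_right)
    also have "?this \<longleftrightarrow> ((\<lambda>k. x ^ (n * k)) has_sum (x ^ n / (1 - x ^ n))) {0<..}"
      by (rule has_sum_reindex_bij_witness[of _ "\<lambda>k. k - 1" Suc]) (auto simp: power_mult power_add)
    finally show ?thesis .
  qed
  have "(\<lambda>n. x ^ n / (1 - x ^ n)) summable_on {0<..}"
  proof (rule summable_on_comparison_test)
    have "((\<lambda>n. x ^ n) has_sum 1 / (1 - x)) UNIV"
      using geometric_sums[of x] x by (intro sums_nonneg_imp_has_sum) auto
    hence "(\<lambda>n. x ^ n) summable_on {0<..}"
      by (meson has_sum_imp_summable subset_UNIV summable_on_subset_banach)
    thus "(\<lambda>n. 1 / (1 - x) * x ^ n) summable_on {0<..}" by (rule summable_on_cmult_right)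
    fix n :: nat assume "n \<in> {0<..}"
    hence "x ^ n \<le> x ^ 1" using x by (intro power_decreasing) auto
    hence "x ^ n / (1 - x ^ n) \<le> x ^ n / (1 - x)" using x by (intro divide_left_mono) auto
    thus "x ^ n / (1 - x ^ n) \<le> 1 / (1 - x) * x ^ n" by simp
    show "0 \<le> x ^ n / (1 - x ^ n)" using x by (simp add: power_le_one)
  qed
  hence ps: "(\<lambda>(n, k). x ^ (n * k)) summable_on ({0<..} \<times> {0<..})"
    using inner x by (intro summable_on_SigmaI[where g = "\<lambda>n. x ^ n / (1 - x ^ n)"]) auto
  have *: "(\<lambda>(n, k). \<xi> n * x ^ (n * k)) summable_on ({0<..} \<times> {0<..})"
  proof (rule abs_summable_summable, rule summable_on_comparison_test[OF ps])
    fix p :: "nat \<times> nat"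
    have "\<bar>\<xi> (fst p)\<bar> * x ^ (fst p * snd p) \<le> 1 * x ^ (fst p * snd p)"
      using real_character_abs_le[OF character] x by (intro mult_right_mono) auto
    thus "norm (case p of (n, k) \<Rightarrow> \<xi> n * x ^ (n * k)) \<le> (case p of (n, k) \<Rightarrow> x ^ (n * k))"
      using x by (simp add: case_prod_unfold abs_mult)
  qed simp
  have inner': "((\<lambda>k. \<xi> n * x ^ (n * k)) has_sum \<xi> n * (x ^ n / (1 - x ^ n))) {0<..}" if "n > 0" for n
    using inner[OF that] by (rule has_sum_cmult_right)
  have hs: "((\<lambda>n. \<xi> n * (x ^ n / (1 - x ^ n))) has_sum (\<Sum>\<^sub>\<infinity>(n, k)\<in>{0<..} \<times> {0<..}. \<xi> n * x ^ (n * k))) {0<..}"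
    by (rule has_sum_SigmaD[OF has_sum_infsum[OF *]]) (use inner' in auto)
  thus "(\<lambda>n. \<xi> n * (x ^ n / (1 - x ^ n))) summable_on {0<..}" by (rule has_sum_imp_summable)
  have "((\<lambda>(n, k). \<xi> n * x ^ (n * k)) has_sum (\<Sum>\<^sub>\<infinity>n\<in>{0<..}. \<xi> n * (x ^ n / (1 - x ^ n)))) ({0<..} \<times> {0<..})"
    using has_sum_infsum[OF *] infsumI[OF hs] by simp
  from has_sum_divisors[OF this]
  have "((\<lambda>m. \<Sum>d | d dvd m. \<xi> d * x ^ (d * (m div d))) has_sum (\<Sum>\<^sub>\<infinity>n\<in>{0<..}. \<xi> n * (x ^ n / (1 - x ^ n)))) {0<..}" .
  thus "((\<lambda>m. (\<Sum>d | d dvd m. \<xi> d) * x ^ m) has_sum (\<Sum>\<^sub>\<infinity>n\<in>{0<..}. \<xi> n * (x ^ n / (1 - x ^ n)))) {0<..}"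
    by (rule has_sum_cong[THEN iffD1, rotated]) (auto simp: sum_distrib_right intro!: sum.cong)
qed

text \<open>The Lambert series $\sum \chi(n) x^n/(1-x^n)$ is unbounded as $x \to 1$, being at least $\sum x^{j^2}$;
  if $L(1,\chi)$ vanished, subtracting $L(1,\chi)/(1-x)$ would bound it by the Dirichlet test
  (Monsky's argument).\<close>
lemma char_L_one_nonzero: "char_L \<xi> 1 \<noteq> 0"
proof
  assume L: "char_L \<xi> 1 = 0"
  \<comment> \<open>Each of the first \<open>J\<close> squares will contribute at least 1/2, a total
    of 2M + 2, which beats the upper bound 2M.\<close>
  define J where "J = 4 * M + 4"
  obtain x :: real where x: "0 < x" "x < 1" and xJ: "1 / 2 \<le> x ^ (J\<^sup>2)"
  proof -
    have "((\<lambda>x::real. x ^ (J\<^sup>2)) \<longlongrightarrow> 1 ^ (J\<^sup>2)) (at_left 1)" by (intro tendsto_intros)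
    hence "eventually (\<lambda>x::real. x ^ (J\<^sup>2) > 1 / 2) (at_left 1)" by (intro order_tendstoD) auto
    moreover have "eventually (\<lambda>x::real. x \<in> {0<..<1}) (at_left 1)"
      by (rule eventually_at_left_real) simp
    ultimately have "eventually (\<lambda>x::real. x ^ (J\<^sup>2) > 1 / 2 \<and> x \<in> {0<..<1}) (at_left 1)"
      by eventually_elim simp
    from eventually_happens[OF this] show ?thesis using that by fastforce
  qed
  define F where "F = (\<Sum>\<^sub>\<infinity>n\<in>{0<..}. \<xi> n * (x ^ n / (1 - x ^ n)))"
  define b where "b = (\<lambda>n. 1 / (real n * (1 - x)) - x ^ n / (1 - x ^ n))"
  have bsum: "\<bar>(\<Sum>n. \<xi> n * b n) - (\<Sum>n<1. \<xi> n * b n)\<bar> \<le> 2 * real M * b 1"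
    and bsm: "summable (\<lambda>n. \<xi> n * b n)"
  proof -
    have lim: "b \<longlonglongrightarrow> 0"
    proof -
      have lim_pow: "(\<lambda>n. x ^ n) \<longlonglongrightarrow> 0" using x by (intro LIMSEQ_power_zero) auto
      hence "(\<lambda>n. inverse (real n) * (1 / (1 - x)) - x ^ n / (1 - x ^ n)) \<longlonglongrightarrow> 0 * (1 / (1 - x)) - 0 / (1 - 0)"
        by (intro tendsto_diff tendsto_mult tendsto_divide tendsto_const lim_inverse_n lim_pow) auto
      thus ?thesis by (simp add: b_def field_simps)
    qed
    have mono: "b (Suc n) \<le> b n" if "n \<ge> 1" for n
      unfolding b_def using monsky_decreasing[OF x] that by auto
    show "\<bar>(\<Sum>n. \<xi> n * b n) - (\<Sum>n<1. \<xi> n * b n)\<bar> \<le> 2 * real M * b 1"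
      by (rule dirichlet_test(2)[OF partial_sum_le mono lim]) auto
    show "summable (\<lambda>n. \<xi> n * b n)"
      by (rule dirichlet_test(1)[OF partial_sum_le mono lim])
  qed
  \<comment> \<open>At 0 both quotients have denominator 0 and hence the value 0; at 1 the
    difference is (1 - x) / (1 - x).\<close>
  have b0: "b 0 = 0" "b 1 = 1" using x by (auto simp: b_def field_simps)
  have sm1: "summable (\<lambda>n. \<xi> n * real n powr (- 1))"
    by (rule dirichlet_test(1)[OF partial_sum_le, of 1])
       (use powr_minus_Suc_le[of _ 1] tendsto_powr_minus_nat[of 1] in auto)
  have "(\<lambda>n. \<xi> n * real n powr (- 1)) sums 0"
    using L summable_sums[OF sm1] by (simp add: char_L_def)
  hence "(\<lambda>n. 1 / (1 - x) * (\<xi> n * real n powr (- 1))) sums (1 / (1 - x) * 0)" by (rule sums_mult)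
  from sums_diff[OF this summable_sums[OF bsm]]
  have "(\<lambda>n. 1 / (1 - x) * (\<xi> n * real n powr (- 1)) - \<xi> n * b n) sums (- (\<Sum>n. \<xi> n * b n))" by simp
  also have "(\<lambda>n. 1 / (1 - x) * (\<xi> n * real n powr (- 1)) - \<xi> n * b n) = (\<lambda>n. \<xi> n * (x ^ n / (1 - x ^ n)))"
    by (auto simp: b_def fun_eq_iff powr_minus field_simps)
  finally have "(\<lambda>n. \<xi> n * (x ^ n / (1 - x ^ n))) sums (- (\<Sum>n. \<xi> n * b n))" .
  moreover have "(\<lambda>n. \<xi> n * (x ^ n / (1 - x ^ n))) sums F"
  proof (rule has_sum_imp_sums)
    have "((\<lambda>n. \<xi> n * (x ^ n / (1 - x ^ n))) has_sum F) {0<..}"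
      unfolding F_def by (intro has_sum_infsum lambert_series_sums x)
    thus "((\<lambda>n. \<xi> n * (x ^ n / (1 - x ^ n))) has_sum F) UNIV"
      by (rule has_sum_cong_neutral[THEN iffD1, rotated -1]) auto
  qed
  ultimately have "F = - (\<Sum>n. \<xi> n * b n)" by (rule sums_unique2[symmetric])
  hence upper: "F \<le> 2 * real M" using bsum b0 by simp
  have "(\<Sum>m\<in>(\<lambda>j. j\<^sup>2) ` {1..J}. (\<Sum>d | d dvd m. \<xi> d) * x ^ m) \<le> F"
    unfolding F_def
  proof (rule has_sum_mono2[OF has_sum_finite lambert_series_sums(1)[OF x]])
    show "0 \<le> (\<Sum>d | d dvd m. \<xi> d) * x ^ m" if "m \<in> {0<..} - (\<lambda>j. j\<^sup>2) ` {1..J}" for m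
      using real_character_divisor_sum[OF character, of m] x that by auto
  qed auto
  moreover have "(\<Sum>m\<in>(\<lambda>j. j\<^sup>2) ` {1..J}. (\<Sum>d | d dvd m. \<xi> d) * x ^ m) \<ge> (\<Sum>m\<in>(\<lambda>j. j\<^sup>2) ` {1..J}. 1 * (1 / 2))"
  proof (intro sum_mono mult_mono)
    fix m assume "m \<in> (\<lambda>j. j\<^sup>2) ` {1..J}"
    then obtain j where j: "m = j\<^sup>2" "j \<in> {1..J}" by blast
    show "1 \<le> (\<Sum>d | d dvd m. \<xi> d)" "0 \<le> (\<Sum>d | d dvd m. \<xi> d)"
      using real_character_divisor_sum[OF character, of m] j by auto
    have "x ^ (J\<^sup>2) \<le> x ^ m" using x j by (intro power_decreasing power_mono) auto
    thus "1 / 2 \<le> x ^ m" using xJ by simp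
  qed auto
  moreover have "card ((\<lambda>j. j\<^sup>2) ` {1..J}) = J" by (subst card_image) (auto simp: inj_on_def)
  ultimately have "real J / 2 \<le> F" by simp
  thus False using upper by (simp add: J_def)
qed

end

section \<open>Products of Dirichlet series and the von Mangoldt function\<close>

text \<open>The factor \<open>e\<close> stands for n^(-s). Leaving it abstract lets one proof serve
  real s for the von Mangoldt function and complex s for the Liouville function.\<close>

lemma dirichlet_series_mult:
  fixes a b e :: "nat \<Rightarrow> 'a::{real_normed_field, banach}"
  assumes e0: "e 0 = 0" and e: "\<And>m n. m > 0 \<Longrightarrow> n > 0 \<Longrightarrow> e (m * n) = e m * e n"
    and a: "summable (\<lambda>n. norm (a n * e n))" and b: "summable (\<lambda>n. norm (b n * e n))"
  shows "(\<lambda>m. (\<Sum>d | d dvd m. a d * b (m div d)) * e m) sums ((\<Sum>n. a n * e n) * (\<Sum>n. b n * e n))"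
proof -
  have inf: "(\<lambda>n. norm (c n * e n)) summable_on {0<..}" "infsum (\<lambda>n. c n * e n) {0<..} = (\<Sum>n. c n * e n)"
    if "summable (\<lambda>n. norm (c n * e n))" for c
  proof -
    have "(\<lambda>n. norm (c n * e n)) summable_on UNIV"
      using that by (intro norm_summable_imp_summable_on) simp
    thus "(\<lambda>n. norm (c n * e n)) summable_on {0<..}"
      by (rule summable_on_subset_banach) simp
    have "((\<lambda>n. c n * e n) has_sum (\<Sum>n. c n * e n)) UNIV"
      using that by (intro norm_summable_imp_has_sum summable_sums summable_norm_cancel[OF that])
    hence "((\<lambda>n. c n * e n) has_sum (\<Sum>n. c n * e n)) {0<..}"
      by (rule has_sum_cong_neutral[THEN iffD1, rotated -1]) (auto simp: e0)
    thus "infsum (\<lambda>n. c n * e n) {0<..} = (\<Sum>n. c n * e n)" by (rule infsumI)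
  qed
  have "((\<lambda>(i, j). (a i * e i) * (b j * e j)) has_sum ((\<Sum>n. a n * e n) * (\<Sum>n. b n * e n))) ({0<..} \<times> {0<..})"
    using has_sum_Times_mult[OF inf(1)[OF a] inf(1)[OF b]] inf(2)[OF a] inf(2)[OF b] by simp
  from has_sum_divisors[OF this]
  have "((\<lambda>m. \<Sum>d | d dvd m. (a d * e d) * (b (m div d) * e (m div d))) has_sum
      ((\<Sum>n. a n * e n) * (\<Sum>n. b n * e n))) {0<..}" .
  hence "((\<lambda>m. (\<Sum>d | d dvd m. a d * b (m div d)) * e m) has_sum
      ((\<Sum>n. a n * e n) * (\<Sum>n. b n * e n))) {0<..}"
  proof (rule has_sum_cong[THEN iffD1, rotated])
    fix m :: nat assume "m \<in> {0<..}"
    hence "e d * e (m div d) = e m" if "d dvd m" for d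
      using that e[of d "m div d"] by (auto simp: dvd_div_eq_0_iff intro!: Nat.gr0I)
    thus "(\<Sum>d | d dvd m. (a d * e d) * (b (m div d) * e (m div d))) =
        (\<Sum>d | d dvd m. a d * b (m div d)) * e m"
      unfolding sum_distrib_right by (intro sum.cong refl) (metis (no_types, lifting) mem_Collect_eq mult.assoc mult.left_commute)
  qed
  hence "((\<lambda>m. (\<Sum>d | d dvd m. a d * b (m div d)) * e m) has_sum
      ((\<Sum>n. a n * e n) * (\<Sum>n. b n * e n))) UNIV"
    by (rule has_sum_cong_neutral[THEN iffD1, rotated -1]) (auto simp: e0)
  thus ?thesis by (rule has_sum_imp_sums)
qed

text \<open>Half of the excess s - 1 absorbs the logarithm; the remaining exponent (1 + s)/2 is
  still above 1.\<close>

lemma ln_times_powr_le: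
  assumes "s > 1" "n \<ge> 1"
  shows "ln (real n) * real n powr (- s) \<le> 2 / (s - 1) * real n powr (- ((1 + s) / 2))"
proof -
  have "ln (real n) \<le> real n powr ((s - 1) / 2) / ((s - 1) / 2)"
    using assms by (intro ln_powr_bound) auto
  hence "ln (real n) * real n powr (- s) \<le> real n powr ((s - 1) / 2) / ((s - 1) / 2) * real n powr (- s)"
    by (intro mult_right_mono) auto
  also have "\<dots> = 2 / (s - 1) * (real n powr ((s - 1) / 2) * real n powr (- s))" by simp
  also have "real n powr ((s - 1) / 2) * real n powr (- s) = real n powr (- ((1 + s) / 2))"
  proof -
    have "(s - 1) / 2 + - s = - ((1 + s) / 2)" by (simp add: field_simps)
    thus ?thesis by (simp only: powr_add[symmetric])
  qed
  finally show ?thesis .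
qed

lemma summable_ln_powr:
  assumes "s > 1"
  shows "summable (\<lambda>n. ln (real n) * real n powr (- s))"
proof (rule summable_comparison_test')
  show "summable (\<lambda>n. 2 / (s - 1) * real n powr (- ((1 + s) / 2)))"
    using assms by (intro summable_mult) (simp add: summable_real_powr_iff)
  show "norm (ln (real n) * real n powr (- s)) \<le> 2 / (s - 1) * real n powr (- ((1 + s) / 2))" if "n \<ge> 1" for n
    using ln_times_powr_le[OF assms that] that by simp
qed

lemma mangoldt_le_ln: "(mangoldt n :: real) \<le> ln (real n)"
  using mangoldt_le[of n] by (cases "n = 0") auto

lemma summable_mangoldt_powr:
  assumes "s > 1" "\<And>n. \<bar>\<xi> n\<bar> \<le> K"
  shows "summable (\<lambda>n. norm (\<xi> n * mangoldt n * real n powr (- s)))"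
proof (rule summable_comparison_test')
  show "summable (\<lambda>n. K * (ln (real n) * real n powr (- s)))"
    by (intro summable_mult summable_ln_powr assms)
  show "norm (norm (\<xi> n * mangoldt n * real n powr (- s))) \<le> K * (ln (real n) * real n powr (- s))" for n
    using assms(2)[of n] mangoldt_le_ln[of n] mangoldt_nonneg[of n]
    by (auto simp: abs_mult mult.assoc intro!: mult_mono mult_nonneg_nonneg order_trans[OF abs_ge_zero assms(2)])
qed

text \<open>This is L (-L'/L) = -L' written with Dirichlet series: the sum of
  \<open>mangoldt\<close> over the divisors of m is ln m, and the completely multiplicative \<xi>
  factors out of the convolution. No derivative of \<open>char_L\<close> enters.\<close>

lemma char_L_mangoldt:
  assumes s: "s > 1" and mult: "\<And>a b. \<xi> (a * b) = \<xi> a * \<xi> b" and bd: "\<And>n. \<bar>\<xi> n\<bar> \<le> 1"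
  shows "char_L \<xi> s * (\<Sum>n. \<xi> n * mangoldt n * real n powr (- s)) = (\<Sum>n. \<xi> n * ln (real n) * real n powr (- s))"
proof -
  have 1: "summable (\<lambda>n. norm (\<xi> n * real n powr (- s)))"
  proof (rule summable_comparison_test')
    show "summable (\<lambda>n. real n powr (- s))" using s by (simp add: summable_real_powr_iff)
    show "norm (norm (\<xi> n * real n powr (- s))) \<le> real n powr (- s)" for n
      using bd[of n] by (simp add: abs_mult mult_left_le_one_le)
  qed
  have "(\<lambda>m. (\<Sum>d | d dvd m. \<xi> d * (\<xi> (m div d) * mangoldt (m div d))) * real m powr (- s)) sums
    ((\<Sum>n. \<xi> n * real n powr (- s)) * (\<Sum>n. (\<xi> n * mangoldt n) * real n powr (- s)))"
    by (rule dirichlet_series_mult) (use 1 summable_mangoldt_powr[OF s bd] in \<open>auto simp: powr_mult\<close>)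
  also have "(\<lambda>m. (\<Sum>d | d dvd m. \<xi> d * (\<xi> (m div d) * mangoldt (m div d))) * real m powr (- s)) =
      (\<lambda>m. \<xi> m * ln (real m) * real m powr (- s))"
  proof
    fix m :: nat
    show "(\<Sum>d | d dvd m. \<xi> d * (\<xi> (m div d) * mangoldt (m div d))) * real m powr (- s) =
      \<xi> m * ln (real m) * real m powr (- s)"
    proof (cases "m = 0")
      case False
      have "(\<Sum>d | d dvd m. \<xi> d * (\<xi> (m div d) * mangoldt (m div d))) = (\<Sum>d | d dvd m. \<xi> m * mangoldt (m div d))"
        by (intro sum.cong refl) (metis mem_Collect_eq mult dvd_mult_div_cancel mult.assoc)
      also have "\<dots> = \<xi> m * (\<Sum>d | d dvd m. mangoldt (m div d))" by (simp add: sum_distrib_left)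
      also have "(\<Sum>d | d dvd m. mangoldt (m div d)) = (\<Sum>d | d dvd m. mangoldt d :: real)"
        by (rule sum.reindex_bij_witness[of _ "\<lambda>d. m div d" "\<lambda>d. m div d"]) (use False in auto)
      also have "\<dots> = ln (real m)" using mangoldt_sum[OF False, where ?'a = real] by simp
      finally show ?thesis by simp
    qed simp
  qed
  finally show ?thesis by (simp add: sums_iff char_L_def)
qed

text \<open>The series is -L'/L. Its numerator is bounded near 1 by Dirichlet's test, and its
  denominator stays away from 0 because L is continuous at 1 from the right and does not vanish
  there.\<close>

lemma (in nonprincipal_character) mangoldt_series_bounded:
  "\<exists>K. eventually (\<lambda>s. \<bar>\<Sum>n. \<xi> n * mangoldt n * real n powr (- s)\<bar> \<le> K) (at_right 1)"
proof -
  define c where "c = \<bar>char_L \<xi> 1\<bar> / 2"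
  have c: "c > 0" using char_L_one_nonzero by (simp add: c_def)
  have "continuous (at_right 1) (char_L \<xi>)"
    using continuous_char_L unfolding continuous_on_eq_continuous_within
    by (metis atLeast_iff continuous_within_subset greaterThan_iff less_imp_le order_refl subsetI)
  hence "((\<lambda>s. \<bar>char_L \<xi> s\<bar>) \<longlongrightarrow> \<bar>char_L \<xi> 1\<bar>) (at_right 1)"
    by (intro tendsto_rabs) (simp add: continuous_within)
  hence ev: "eventually (\<lambda>s. \<bar>char_L \<xi> s\<bar> > c) (at_right 1)"
    by (rule order_tendstoD) (use c in \<open>auto simp: c_def\<close>)
  \<comment> \<open>Terms below index 3 are bounded trivially; from 3 on Dirichlet's test applies
    with first weight at most ln 3.\<close>
  define D where "D = (\<Sum>n<3. ln (real n)) + 2 * real M * ln 3"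
  have "eventually (\<lambda>s. \<bar>\<Sum>n. \<xi> n * mangoldt n * real n powr (- s)\<bar> \<le> D / c) (at_right 1)"
    using ev eventually_at_right_less[of 1]
  proof eventually_elim
    case (elim s)
    define g where "g = (\<lambda>n. ln (real n) * real n powr (- s))"
    \<comment> \<open>Since ln n >= 1 for n >= 3, ln (n + 1) <= ln n + 1/n <= (ln n / n)(n + 1). So
      ln n / n decreases, and so does its product with n^(-(s-1)).\<close>
    have mono: "g (Suc n) \<le> g n" if "n \<ge> 3" for n
    proof -
      have n: "real n > 0" "ln (real n) \<ge> 1"
        using that exp_le by (auto simp: ln_ge_iff)
      have "real (Suc n) = real n * (1 + 1 / real n)" using n by (simp add: field_simps)
      hence "ln (real (Suc n)) = ln (real n) + ln (1 + 1 / real n)"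
        using n ln_mult_pos[of "real n" "1 + 1 / real n"] by (simp add: add_pos_pos)
      also have "ln (1 + 1 / real n) \<le> 1 / real n"
        using n by (intro ln_add_one_self_le_self) auto
      also have "1 / real n \<le> ln (real n) / real n" using n by (intro divide_right_mono) auto
      also have "ln (real n) + ln (real n) / real n = ln (real n) / real n * real (Suc n)"
        using n by (simp add: field_simps)
      finally have "ln (real (Suc n)) / real (Suc n) \<le> ln (real n) / real n" by (simp add: field_simps)
      moreover have "real (Suc n) powr (- (s - 1)) \<le> real n powr (- (s - 1))"
        using powr_minus_Suc_le[of n "s - 1"] elim that by simp
      ultimately have "ln (real (Suc n)) / real (Suc n) * real (Suc n) powr (- (s - 1))
          \<le> ln (real n) / real n * real n powr (- (s - 1))"
        using n by (intro mult_mono) auto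
      moreover have "ln y / y * y powr (- (s - 1)) = ln y * y powr (- s)" if "y > 0" for y :: real
        using that by (simp add: powr_minus powr_diff field_simps)
      ultimately show ?thesis using n by (simp add: g_def)
    qed
    have lim: "g \<longlonglongrightarrow> 0" unfolding g_def using summable_ln_powr elim by (intro summable_LIMSEQ_zero) auto
    have "\<bar>(\<Sum>n. \<xi> n * g n) - (\<Sum>n<3. \<xi> n * g n)\<bar> \<le> 2 * real M * g 3"
      by (rule dirichlet_test(2)[OF partial_sum_le mono lim]) auto
    also have "\<dots> \<le> 2 * real M * (ln 3 * 1)"
    proof -
      have "3 powr (- s) \<le> (3 :: real) powr 0" using elim by (intro powr_mono) auto
      hence "g 3 \<le> ln 3 * 1" by (simp add: g_def)
      thus ?thesis by (intro mult_left_mono) auto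
    qed
    finally have 1: "\<bar>(\<Sum>n. \<xi> n * g n) - (\<Sum>n<3. \<xi> n * g n)\<bar> \<le> 2 * real M * ln 3" by simp
    have "\<bar>\<Sum>n<3. \<xi> n * g n\<bar> \<le> (\<Sum>n<3. \<bar>\<xi> n * g n\<bar>)" by (rule sum_abs)
    also have "\<dots> \<le> (\<Sum>n<3. ln (real n))"
    proof (rule sum_mono)
      fix n :: nat
      show "\<bar>\<xi> n * g n\<bar> \<le> ln (real n)"
      proof (cases "n = 0")
        case False
        have "real n powr (- s) \<le> real n powr 0" using elim False by (intro powr_mono) auto
        hence "g n \<le> ln (real n) * 1" "0 \<le> g n" unfolding g_def using False by (auto intro!: mult_left_mono simp del: mult_1_right)
        moreover have "\<bar>\<xi> n\<bar> * g n \<le> 1 * g n"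
          using real_character_abs_le[OF character, of n] \<open>0 \<le> g n\<close> by (intro mult_right_mono)
        ultimately show ?thesis by (simp add: abs_mult)
      qed (simp add: g_def)
    qed
    finally have "\<bar>\<Sum>n. \<xi> n * g n\<bar> \<le> D" using 1 by (simp add: D_def)
    moreover have "(\<Sum>n. \<xi> n * g n) = char_L \<xi> s * (\<Sum>n. \<xi> n * mangoldt n * real n powr (- s))"
      using char_L_mangoldt[of s \<xi>] elim real_character_mult[OF character] real_character_abs_le[OF character]
      by (simp add: g_def mult.assoc)
    ultimately have "\<bar>char_L \<xi> s\<bar> * \<bar>\<Sum>n. \<xi> n * mangoldt n * real n powr (- s)\<bar> \<le> D"
      by (simp add: abs_mult)
    moreover have "c * \<bar>\<Sum>n. \<xi> n * mangoldt n * real n powr (- s)\<bar> \<le> \<bar>char_L \<xi> s\<bar> * \<bar>\<Sum>n. \<xi> n * mangoldt n * real n powr (- s)\<bar>"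
      using elim by (intro mult_right_mono) auto
    ultimately show ?case using c by (simp add: field_simps)
  qed
  thus ?thesis by blast
qed

text \<open>For fixed m the terms ln m / m^k with k >= 2 sum to at most 2 ln m / m^2 <= 4 m^(-3/2).
  Hence higher prime powers contribute a bounded amount as s tends to 1, and only primes can make a
  weighted von Mangoldt series diverge.\<close>

lemma summable_mangoldt_nonprime:
  "summable (\<lambda>n. if prime n then 0 else mangoldt n / real n)"
proof (rule bounded_imp_summable)
  define B where "B = (\<Sum>m. 4 * real m powr (- (3 / 2)))"
  have sm: "summable (\<lambda>m. 4 * real m powr (- (3 / 2)))"
    by (intro summable_mult) (simp add: summable_real_powr_iff)
  show "0 \<le> (if prime n then 0 else mangoldt n / real n :: real)" for n
    by (simp add: mangoldt_nonneg)
  show "(\<Sum>n\<le>N. if prime n then 0 else mangoldt n / real n) \<le> B" for N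
  proof -
    \<comment> \<open>For n = p^k <= N both the base and the exponent are at most N.\<close>
    define I where "I = {2..N} \<times> {2..N}"
    define h :: "nat \<Rightarrow> real" where "h = (\<lambda>n. if prime n then 0 else mangoldt n / real n)"
    have h0: "h n \<ge> 0" for n by (simp add: h_def mangoldt_nonneg)
    have fin: "finite {(m, k)\<in>I. prime m}"
      by (rule finite_subset[of _ I]) (auto simp: I_def)
    have "(\<Sum>n\<le>N. h n) = (\<Sum>n\<in>{..N} \<inter> {n. primepow n \<and> \<not> prime n}. h n)"
      by (intro sum.mono_neutral_right) (auto simp: h_def mangoldt_def)
    also have "\<dots> \<le> (\<Sum>n\<in>(\<lambda>(m, k). m ^ k) ` {(m, k)\<in>I. prime m}. h n)"
    proof (intro sum_mono2 h0)
      show "{..N} \<inter> {n. primepow n \<and> \<not> prime n} \<subseteq> (\<lambda>(m, k). m ^ k) ` {(m, k)\<in>I. prime m}"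
      proof
        fix n assume "n \<in> {..N} \<inter> {n. primepow n \<and> \<not> prime n}"
        then obtain p k where pk: "prime p" "k > 0" "n = p ^ k" "\<not> prime n" "n \<le> N"
          by (auto simp: primepow_def)
        have "k \<noteq> 1" using pk by auto
        hence k: "k \<ge> 2" using pk by simp
        have "p \<ge> 2" using pk by (simp add: prime_ge_2_nat)
        have "p ^ 1 \<le> p ^ k" using k \<open>p \<ge> 2\<close> by (intro power_increasing) auto
        moreover have "k \<le> n"
          using less_exp[of k] power_mono[of 2 p k] \<open>p \<ge> 2\<close> pk by simp
        hence "k \<le> N" using pk(5) by (rule le_trans)
        ultimately have "(p, k) \<in> I" using pk k \<open>p \<ge> 2\<close> by (auto simp: I_def)
        thus "n \<in> (\<lambda>(m, k). m ^ k) ` {(m, k)\<in>I. prime m}" using pk by force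
      qed
      show "finite ((\<lambda>(m, k). m ^ k) ` {(m, k)\<in>I. prime m})"
        by (intro finite_imageI fin)
    qed
    also have "\<dots> \<le> (\<Sum>(m, k)\<in>{(m, k)\<in>I. prime m}. h (m ^ k))"
      using sum_image_le[of "{(m, k)\<in>I. prime m}" h "\<lambda>(m, k). m ^ k"] h0
        fin by (simp add: o_def case_prod_unfold)
    also have "\<dots> \<le> (\<Sum>(m, k)\<in>{(m, k)\<in>I. prime m}. ln (real m) / real m ^ k)"
      by (intro sum_mono) (auto simp: h_def I_def prime_gt_0_nat)
    also have "\<dots> \<le> (\<Sum>(m, k)\<in>I. ln (real m) / real m ^ k)"
      by (intro sum_mono2) (auto simp: I_def)
    also have "\<dots> = (\<Sum>m=2..N. \<Sum>k=2..N. ln (real m) / real m ^ k)"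
      by (simp add: I_def sum.cartesian_product)
    also have "\<dots> \<le> (\<Sum>m=2..N. 4 * real m powr (- (3 / 2)))"
    proof (rule sum_mono)
      fix m assume m: "m \<in> {2..N}"
      define x where "x = 1 / real m"
      have x: "0 < x" "x \<le> 1 / 2" using m by (auto simp: x_def)
      have "(\<Sum>k=2..N. ln (real m) / real m ^ k) = ln (real m) * (\<Sum>k=2..N. x ^ k)"
        by (simp add: x_def sum_distrib_left power_divide)
      also have "(\<Sum>k=2..N. x ^ k) \<le> 2 * x ^ 2"
      proof -
        have "(\<Sum>k=2..N. x ^ k) = x ^ 2 * (\<Sum>k<N - 1. x ^ k)"
        proof -
          have "(\<Sum>k=2..N. x ^ k) = (\<Sum>k<N - 1. x ^ (k + 2))"
            by (rule sum.reindex_bij_witness[of _ "\<lambda>k. k + 2" "\<lambda>k. k - 2"]) (use m in \<open>auto simp del: add_2_eq_Suc'\<close>)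
          thus ?thesis by (simp add: sum_distrib_left power2_eq_square mult.assoc)
        qed
        moreover have "(\<Sum>k<N - 1. x ^ k) \<le> 2"
        proof -
          have "(1 - x) * (\<Sum>k<N - 1. x ^ k) \<le> 1" using x by (simp flip: one_diff_power_eq)
          moreover have "1 / 2 * (\<Sum>k<N - 1. x ^ k) \<le> (1 - x) * (\<Sum>k<N - 1. x ^ k)"
            using x by (intro mult_right_mono sum_nonneg) auto
          ultimately show ?thesis by simp
        qed
        ultimately show ?thesis using mult_left_mono[of "\<Sum>k<N - 1. x ^ k" 2 "x ^ 2"] by simp
      qed
      hence "ln (real m) * (\<Sum>k=2..N. x ^ k) \<le> ln (real m) * (2 * x ^ 2)" using m by (intro mult_left_mono) auto
      also have "\<dots> \<le> (real m powr (1 / 2) / (1 / 2)) * (2 * x ^ 2)"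
        using m x by (intro mult_right_mono ln_powr_bound) auto
      also have "\<dots> = 4 * (real m powr (1 / 2) * real m powr (- 2))"
        using m by (simp add: x_def powr_minus power_divide field_simps)
      also have "\<dots> = 4 * real m powr (- (3 / 2))" by (subst powr_add[symmetric]) simp
      finally show "(\<Sum>k=2..N. ln (real m) / real m ^ k) \<le> 4 * real m powr (- (3 / 2))"
        using \<open>(\<Sum>k=2..N. ln (real m) / real m ^ k) = ln (real m) * (\<Sum>k=2..N. x ^ k)\<close> by simp
    qed
    also have "\<dots> \<le> B" unfolding B_def by (intro sum_le_suminf sm) auto
    finally show ?thesis by (simp add: h_def)
  qed
qed

subsection \<open>Primes with prescribed character values\<close>

text \<open>With Z the series of n^(-s) and P that of \<open>mangoldt\<close>, Z P is the series of
  ln n * n^(-s). Its terms from N on carry a weight of at least ln N, so Z P >= ln N (Z - N). Since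
  Z grows without bound as s tends to 1, P >= ln N / 2 near 1, for any N.\<close>

lemma mangoldt_series_at_top:
  "eventually (\<lambda>s. (\<Sum>n. mangoldt n * real n powr (- s)) \<ge> C) (at_right 1)"
proof -
  define N where "N = nat \<lceil>exp (2 * \<bar>C\<bar>)\<rceil> + 1"
  have N: "N \<ge> 1" "ln (real N) \<ge> 2 * \<bar>C\<bar>"
  proof -
    show N1: "N \<ge> 1" by (simp add: N_def)
    have "exp (2 * \<bar>C\<bar>) \<le> real N" unfolding N_def by linarith
    thus "ln (real N) \<ge> 2 * \<bar>C\<bar>" using N1 by (subst ln_ge_iff) auto
  qed
  \<comment> \<open>A partial harmonic sum above 4N + 2 leaves room for the limit in s: for s near 1
    the same partial sum of n^(-s) still exceeds 4N, which gives Z - N >= Z/2.\<close>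
  obtain K where K: "(\<Sum>n<K. 1 / real n) \<ge> 4 * real N + 2"
  proof -
    have "\<not> summable (\<lambda>n. 1 / real n)"
      using not_summable_harmonic[where 'a = real] by (simp add: summable_Suc_iff[of "\<lambda>n. 1 / real n", symmetric] inverse_eq_divide)
    hence "\<exists>K. (\<Sum>n<K. 1 / real n) > 4 * real N + 2"
      by (metis bounded_imp_summable linorder_not_less divide_nonneg_nonneg zero_le_one of_nat_0_le_iff lessThan_Suc_atMost)
    thus ?thesis using that by (meson less_imp_le)
  qed
  have "((\<lambda>s. \<Sum>n<K. real n powr (- s)) \<longlongrightarrow> (\<Sum>n<K. real n powr (- 1))) (at_right 1)"
  proof (intro tendsto_sum)
    show "((\<lambda>s. real n powr (- s)) \<longlongrightarrow> real n powr (- 1)) (at_right 1)" for n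
    proof (cases "n = 0")
      case False
      thus ?thesis by (intro tendsto_powr tendsto_minus tendsto_ident_at tendsto_const) auto
    qed simp
  qed
  moreover have "(\<Sum>n<K. real n powr (- 1)) = (\<Sum>n<K. 1 / real n)"
    by (intro sum.cong refl) (auto simp: powr_minus field_simps)
  ultimately have "eventually (\<lambda>s. (\<Sum>n<K. real n powr (- s)) > 4 * real N) (at_right 1)"
    using K by (intro order_tendstoD) auto
  thus ?thesis
    using eventually_at_right_less[of 1]
  proof eventually_elim
    case (elim s)
    have s: "s > 1" using elim by simp
    define Z where "Z = (\<Sum>n. real n powr (- s))"
    define P where "P = (\<Sum>n. mangoldt n * real n powr (- s))"
    have sm: "summable (\<lambda>n. real n powr (- s))" using s by (simp add: summable_real_powr_iff)
    have "(\<Sum>n<K. real n powr (- s)) \<le> Z" unfolding Z_def by (intro sum_le_suminf sm) auto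
    hence Z: "Z > 4 * real N" using elim by linarith
    have "Z * P = (\<Sum>n. ln (real n) * real n powr (- s))"
      using char_L_mangoldt[OF s, of "\<lambda>_. 1"] by (simp add: char_L_def Z_def P_def)
    \<comment> \<open>Subtracting 1 for n < N makes those terms nonpositive, so they stay below the
      nonnegative terms on the left.\<close>
    also have "\<dots> \<ge> (\<Sum>n. ln (real N) * (real n powr (- s) - (if n < N then 1 else 0)))"
    proof (rule suminf_le)
      show "ln (real N) * (real n powr (- s) - (if n < N then 1 else 0)) \<le> ln (real n) * real n powr (- s)" for n
      proof (cases "n < N")
        case True
        have "real n powr (- s) \<le> 1"
        proof (cases "n = 0")
          case False
          hence "real n powr (- s) \<le> real n powr 0" using s by (intro powr_mono) auto
          thus ?thesis using False by simp
        qed simp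
        hence "ln (real N) * (real n powr (- s) - 1) \<le> 0" using N by (intro mult_nonneg_nonpos) auto
        moreover have "0 \<le> ln (real n) * real n powr (- s)" by (cases "n = 0") auto
        ultimately show ?thesis using True by simp
      next
        case False
        thus ?thesis using N by (auto intro!: mult_right_mono)
      qed
      show "summable (\<lambda>n. ln (real N) * (real n powr (- s) - (if n < N then 1 else 0)))"
        by (intro summable_mult summable_diff sm summable_finite[of "{..<N}"]) auto
    qed (rule summable_ln_powr[OF s])
    also have "(\<Sum>n. ln (real N) * (real n powr (- s) - (if n < N then 1 else 0))) = ln (real N) * (Z - real N)"
    proof -
      have "(\<lambda>n. if n < N then 1 else 0 :: real) sums (\<Sum>n<N. 1)"
        using sums_If_finite_set[of "{..<N}" "\<lambda>_. 1 :: real"] by simp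
      hence "(\<lambda>n. ln (real N) * (real n powr (- s) - (if n < N then 1 else 0))) sums (ln (real N) * (Z - (\<Sum>n<N. 1)))"
        unfolding Z_def by (intro sums_mult sums_diff summable_sums sm)
      thus ?thesis by (simp add: sums_iff)
    qed
    finally have "ln (real N) * (Z - real N) \<le> Z * P" .
    moreover have "2 * \<bar>C\<bar> * (Z / 2) \<le> ln (real N) * (Z - real N)"
      using N Z by (intro mult_mono) auto
    ultimately have "Z * \<bar>C\<bar> \<le> Z * P" by (simp add: mult_ac)
    hence "\<bar>C\<bar> \<le> P" using Z by (simp add: mult_le_cancel_left)
    thus ?case unfolding P_def by linarith
  qed
qed

text \<open>Expanding $\prod_j (1 + \epsilon_j \psi_j)$ weights the von Mangoldt function by the characters
  $\prod_{j \in T} \psi_j$; only the contribution of the empty $T$ is unbounded as $s \to 1$.\<close>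
theorem exists_prime_with_characters:
  assumes J: "finite J" and M: "0 < M"
    and char: "\<And>j. j \<in> J \<Longrightarrow> real_character M (\<psi> j)"
    and indep: "\<And>j. j \<in> J \<Longrightarrow> \<exists>a. coprime a M \<and> \<psi> j a = -1 \<and> (\<forall>i\<in>J - {j}. \<psi> i a = 1)"
    and eps: "\<And>j. j \<in> J \<Longrightarrow> \<epsilon> j \<in> {-1, 1 :: real}"
  shows "\<exists>q. prime q \<and> (\<forall>j\<in>J. \<psi> j q = \<epsilon> j)"
proof (rule ccontr)
  assume no: "\<not> ?thesis"
  \<comment> \<open>For nonzero \<open>\<psi> j n\<close> each factor is 2 on agreement with
    \<open>\<epsilon> j\<close> and 0 otherwise. If no prime realises all the signs,
    \<open>h\<close> vanishes at every prime not dividing \<open>M\<close>.\<close>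
  define h where "h = (\<lambda>n. \<Prod>j\<in>J. \<epsilon> j * \<psi> j n + 1)"
  define \<psi>' where "\<psi>' = (\<lambda>T n. \<Prod>j\<in>T. \<psi> j n)"
  define e where "e = (\<lambda>T. \<Prod>j\<in>T. \<epsilon> j)"
  have h_eq: "h n = (\<Sum>T\<in>Pow J. e T * \<psi>' T n)" for n
    unfolding h_def e_def \<psi>'_def by (subst prod_add[OF J]) (simp add: prod.distrib)
  have chT: "real_character M (\<psi>' T)" if "T \<subseteq> J" for T
    unfolding \<psi>'_def using that J M char by (intro real_character_prod) (auto intro: finite_subset)
  have h_bd: "0 \<le> h n" "h n \<le> 2 ^ card J" for n
  proof -
    have "0 \<le> \<epsilon> j * \<psi> j n + 1 \<and> \<epsilon> j * \<psi> j n + 1 \<le> 2" if "j \<in> J" for j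
      using eps[OF that] real_character_values[OF char[OF that], of n] by auto
    thus "0 \<le> h n" "h n \<le> 2 ^ card J"
      unfolding h_def using prod_mono[of J "\<lambda>j. \<epsilon> j * \<psi> j n + 1" "\<lambda>_. 2"] by (auto intro!: prod_nonneg)
  qed
  have h_prime: "h q = 0" if "prime q" "\<not> q dvd M" for q
  proof -
    have "coprime q M" using that by (simp add: prime_imp_coprime)
    have "\<not> (\<forall>j\<in>J. \<psi> j q = \<epsilon> j)" using no that(1) by metis
    then obtain j where j: "j \<in> J" "\<psi> j q \<noteq> \<epsilon> j" by blast
    have "\<psi> j q \<noteq> 0" by (rule real_character_coprime_nonzero[OF char[OF j(1)] \<open>coprime q M\<close>])
    hence "\<psi> j q = 1 \<or> \<psi> j q = -1" using real_character_values[OF char[OF j(1)], of q] by auto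
    moreover have "\<epsilon> j = 1 \<or> \<epsilon> j = -1" using eps[OF j(1)] by auto
    ultimately have "\<epsilon> j * \<psi> j q + 1 = 0" using j(2) by (elim disjE) simp_all
    thus ?thesis unfolding h_def using j J by (subst prod_zero_iff) auto
  qed
  \<comment> \<open>A majorant independent of s: what survives are the higher prime powers and the
    primes dividing \<open>M\<close>, all of which are at most \<open>M\<close>.\<close>
  define U where "U = (\<lambda>n. 2 ^ card J * ((if prime n then 0 else mangoldt n / real n) + (if n \<in> {..M} then mangoldt n else 0)))"
  have U0: "0 \<le> U n" for n
    unfolding U_def
    by (intro mult_nonneg_nonneg add_nonneg_nonneg) (auto simp: mangoldt_nonneg simp del: mangoldt_prime)
  have U: "summable U"
    unfolding U_def by (intro summable_mult summable_add summable_mangoldt_nonprime summable_If_finite_set) simp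
  have upper: "(\<Sum>n. h n * mangoldt n * real n powr (- s)) \<le> suminf U" if s: "s > 1" for s
  proof (rule suminf_le[OF _ _ U])
    show "summable (\<lambda>n. h n * mangoldt n * real n powr (- s))"
      by (rule summable_norm_cancel, rule summable_mangoldt_powr[OF s, of _ "2 ^ card J"])
         (simp add: h_bd)
    fix n
    show "h n * mangoldt n * real n powr (- s) \<le> U n"
    proof (cases "n = 0 \<or> (prime n \<and> \<not> n dvd M)")
      case True
      thus ?thesis using h_prime U0[of n] by auto
    next
      case False
      have "real n powr (- s) \<le> real n powr (- 1)" using False s by (intro powr_mono) auto
      hence p: "real n powr (- s) \<le> 1 / real n" by (simp add: powr_minus divide_inverse)
      have "h n * mangoldt n * real n powr (- s) = h n * (mangoldt n * real n powr (- s))" by simp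
      also have "\<dots> \<le> 2 ^ card J * (mangoldt n * (1 / real n))"
        using h_bd mangoldt_nonneg p by (intro mult_mono mult_nonneg_nonneg mult_left_mono) auto
      also have "\<dots> \<le> U n"
      proof (cases "prime n")
        case True
        hence "n \<le> M" using False M by (auto dest: dvd_imp_le)
        moreover have "mangoldt n * (1 / real n) \<le> mangoldt n"
          using True by (intro mult_right_le_one_le mangoldt_nonneg) (auto simp: prime_gt_0_nat Suc_leI)
        ultimately show ?thesis
          unfolding U_def using True by (intro mult_left_mono) (auto simp del: mangoldt_prime)
      next
        case False
        thus ?thesis unfolding U_def by (intro mult_left_mono) (auto simp: mangoldt_nonneg)
      qed
      finally show ?thesis .
    qed
  qed
  have "\<exists>K. eventually (\<lambda>s. \<bar>\<Sum>n. \<psi>' T n * mangoldt n * real n powr (- s)\<bar> \<le> K) (at_right 1)"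
    if T: "T \<in> Pow J - {{}}" for T
  proof -
    obtain j where j: "j \<in> T" "j \<in> J" using T by auto
    obtain a where a: "coprime a M" "\<psi> j a = -1" "\<forall>i\<in>J - {j}. \<psi> i a = 1" using indep[OF j(2)] by blast
    \<comment> \<open>The independence witness for one member j of \<open>T\<close> makes exactly
      one factor -1, so the product character is nonprincipal.\<close>
    have "\<psi>' T a = \<psi> j a * (\<Prod>i\<in>T - {j}. \<psi> i a)"
      unfolding \<psi>'_def using j T J by (intro prod.remove) (auto intro: finite_subset)
    also have "(\<Prod>i\<in>T - {j}. \<psi> i a) = 1" using a(3) T by (intro prod.neutral) auto
    finally interpret nonprincipal_character M "\<psi>' T" a
      using chT[of T] T a by unfold_locales auto
    show ?thesis by (rule mangoldt_series_bounded)
  qed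
  then obtain K where K: "\<And>T. T \<in> Pow J - {{}} \<Longrightarrow>
      eventually (\<lambda>s. \<bar>\<Sum>n. \<psi>' T n * mangoldt n * real n powr (- s)\<bar> \<le> K T) (at_right 1)"
    by metis
  have "eventually (\<lambda>s. \<forall>T\<in>Pow J - {{}}. \<bar>\<Sum>n. \<psi>' T n * mangoldt n * real n powr (- s)\<bar> \<le> K T) (at_right 1)"
    using J K by (intro eventually_ball_finite) auto
  moreover have "eventually (\<lambda>s. (\<Sum>n. mangoldt n * real n powr (- s)) \<ge> suminf U + (\<Sum>T\<in>Pow J - {{}}. K T) + 1) (at_right 1)"
    by (rule mangoldt_series_at_top)
  ultimately have "eventually (\<lambda>s::real. False) (at_right 1)"
    using eventually_at_right_less[of 1]
  proof eventually_elim
    case (elim s)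
    hence s: "s > 1" by simp
    define P where "P = (\<lambda>T. \<Sum>n. \<psi>' T n * mangoldt n * real n powr (- s))"
    have smT: "summable (\<lambda>n. \<psi>' T n * mangoldt n * real n powr (- s))" if "T \<subseteq> J" for T
      by (rule summable_norm_cancel, rule summable_mangoldt_powr[OF s, of _ 1])
         (rule real_character_abs_le[OF chT[OF that]])
    have "(\<lambda>n. \<Sum>T\<in>Pow J. e T * (\<psi>' T n * mangoldt n * real n powr (- s))) sums (\<Sum>T\<in>Pow J. e T * P T)"
      unfolding P_def by (intro sums_sum sums_mult summable_sums smT) auto
    also have "(\<lambda>n. \<Sum>T\<in>Pow J. e T * (\<psi>' T n * mangoldt n * real n powr (- s))) = (\<lambda>n. h n * mangoldt n * real n powr (- s))"
      by (simp add: h_eq sum_distrib_right mult.assoc)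
    finally have "(\<Sum>T\<in>Pow J. e T * P T) \<le> suminf U" using upper[OF s] by (simp add: sums_iff)
    moreover have "(\<Sum>T\<in>Pow J. e T * P T) = e {} * P {} + (\<Sum>T\<in>Pow J - {{}}. e T * P T)"
      using J by (intro sum.remove) auto
    moreover have "e {} * P {} = (\<Sum>n. mangoldt n * real n powr (- s))" by (simp add: e_def P_def \<psi>'_def)
    moreover have "(\<Sum>T\<in>Pow J - {{}}. - K T) \<le> (\<Sum>T\<in>Pow J - {{}}. e T * P T)"
    proof (rule sum_mono)
      fix T assume T: "T \<in> Pow J - {{}}"
      have "\<bar>e T\<bar> = 1"
        unfolding e_def abs_prod
      proof (intro prod.neutral ballI)
        fix j assume "j \<in> T"
        hence "\<epsilon> j \<in> {-1, 1}" using T by (intro eps) auto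
        thus "\<bar>\<epsilon> j\<bar> = 1" by auto
      qed
      hence "\<bar>e T * P T\<bar> \<le> K T" using elim(1) T by (simp add: abs_mult P_def)
      thus "- K T \<le> e T * P T" by linarith
    qed
    ultimately show ?case using elim(2) unfolding sum_negf by linarith
  qed
  from eventually_happens[OF this] show False by simp
qed

section \<open>A prime modulo which all small primes are nonresidues\<close>

lemma real_character_dvd:
  assumes "real_character k \<xi>" "k dvd M" "0 < M"
  shows "real_character M \<xi>"
proof -
  obtain l where l: "M = l * k" using assms(2) by (metis dvdE mult.commute)
  show ?thesis
    using assms(1,3) real_character_add_mult[OF assms(1), of _ l] unfolding real_character_def l by blast
qed

text \<open>On odd n this is the Jacobi symbol (-1/n).\<close>

definition chi4 :: "nat \<Rightarrow> real" where
  "chi4 n = (if n mod 4 = 1 then 1 else if n mod 4 = 3 then -1 else 0)"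

text \<open>On odd n this is the Jacobi symbol (2/n).\<close>

definition chi8 :: "nat \<Rightarrow> real" where
  "chi8 n = (if n mod 8 = 1 \<or> n mod 8 = 7 then 1 else if n mod 8 = 3 \<or> n mod 8 = 5 then -1 else 0)"

lemma real_character_chi4: "real_character 4 chi4"
proof -
  have "chi4 (a * b) = chi4 a * chi4 b" for a b
  proof -
    have "a mod 4 \<in> {0, 1, 2, 3}" "b mod 4 \<in> {0, 1, 2, 3}" by auto
    moreover have "(a * b) mod 4 = ((a mod 4) * (b mod 4)) mod 4" by (simp add: mod_mult_eq)
    ultimately show ?thesis unfolding chi4_def by (elim insertE emptyE) simp_all
  qed
  thus ?thesis unfolding real_character_def by (auto simp: chi4_def)
qed

lemma real_character_chi8: "real_character 8 chi8"
proof -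
  have "chi8 (a * b) = chi8 a * chi8 b" for a b
  proof -
    have "a mod 8 \<in> {0, 1, 2, 3, 4, 5, 6, 7}" "b mod 8 \<in> {0, 1, 2, 3, 4, 5, 6, 7}" by auto
    moreover have "(a * b) mod 8 = ((a mod 8) * (b mod 8)) mod 8" by (simp add: mod_mult_eq)
    ultimately show ?thesis unfolding chi8_def by (elim insertE emptyE) simp_all
  qed
  thus ?thesis unfolding real_character_def by (auto simp: chi8_def)
qed

lemma real_character_Legendre:
  assumes "prime p" "2 < p"
  shows "real_character p (\<lambda>n. real_of_int (Legendre (int n) (int p)))"
proof -
  have "Legendre (int (a + p)) (int p) = Legendre (int a) (int p)" for a
    by (rule Legendre_cong) (simp add: cong_def)
  moreover have "real_of_int (Legendre (int a) (int p)) \<in> {-1, 0, 1}" for a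
    using Legendre_values[of "int a" "int p"] by auto
  ultimately show ?thesis
    using assms Legendre_mult[OF assms] Legendre_one[of "int p"]
    unfolding real_character_def by (simp add: prime_gt_0_nat)
qed

text \<open>Prescribing \<open>chi4 q = chi8 q = -1\<close> forces q = 3 mod 8, which settles p = 2.
  For odd p, reciprocity with q = 3 mod 4 reads (p/q)(q/p) = (-1)^((p-1)/2), so the condition on
  (p/q) becomes one on (q/p), a real character evaluated at q.\<close>

lemma exists_prime_nonresidues:
  "\<exists>q. prime q \<and> [q = 3] (mod 8) \<and> (\<forall>p. prime p \<and> p \<le> N \<longrightarrow> Legendre (int p) (int q) = -1)"
proof -
  define P where "P = {p. prime p \<and> 2 < p \<and> p \<le> N}"
  have finP: "finite P" unfolding P_def by (rule finite_subset[of _ "{..N}"]) auto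
  have P: "prime p" "2 < p" "p \<le> N" if "p \<in> P" for p using that by (auto simp: P_def)
  define M where "M = 8 * \<Prod>P"
  have M0: "M > 0" using P by (auto simp: M_def prime_gt_0_nat intro!: prod_pos)
  \<comment> \<open>The indices 0 and 1 are not primes and are free to denote the two characters of
    2-power modulus.\<close>
  define \<psi> where "\<psi> = (\<lambda>j n. if j = 0 then chi4 n else if j = 1 then chi8 n else real_of_int (Legendre (int n) (int j)))"
  \<comment> \<open>For odd p this is the value of (q/p) that makes (p/q) = -1: it is -1 for p = 1
    mod 4 and +1 for p = 3 mod 4.\<close>
  define \<epsilon> :: "nat \<Rightarrow> real" where "\<epsilon> = (\<lambda>j. if j > 2 \<and> j mod 4 \<noteq> 1 then 1 else -1)"
  define J where "J = insert 0 (insert 1 P)"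
  have char8: "real_character M chi4" "real_character M chi8"
    using real_character_dvd[OF real_character_chi4 _ M0] real_character_dvd[OF real_character_chi8 _ M0]
    by (auto simp: M_def)
  have psi: "\<psi> p = (\<lambda>n. real_of_int (Legendre (int n) (int p)))" if "p \<in> P" for p
    using P(2)[OF that] by (auto simp: \<psi>_def)
  have dvd: "p dvd \<Prod>P" if "p \<in> P" for p using dvd_prodI[OF finP that, of "\<lambda>x. x"] by simp
  have charP: "real_character M (\<psi> p)" if "p \<in> P" for p
    unfolding psi[OF that]
    by (rule real_character_dvd[OF real_character_Legendre[OF P(1,2)[OF that]] _ M0]) (use dvd[OF that] in \<open>simp add: M_def\<close>)
  have psi01: "\<psi> 0 = chi4" "\<psi> 1 = chi8" by (auto simp: \<psi>_def)
  have leg1: "\<psi> p a = 1" if "p \<in> P" "[a = 1] (mod m)" "p dvd m" for p a m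
  proof -
    have "[int a = 1] (mod int p)" using that(2,3) by (metis cong_dvd_modulus_nat cong_int_iff of_nat_1)
    hence "Legendre (int a) (int p) = Legendre 1 (int p)" by (rule Legendre_cong)
    thus ?thesis using P(2)[OF that(1)] by (simp add: psi[OF that(1)] Legendre_one)
  qed
  have odd: "coprime 8 p" if "p \<in> P" for p
  proof -
    have "odd p" using P[OF that] by (simp add: prime_odd_nat)
    hence "coprime (2 ^ 3) p" by (subst coprime_power_left_iff) simp
    thus ?thesis by simp
  qed
  have "coprime 8 (\<Prod>P)" using odd by (intro prod_coprime_right) auto
  have mod8: "\<exists>a. coprime a M \<and> [a = r] (mod 8) \<and> [a = 1] (mod \<Prod>P)" if "coprime r 8" for r :: nat
  proof -
    obtain a where a: "[a = r] (mod 8)" "[a = 1] (mod \<Prod>P)"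
      using binary_chinese_remainder_nat[OF \<open>coprime 8 (\<Prod>P)\<close>] by blast
    have "coprime a 8" "coprime a (\<Prod>P)"
      using a that by (metis cong_imp_coprime cong_sym coprime_1_left)+
    thus ?thesis using a unfolding M_def by auto
  qed
  have chi_cong: "chi4 a = chi4 b" "chi8 a = chi8 b" if "[a = b] (mod 8)" for a b
  proof -
    show "chi8 a = chi8 b" using that by (simp add: chi8_def cong_def)
    have "[a = b] (mod 4)" using that by (rule cong_dvd_modulus_nat) simp
    thus "chi4 a = chi4 b" by (simp add: chi4_def cong_def)
  qed
  have "\<exists>q. prime q \<and> (\<forall>j\<in>J. \<psi> j q = \<epsilon> j)"
  proof (rule exists_prime_with_characters[of J M \<psi> \<epsilon>])
    show "finite J" using finP by (simp add: J_def)
    show "real_character M (\<psi> j)" if "j \<in> J" for j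
      using that charP char8 by (auto simp: J_def psi01[simplified])
    show "\<epsilon> j \<in> {-1, 1}" for j by (simp add: \<epsilon>_def)
    fix j assume "j \<in> J"
    then consider "j = 0" | "j = 1" | "j \<in> P" by (auto simp: J_def)
    thus "\<exists>a. coprime a M \<and> \<psi> j a = -1 \<and> (\<forall>i\<in>J - {j}. \<psi> i a = 1)"
    proof cases
      case 1
      \<comment> \<open>The class 7 modulo 8 has \<open>chi4\<close> equal to -1 and
        \<open>chi8\<close> equal to 1.\<close>
      have "coprime (7 :: nat) (2 ^ 3)"
        by (subst coprime_power_right_iff) (simp add: coprime_right_2_iff_odd)
      hence "coprime (7 :: nat) 8" by simp
      from mod8[OF this] obtain a where a: "coprime a M" "[a = 7] (mod 8)" "[a = 1] (mod \<Prod>P)" by blast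
      have "\<psi> i a = 1" if "i \<in> P" for i using leg1[OF that a(3) dvd[OF that]] .
      moreover have "\<psi> 0 a = -1" "\<psi> 1 a = 1" using chi_cong[OF a(2)] by (simp_all add: \<psi>_def chi4_def chi8_def)
      ultimately show ?thesis using a(1) 1 by (intro exI[of _ a]) (auto simp: J_def)
    next
      case 2
      \<comment> \<open>The class 5 modulo 8 has \<open>chi4\<close> equal to 1 and
        \<open>chi8\<close> equal to -1.\<close>
      have "coprime (5 :: nat) (2 ^ 3)"
        by (subst coprime_power_right_iff) (simp add: coprime_right_2_iff_odd)
      hence "coprime (5 :: nat) 8" by simp
      from mod8[OF this] obtain a where a: "coprime a M" "[a = 5] (mod 8)" "[a = 1] (mod \<Prod>P)" by blast
      have "\<psi> i a = 1" if "i \<in> P" for i using leg1[OF that a(3) dvd[OF that]] .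
      moreover have "\<psi> 0 a = 1" "\<psi> 1 a = -1" using chi_cong[OF a(2)] by (simp_all add: \<psi>_def chi4_def chi8_def)
      ultimately show ?thesis using a(1) 2 by (intro exI[of _ a]) (auto simp: J_def)
    next
      case 3
      \<comment> \<open>A nonresidue modulo j that is 1 modulo 8 and modulo every other prime in
        \<open>P\<close> changes the sign of the j-th character alone.\<close>
      obtain b where b: "coprime b j" "Legendre (int b) (int j) = -1"
        using Legendre_minus_one_exists[OF P(1,2)[OF 3]] by blast
      define m where "m = 8 * \<Prod>(P - {j})"
      have Mm: "M = j * m" using prod.remove[OF finP 3, of "\<lambda>x. x"] by (simp add: M_def m_def)
      have "coprime j (\<Prod>(P - {j}))"
        using P(1) 3 by (intro prod_coprime_right) (auto intro: primes_coprime)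
      hence "coprime j m" using odd[OF 3] by (simp add: m_def coprime_commute)
      then obtain a where a: "[a = b] (mod j)" "[a = 1] (mod m)"
        using binary_chinese_remainder_nat by blast
      have "coprime a j" "coprime a m" using a b by (metis cong_imp_coprime cong_sym coprime_1_left)+
      hence aM: "coprime a M" by (simp add: Mm)
      have "\<psi> j a = -1"
        using Legendre_cong[of "int a" "int b" "int j"] a(1) b by (simp add: psi[OF 3] cong_int_iff)
      moreover have "\<psi> i a = 1" if "i \<in> P - {j}" for i
      proof -
        have "i dvd \<Prod>(P - {j})" using dvd_prodI[of "P - {j}" i "\<lambda>x. x"] that finP by simp
        thus ?thesis using that by (intro leg1[OF _ a(2)]) (auto simp: m_def)
      qed
      moreover have "\<psi> 0 a = 1" "\<psi> 1 a = 1"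
        using chi_cong[of a 1] cong_dvd_modulus_nat[OF a(2), of 8]
        by (simp_all add: \<psi>_def m_def chi4_def chi8_def)
      ultimately show ?thesis using aM by (intro exI[of _ a]) (auto simp: J_def)
    qed
  qed (use M0 in auto)
  then obtain q where q: "prime q" and qJ: "\<And>j. j \<in> J \<Longrightarrow> \<psi> j q = \<epsilon> j" by blast
  have "chi4 q = -1" "chi8 q = -1" using qJ[of 0] qJ[of 1] by (auto simp: J_def \<psi>_def \<epsilon>_def)
  hence "q mod 4 = 3" "q mod 8 = 3 \<or> q mod 8 = 5" by (auto simp: chi4_def chi8_def split: if_splits)
  hence q8: "q mod 8 = 3" by presburger
  have q3: "[q = 3] (mod 8)" using q8 by (simp add: cong_def)
  have "odd ((q - 1) div 2)" using q8 by presburger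
  have "q \<noteq> 2" using q8 by auto
  hence "q > 2" using prime_ge_2_nat[OF q] by simp
  have "Legendre (int p) (int q) = -1" if "prime p" "p \<le> N" for p
  proof (cases "p = 2")
    case True
    thus ?thesis using Legendre_two_3_mod_8[OF q q3] by simp
  next
    case False
    hence p2: "p > 2" using that prime_ge_2_nat[of p] by simp
    hence pP: "p \<in> P" using that by (simp add: P_def)
    have leg: "real_of_int (Legendre (int q) (int p)) = \<epsilon> p" using qJ[of p] pP by (simp add: J_def psi)
    have "p \<noteq> q"
    proof
      assume "p = q"
      hence "Legendre (int q) (int p) = 0" by (simp add: Legendre_def cong_def)
      thus False using leg by (simp add: \<epsilon>_def split: if_splits)
    qed
    hence "Legendre (int p) (int q) * Legendre (int q) (int p) = (-1) ^ ((p - 1) div 2 * ((q - 1) div 2))"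
      using Quadratic_Reciprocity[OF \<open>prime p\<close> p2 q \<open>q > 2\<close>] by simp
    also have "\<dots> = (-1) ^ ((p - 1) div 2)" using \<open>odd ((q - 1) div 2)\<close> by (simp add: power_mult minus_one_power_iff)
    finally have prod: "Legendre (int p) (int q) * Legendre (int q) (int p) = (-1) ^ ((p - 1) div 2)" .
    have "odd p" using that p2 by (simp add: prime_odd_nat)
    show ?thesis
    proof (cases "p mod 4 = 1")
      case True
      hence "even ((p - 1) div 2)" by presburger
      moreover have "Legendre (int q) (int p) = -1" using leg True by (simp add: \<epsilon>_def)
      ultimately show ?thesis using prod by simp
    next
      case False
      hence "odd ((p - 1) div 2)" using \<open>odd p\<close> by presburger
      moreover have "Legendre (int q) (int p) = 1" using leg False p2 by (simp add: \<epsilon>_def)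
      ultimately show ?thesis using prod by simp
    qed
  qed
  thus ?thesis using q q3 by blast
qed

section \<open>The Liouville function on an initial segment\<close>

text \<open>\<open>size\<close> counts prime factors with multiplicity. The value at 0 is 1, so the
  absolute value is 1 without exception; in Dirichlet series the index 0 is removed by the factor
  \<open>0 powr (- s) = 0\<close>.\<close>

definition liouville :: "nat \<Rightarrow> int" where
  "liouville n = (-1) ^ size (prime_factorization n)"

lemma liouville_mult: "a > 0 \<Longrightarrow> b > 0 \<Longrightarrow> liouville (a * b) = liouville a * liouville b"
  by (simp add: liouville_def prime_factorization_mult power_add)

lemma liouville_one [simp]: "liouville (Suc 0) = 1"
  by (simp add: liouville_def)

lemma liouville_prime: "prime p \<Longrightarrow> liouville p = -1"
  by (simp add: liouville_def prime_factorization_prime)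

text \<open>Both sides are completely multiplicative on positive integers and equal -1 at every
  prime up to \<open>N\<close>.\<close>

lemma Legendre_eq_liouville:
  assumes q: "prime q" "2 < q" and nonres: "\<And>p. prime p \<Longrightarrow> p \<le> N \<Longrightarrow> Legendre (int p) (int q) = -1"
    and "0 < n" "n \<le> N"
  shows "Legendre (int n) (int q) = liouville n"
  using assms(4,5)
proof (induction n rule: less_induct)
  case (less n)
  show ?case
  proof (cases "n = 1")
    case True
    thus ?thesis using q by (simp add: Legendre_one)
  next
    case False
    then obtain p where p: "prime p" "p dvd n" using prime_factor_nat by blast
    then obtain m where m: "n = p * m" by (elim dvdE)
    have "p \<le> n" using p less.prems by (intro dvd_imp_le) auto
    have "m > 0" using m less.prems by (auto intro: Nat.gr0I)
    have "m < n" using m \<open>m > 0\<close> prime_gt_1_nat[OF p(1)] by simp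
    have "Legendre (int n) (int q) = Legendre (int p) (int q) * Legendre (int m) (int q)"
      unfolding m of_nat_mult by (rule Legendre_mult[OF q])
    also have "\<dots> = liouville p * liouville m"
      using less.IH[OF \<open>m < n\<close> \<open>m > 0\<close>] \<open>m < n\<close> less.prems nonres[OF p(1)] \<open>p \<le> n\<close> liouville_prime[OF p(1)] by simp
    also have "\<dots> = liouville n" unfolding m using \<open>m > 0\<close> p(1) by (simp add: liouville_mult prime_gt_0_nat)
    finally show ?thesis .
  qed
qed

subsection \<open>Landau's lemma\<close>

text \<open>The difference of the two series represents the zero function. Comparing at the centre
  settles the constant term; a nonzero coefficient of positive index would make the zero at the
  centre isolated, which is absurd for the zero function.\<close>

lemma power_series_coeffs_eq:
  fixes a b :: "nat \<Rightarrow> complex"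
  assumes "0 < r" "\<And>x. norm (x - z) < r \<Longrightarrow> (\<lambda>n. a n * (x - z) ^ n) sums f x"
    and "\<And>x. norm (x - z) < r \<Longrightarrow> (\<lambda>n. b n * (x - z) ^ n) sums f x"
  shows "a = b"
proof
  fix m
  have d: "(\<lambda>n. (a n - b n) * (x - z) ^ n) sums 0" if "norm (x - z) < r" for x
    using sums_diff[OF assms(2)[OF that] assms(3)[OF that]] by (simp add: algebra_simps)
  show "a m = b m"
  proof (cases "m = 0")
    case True
    have "(\<lambda>n. (a n - b n) * 0 ^ n) sums 0" using d[of z] assms(1) by simp
    moreover have "(\<lambda>n. (a n - b n) * 0 ^ n) sums (a 0 - b 0)" by (rule powser_sums_zero)
    ultimately have "a 0 - b 0 = 0" by (rule sums_unique2[symmetric])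
    thus ?thesis using True by simp
  next
    case False
    show ?thesis
    proof (rule ccontr)
      assume "a m \<noteq> b m"
      then obtain s where s: "0 < s" "\<And>w. w \<in> cball z s - {z} \<Longrightarrow> (0::complex) \<noteq> 0"
        using powser_0_nonzero[OF assms(1), of z "\<lambda>n. a n - b n" "\<lambda>_. 0" m] d False by auto
      have "z + of_real s \<in> cball z s - {z}" using s(1) by (simp add: dist_norm)
      from s(2)[OF this] show False by simp
    qed
  qed
qed

section \<open>Integrals of exponentials depending on a complex parameter\<close>

text \<open>Mellin integrals are the case \<open>u x = - ln x\<close>, where exp (s * u x) is
  x^(-s). Absolute convergence at the two real ends \<open>a\<close> and \<open>b\<close> controls
  the whole closed strip between them.\<close>

locale exp_integrals =
  fixes M :: "'a measure" and h u :: "'a \<Rightarrow> real" and a b :: real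
  assumes h_meas [measurable]: "h \<in> borel_measurable M"
    and u_meas [measurable]: "u \<in> borel_measurable M"
    and int_a: "integrable M (\<lambda>x. h x * exp (a * u x))"
    and int_b: "integrable M (\<lambda>x. h x * exp (b * u x))"
begin

definition F :: "complex \<Rightarrow> complex" where
  "F s = (\<integral>x. of_real (h x) * exp (s * of_real (u x)) \<partial>M)"

definition bound :: "'a \<Rightarrow> real" where
  "bound x = \<bar>h x\<bar> * exp (a * u x) + \<bar>h x\<bar> * exp (b * u x)"

lemma integrable_bound: "integrable M bound"
  unfolding bound_def using integrable_abs[OF int_a] integrable_abs[OF int_b] by (simp add: abs_mult)

text \<open>The factor exp (\<rho> * |u|) moves the exponent towards the right end where u >= 0 and
  towards the left end elsewhere. It is also the sum of the absolute values in an exponential series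
  at distance \<rho> from the centre.\<close>

lemma exp_le_bound:
  assumes "a \<le> \<sigma> - \<rho>" "\<sigma> + \<rho> \<le> b" "0 \<le> \<rho>"
  shows "\<bar>h x\<bar> * (exp (\<sigma> * u x) * exp (\<rho> * \<bar>u x\<bar>)) \<le> bound x"
proof -
  have "exp (\<sigma> * u x) * exp (\<rho> * \<bar>u x\<bar>) \<le> exp (a * u x) + exp (b * u x)"
  proof (cases "u x \<ge> 0")
    case True
    have "exp (\<sigma> * u x) * exp (\<rho> * \<bar>u x\<bar>) = exp ((\<sigma> + \<rho>) * u x)"
      using True by (simp add: exp_add[symmetric] algebra_simps)
    also have "\<dots> \<le> exp (b * u x)" using True assms by (simp add: mult_right_mono)
    finally show ?thesis by (simp add: add_increasing)
  next
    case False
    have "exp (\<sigma> * u x) * exp (\<rho> * \<bar>u x\<bar>) = exp ((\<sigma> - \<rho>) * u x)"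
      using False by (simp add: exp_add[symmetric] algebra_simps)
    also have "\<dots> \<le> exp (a * u x)" using False assms by (simp add: mult_right_mono_neg)
    finally show ?thesis by (simp add: add_increasing2)
  qed
  thus ?thesis unfolding bound_def using mult_left_mono[of _ _ "\<bar>h x\<bar>"] by (simp add: distrib_left[symmetric])
qed

lemma integrable_exp_real:
  assumes "a \<le> \<sigma>" "\<sigma> \<le> b"
  shows "integrable M (\<lambda>x. h x * exp (\<sigma> * u x))"
  using exp_le_bound[of \<sigma> 0] assms
  by (intro Bochner_Integration.integrable_bound[OF integrable_bound] AE_I2)
     (auto simp: abs_mult bound_def intro: order_trans[OF _ abs_ge_self])

definition coeff :: "complex \<Rightarrow> nat \<Rightarrow> complex" where
  "coeff c k = (\<integral>x. of_real (h x) * exp (c * of_real (u x)) * of_real (u x) ^ k / fact k \<partial>M)"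

text \<open>In exp (s u) = exp (c u) exp ((s - c) u) the second factor is expanded. The partial sums
  of absolute values stay below the integrable \<open>bound\<close>, so summation and integration
  may be exchanged.\<close>

lemma power_series:
  assumes "a \<le> Re c - r" "Re c + r \<le> b" "norm (s - c) \<le> r"
  shows "(\<lambda>k. coeff c k * (s - c) ^ k) sums F s"
proof -
  define f where "f = (\<lambda>k x. of_real (h x) * exp (c * of_real (u x)) * ((s - c) * of_real (u x)) ^ k / fact k)"
  have r: "0 \<le> r" using assms(3) norm_ge_zero order_trans by blast
  define p where "p = (\<lambda>k x. \<bar>h x\<bar> * exp (Re c * u x) * ((norm (s - c) * \<bar>u x\<bar>) ^ k / fact k))"
  have norm_f: "norm (f k x) = p k x" for k x
    by (simp add: f_def p_def norm_mult norm_divide norm_power)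
  have p_sums: "(\<lambda>k. p k x) sums (\<bar>h x\<bar> * exp (Re c * u x) * exp (norm (s - c) * \<bar>u x\<bar>))" for x
    unfolding p_def using exp_converges[of "norm (s - c) * \<bar>u x\<bar>"]
    by (intro sums_mult) (simp add: scaleR_conv_of_real divide_inverse mult.commute)
  have p_le: "(\<Sum>k<n. p k x) \<le> bound x" for n x
  proof -
    have "(\<Sum>k<n. p k x) \<le> \<bar>h x\<bar> * exp (Re c * u x) * exp (norm (s - c) * \<bar>u x\<bar>)"
      using p_sums[of x] by (subst sums_unique[OF p_sums], intro sum_le_suminf) (auto simp: p_def sums_iff)
    also have "\<dots> = \<bar>h x\<bar> * (exp (Re c * u x) * exp (norm (s - c) * \<bar>u x\<bar>))" by simp
    also have "\<dots> \<le> bound x" using assms by (intro exp_le_bound) auto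
    finally show ?thesis .
  qed
  have p_int: "integrable M (p k)" for k
  proof (rule Bochner_Integration.integrable_bound[OF integrable_bound])
    show "p k \<in> borel_measurable M" unfolding p_def by measurable
    have "p k x \<le> (\<Sum>j<Suc k. p j x)" for x by (simp add: sum_nonneg p_def)
    hence "p k x \<le> bound x" for x using p_le[of x "Suc k"] order_trans by blast
    moreover have "0 \<le> p k x" for x by (simp add: p_def)
    ultimately show "AE x in M. norm (p k x) \<le> norm (bound x)"
      by (intro AE_I2) (simp add: order_trans[OF _ abs_ge_self])
  qed
  have f_int: "integrable M (f k)" for k
  proof (rule Bochner_Integration.integrable_bound[OF p_int[of k]])
    show "f k \<in> borel_measurable M" unfolding f_def by measurable
  qed (simp add: norm_f)
  have "(\<lambda>k. integral\<^sup>L M (f k)) sums (\<integral>x. (\<Sum>k. f k x) \<partial>M)"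
  proof (rule sums_integral[OF f_int])
    show "AE x in M. summable (\<lambda>k. norm (f k x))"
      unfolding norm_f using p_sums by (auto simp: sums_iff)
    show "summable (\<lambda>k. \<integral>x. norm (f k x) \<partial>M)"
      unfolding norm_f
    proof (rule bounded_imp_summable)
      show "0 \<le> integral\<^sup>L M (p k)" for k by (rule Bochner_Integration.integral_nonneg) (simp add: p_def)
      fix n
      have "(\<Sum>k\<le>n. integral\<^sup>L M (p k)) = (\<integral>x. (\<Sum>k\<le>n. p k x) \<partial>M)"
        using p_int by simp
      also have "\<dots> \<le> integral\<^sup>L M bound"
        using p_int p_le[of _ "Suc n"] by (intro integral_mono integrable_bound) (auto simp: lessThan_Suc_atMost)
      finally show "(\<Sum>k\<le>n. integral\<^sup>L M (p k)) \<le> integral\<^sup>L M bound" .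
    qed
  qed
  also have "(\<lambda>x. \<Sum>k. f k x) = (\<lambda>x. of_real (h x) * exp (s * of_real (u x)))"
  proof
    fix x
    have "(\<lambda>k. f k x) sums (of_real (h x) * exp (c * of_real (u x)) * exp ((s - c) * of_real (u x)))"
      unfolding f_def
      using sums_mult[OF exp_converges[of "(s - c) * of_real (u x)"], of "of_real (h x) * exp (c * of_real (u x))"]
      by (simp add: scaleR_conv_of_real divide_inverse mult_ac)
    also have "of_real (h x) * exp (c * of_real (u x)) * exp ((s - c) * of_real (u x)) = of_real (h x) * exp (s * of_real (u x))"
      by (simp add: mult.assoc exp_add[symmetric] algebra_simps)
    finally show "(\<Sum>k. f k x) = of_real (h x) * exp (s * of_real (u x))" by (simp add: sums_iff)
  qed
  also have "(\<lambda>k. integral\<^sup>L M (f k)) = (\<lambda>k. coeff c k * (s - c) ^ k)"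
  proof
    fix k
    have "f k = (\<lambda>x. (of_real (h x) * exp (c * of_real (u x)) * of_real (u x) ^ k / fact k) * (s - c) ^ k)"
      by (simp add: f_def fun_eq_iff power_mult_distrib)
    thus "integral\<^sup>L M (f k) = coeff c k * (s - c) ^ k" by (simp add: coeff_def)
  qed
  finally show ?thesis by (simp add: F_def)
qed

lemma holomorphic: "F holomorphic_on {s. a < Re s \<and> Re s < b}"
proof -
  have "F field_differentiable (at c)" if c: "a < Re c" "Re c < b" for c
  proof -
    define r where "r = min (Re c - a) (b - Re c)"
    have r: "r > 0" "a \<le> Re c - r" "Re c + r \<le> b" using c by (auto simp: r_def)
    have "F holomorphic_on ball c r"
      by (rule power_series_holomorphic, rule power_series[of _ r]) (use r in \<open>auto simp: dist_norm norm_minus_commute\<close>)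
    thus ?thesis using r by (intro holomorphic_on_imp_differentiable_at) auto
  qed
  thus ?thesis by (auto simp: holomorphic_on_def intro: field_differentiable_at_within)
qed

text \<open>Landau's lemma: the Taylor coefficients of \<open>F\<close> at \<open>c\<close> are nonnegative integrals, and
  monotone convergence reassembles the exponential at any point of the disc where the
  Taylor series of the continuation converges.\<close>
lemma landau:
  assumes nonneg: "\<And>x. 0 \<le> h x" "\<And>x. h x \<noteq> 0 \<Longrightarrow> 0 \<le> u x"
    and c: "a < c" "c < b"
    and \<Phi>: "\<Phi> holomorphic_on ball (of_real c) R" "0 < \<delta>"
      "\<And>s. norm (s - of_real c) < \<delta> \<Longrightarrow> \<Phi> s = F s"
    and \<rho>: "0 \<le> \<rho>" "\<rho> < R"
  shows "integrable M (\<lambda>x. h x * exp ((c + \<rho>) * u x))"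
proof -
  \<comment> \<open>On a disc of this radius \<Phi> coincides with \<open>F\<close>, and
    \<open>F\<close> has its own integral power series.\<close>
  define r where "r = min (min \<delta> R) (min (c - a) (b - c))"
  have r: "r > 0" "r \<le> \<delta>" "r \<le> R" "a \<le> c - r" "c + r \<le> b" using c \<Phi>(2) \<rho> by (auto simp: r_def)
  define d where "d = (\<lambda>k. (deriv ^^ k) \<Phi> (of_real c) / fact k)"
  have taylor: "(\<lambda>k. d k * (s - of_real c) ^ k) sums \<Phi> s" if "norm (s - of_real c) < R" for s
    unfolding d_def using holomorphic_power_series[OF \<Phi>(1), of s] that
    by (simp add: dist_norm norm_minus_commute)
  have d_eq: "d = coeff (of_real c)"
  proof (rule power_series_coeffs_eq[OF r(1)])
    fix s :: complex assume s: "norm (s - of_real c) < r"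
    show "(\<lambda>k. d k * (s - of_real c) ^ k) sums \<Phi> s" using taylor s r by auto
    have "(\<lambda>k. coeff (of_real c) k * (s - of_real c) ^ k) sums F s"
      using s r by (intro power_series[of _ r]) auto
    thus "(\<lambda>k. coeff (of_real c) k * (s - of_real c) ^ k) sums \<Phi> s" using \<Phi>(3)[of s] s r by simp
  qed
  define g where "g = (\<lambda>k x. h x * exp (c * u x) * (u x * \<rho>) ^ k / fact k)"
  have g0: "0 \<le> g k x" for k x
    using nonneg(1)[of x] nonneg(2)[of x] \<rho>(1) by (cases "h x = 0") (auto simp: g_def)
  have g_int: "integrable M (g k)" for k
  proof (cases "\<rho> = 0")
    case True
    thus ?thesis
      using integrable_exp_real[of c] c unfolding g_def by (cases k) auto
  next
    case False
    \<comment> \<open>At the reduced distance \<open>t * \<rho>\<close> the whole exponential series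
      is below \<open>bound\<close>; the factor (1/t)^k restores the single k-th term. So each
      \<open>g k\<close> is integrable although the integrability of their sum is still
      open.\<close>
    define t where "t = min 1 (r / \<rho>)"
    have t: "t > 0" "t * \<rho> \<le> r" using r(1) False \<rho> by (auto simp: t_def min_def field_simps)
    have "g k x \<le> (1 / t) ^ k * bound x" for x
    proof -
      have "h x * exp (c * u x) * ((u x * (t * \<rho>)) ^ k / fact k) \<le> h x * exp (c * u x) * exp (u x * (t * \<rho>))"
      proof (cases "h x = 0")
        case False
        hence "0 \<le> u x * (t * \<rho>)" using nonneg t \<rho> by simp
        hence "(u x * (t * \<rho>)) ^ k / fact k \<le> exp (u x * (t * \<rho>))"
          using sum_le_suminf[OF summable_exp_generic[of "u x * (t * \<rho>)"], of "{k}"]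
          by (simp add: exp_def scaleR_conv_of_real divide_inverse mult.commute)
        thus ?thesis using nonneg by (intro mult_left_mono) auto
      qed simp
      also have "\<dots> \<le> \<bar>h x\<bar> * (exp (c * u x) * exp ((t * \<rho>) * \<bar>u x\<bar>))"
        using nonneg t \<rho> by (cases "h x = 0") (auto simp: mult_ac)
      also have "\<dots> \<le> bound x" using t \<rho> r by (intro exp_le_bound) auto
      finally have "(1 / t) ^ k * (h x * exp (c * u x) * ((u x * (t * \<rho>)) ^ k / fact k)) \<le> (1 / t) ^ k * bound x"
        using t by (intro mult_left_mono) auto
      moreover have "g k x = (1 / t) ^ k * (h x * exp (c * u x) * ((u x * (t * \<rho>)) ^ k / fact k))"
        using t by (simp add: g_def power_mult_distrib power_divide field_simps)
      ultimately show ?thesis by (simp only:)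
    qed
    moreover have "g k \<in> borel_measurable M" unfolding g_def by measurable
    ultimately show ?thesis
      using g0 by (intro Bochner_Integration.integrable_bound[OF integrable_mult_right[OF integrable_bound, of "(1 / t) ^ k"]] AE_I2)
        (simp_all add: order_trans[OF _ abs_ge_self])
  qed
  have g_coeff: "complex_of_real (integral\<^sup>L M (g k)) = d k * of_real \<rho> ^ k" for k
  proof -
    have "complex_of_real (integral\<^sup>L M (g k)) = (\<integral>x. complex_of_real (g k x) \<partial>M)"
      by (rule integral_complex_of_real[symmetric])
    also have "(\<lambda>x. complex_of_real (g k x)) =
        (\<lambda>x. (of_real (h x) * exp (of_real c * of_real (u x)) * of_real (u x) ^ k / fact k) * of_real \<rho> ^ k)"
      by (simp add: fun_eq_iff g_def power_mult_distrib exp_of_real[symmetric])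
    finally show ?thesis by (simp only: d_eq coeff_def Bochner_Integration.integral_mult_left_zero)
  qed
  have "integrable M (\<lambda>x. \<Sum>k. g k x)"
  proof (rule integrable_suminf[OF g_int])
    have g_sums: "(\<lambda>k. g k x) sums (h x * exp (c * u x) * exp (u x * \<rho>))" for x
      unfolding g_def using sums_mult[OF exp_converges[of "u x * \<rho>"], of "h x * exp (c * u x)"]
      by (simp add: divide_inverse mult_ac)
    show "AE x in M. summable (\<lambda>k. norm (g k x))"
      using g_sums g0 by (auto simp: sums_iff)
    \<comment> \<open>At this real point every term of the Taylor series is a nonnegative integral,
      so its convergence bounds the sum of the integrals of \<open>norm (g k x)\<close>.\<close>
    have "(\<lambda>k. d k * of_real \<rho> ^ k) sums \<Phi> (of_real (c + \<rho>))"
      using taylor[of "of_real (c + \<rho>)"] \<rho> by (simp add: norm_of_real)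
    hence "summable (\<lambda>k. complex_of_real (integral\<^sup>L M (g k)))" unfolding g_coeff by (rule sums_summable)
    hence "summable (\<lambda>k. integral\<^sup>L M (g k))" by (simp only: summable_complex_of_real)
    thus "summable (\<lambda>k. \<integral>x. norm (g k x) \<partial>M)" using g0 by simp
  qed
  also have "(\<lambda>x. \<Sum>k. g k x) = (\<lambda>x. h x * exp ((c + \<rho>) * u x))"
  proof
    fix x
    have "(\<lambda>k. g k x) sums (h x * exp (c * u x) * exp (u x * \<rho>))"
      unfolding g_def using sums_mult[OF exp_converges[of "u x * \<rho>"], of "h x * exp (c * u x)"]
      by (simp add: divide_inverse mult_ac)
    thus "(\<Sum>k. g k x) = h x * exp ((c + \<rho>) * u x)"
      by (simp add: sums_iff mult.assoc exp_add[symmetric] algebra_simps)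
  qed
  finally show ?thesis .
qed

end

subsection \<open>Mellin transforms of sine series\<close>

text \<open>Beta integral after the substitution $u = t^2/(1+t^2)$.\<close>
lemma integral_powr_over_one_plus_square:
  fixes w :: real
  assumes w: "0 < w" "w < 2"
  defines "B \<equiv> Beta (w / 2) (1 - w / 2) / 2"
  shows "set_integrable lborel {0<..} (\<lambda>t. t powr (w - 1) / (1 + t\<^sup>2))"
    and "(LBINT t:{0<..}. t powr (w - 1) / (1 + t\<^sup>2)) = B"
proof -
  define g :: "real \<Rightarrow> real" where "g = (\<lambda>t. t\<^sup>2 / (1 + t\<^sup>2))"
  define g' :: "real \<Rightarrow> real" where "g' = (\<lambda>t. 2 * t / (1 + t\<^sup>2)\<^sup>2)"
  define f :: "real \<Rightarrow> real" where "f = (\<lambda>u. u powr (w / 2 - 1) * (1 - u) powr (1 - w / 2 - 1))"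
  have pos: "1 + t\<^sup>2 > 0" for t :: real by (simp add: add_pos_nonneg)
  have pos': "1 + t\<^sup>2 \<noteq> 0" for t :: real using pos[of t] by simp
  have der: "(g has_field_derivative g' t) (at t within {0<..})" for t
    unfolding g_def g'_def
    by (rule derivative_eq_intros refl pos' | simp add: field_simps power2_eq_square)+
  have img: "g ` {0<..} = {0<..<1}"
  proof (intro equalityI subsetI)
    fix y assume "y \<in> g ` {0<..}"
    thus "y \<in> {0<..<1}" using pos by (auto simp: g_def field_simps)
  next
    fix y :: real assume y: "y \<in> {0<..<1}"
    hence "y = g (sqrt (y / (1 - y)))" by (simp add: g_def field_simps)
    moreover have "sqrt (y / (1 - y)) \<in> {0<..}" using y by simp
    ultimately show "y \<in> g ` {0<..}" by blast
  qed
  have inj: "inj_on g {0<..}"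
  proof (rule inj_onI)
    fix x y :: real assume xy: "x \<in> {0<..}" "y \<in> {0<..}" "g x = g y"
    hence "x\<^sup>2 * (1 + y\<^sup>2) = y\<^sup>2 * (1 + x\<^sup>2)" using pos' by (simp add: g_def field_simps)
    hence "x\<^sup>2 = y\<^sup>2" by (simp add: algebra_simps)
    thus "x = y" using xy by (simp add: power2_eq_iff_nonneg)
  qed
  have "(f has_integral 2 * B) {0..1}"
    unfolding f_def B_def using has_integral_Beta_real[of "w / 2" "1 - w / 2"] w by simp
  hence fB: "(f has_integral 2 * B) {0<..<1}" by (simp add: has_integral_Icc_iff_Ioo)
  moreover have "f absolutely_integrable_on {0<..<1}"
    using fB by (intro nonnegative_absolutely_integrable_1) (auto simp: f_def has_integral_iff)
  ultimately have "f absolutely_integrable_on g ` {0<..} \<and> integral (g ` {0<..}) f = 2 * B"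
    unfolding img by (simp add: has_integral_iff)
  hence *: "(\<lambda>t. \<bar>g' t\<bar> * f (g t)) absolutely_integrable_on {0<..} \<and>
      integral {0<..} (\<lambda>t. \<bar>g' t\<bar> * f (g t)) = 2 * B"
    by (subst has_absolute_integral_change_of_variables_1'[OF _ der inj]) auto
  have eq: "\<bar>g' t\<bar> * f (g t) = 2 * (t powr (w - 1) / (1 + t\<^sup>2))" if t: "t \<in> {0<..}" for t
  proof -
    have t0: "t > 0" using t by simp
    have 1: "1 - g t = 1 / (1 + t\<^sup>2)" using pos'[of t] by (simp add: g_def field_simps)
    have "f (g t) = (t\<^sup>2) powr (w / 2 - 1) / (1 + t\<^sup>2) powr (w / 2 - 1) * (1 / (1 + t\<^sup>2) powr (1 - w / 2 - 1))"
      unfolding f_def 1 using pos[of t] by (simp add: g_def powr_divide)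
    also have "(t\<^sup>2) powr (w / 2 - 1) = t powr (w - 2)"
    proof -
      have "t\<^sup>2 = t powr 2" using t0 by (simp add: powr_numeral)
      hence "(t\<^sup>2) powr (w / 2 - 1) = t powr (2 * (w / 2 - 1))" by (simp only: powr_powr)
      thus ?thesis by (simp add: right_diff_distrib)
    qed
    also have "t powr (w - 2) / (1 + t\<^sup>2) powr (w / 2 - 1) * (1 / (1 + t\<^sup>2) powr (1 - w / 2 - 1)) =
        t powr (w - 2) / ((1 + t\<^sup>2) powr (w / 2 - 1) * (1 + t\<^sup>2) powr (1 - w / 2 - 1))" by simp
    also have "(1 + t\<^sup>2) powr (w / 2 - 1) * (1 + t\<^sup>2) powr (1 - w / 2 - 1) = (1 + t\<^sup>2) powr (-1)"
      by (subst powr_add[symmetric]) simp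
    also have "\<dots> = 1 / (1 + t\<^sup>2)" using pos[of t] by (simp add: powr_minus_divide)
    finally have "\<bar>g' t\<bar> * f (g t) = 2 * (t * t powr (w - 2)) / (1 + t\<^sup>2)"
      using t0 pos[of t] by (simp add: g'_def power2_eq_square)
    also have "t * t powr (w - 2) = t powr (w - 1)"
      using t0 powr_add[of t 1 "w - 2"] by simp
    finally show ?thesis by simp
  qed
  have ai: "(\<lambda>t. 2 * (t powr (w - 1) / (1 + t\<^sup>2))) absolutely_integrable_on {0<..}"
    using * eq by (subst set_integrable_cong[OF refl refl eq[symmetric]]) auto
  have ii: "integral {0<..} (\<lambda>t. 2 * (t powr (w - 1) / (1 + t\<^sup>2))) = 2 * B"
    using * by (metis (no_types, lifting) Henstock_Kurzweil_Integration.integral_cong eq)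
  have "(\<lambda>t. (1/2) * (2 * (t powr (w - 1) / (1 + t\<^sup>2)))) absolutely_integrable_on {0<..}"
    by (rule set_integrable_mult_right[OF ai]) 
  hence ai2: "(\<lambda>t. t powr (w - 1) / (1 + t\<^sup>2)) absolutely_integrable_on {0<..}" by simp
  have "(\<lambda>t. indicat_real {0<..} t *\<^sub>R (t powr (w - 1) / (1 + t\<^sup>2))) \<in> borel_measurable borel" by measurable
  thus si: "set_integrable lborel {0<..} (\<lambda>t. t powr (w - 1) / (1 + t\<^sup>2))"
    using ai2 unfolding set_integrable_def by (subst (asm) integrable_completion) auto
  have "integral {0<..} (\<lambda>t. t powr (w - 1) / (1 + t\<^sup>2)) = (LBINT t:{0<..}. t powr (w - 1) / (1 + t\<^sup>2))"
    using set_borel_integral_eq_integral(2)[OF si] by simp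
  thus "(LBINT t:{0<..}. t powr (w - 1) / (1 + t\<^sup>2)) = B"
    using ii by (simp only: Henstock_Kurzweil_Integration.integral_mult_right)
qed

text \<open>Read from right to left, this writes x^(-w) as a superposition of the exponentials exp
  (- x t), which is how it enters the sine integral.\<close>

lemma has_bochner_integral_Gamma_scaled:
  fixes w x :: real
  assumes "0 < w" "0 < x"
  shows "has_bochner_integral lborel (\<lambda>t. indicator {0<..} t * (t powr (w - 1) * exp (- (x * t)))) (Gamma w * x powr (- w))"
proof -
  have "has_bochner_integral lborel (\<lambda>t. indicator {0..} t * (t powr (w - 1) / exp t)) (Gamma w)"
    using Gamma_conv_nn_integral_real[OF assms(1)] assms
    by (intro has_bochner_integral_nn_integral) (auto simp: mult.commute Gamma_real_pos less_imp_le)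
  hence "has_bochner_integral lborel (\<lambda>t. indicator {0..} (0 + x * t) * ((0 + x * t) powr (w - 1) / exp (0 + x * t))) (Gamma w /\<^sub>R \<bar>x\<bar>)"
    using assms by (subst (asm) lborel_has_bochner_integral_real_affine_iff[of x _ _ 0]) auto
  hence "has_bochner_integral lborel (\<lambda>t. x powr (1 - w) * (indicator {0..} (0 + x * t) * ((0 + x * t) powr (w - 1) / exp (0 + x * t)))) (x powr (1 - w) * (Gamma w /\<^sub>R \<bar>x\<bar>))"
    by (rule has_bochner_integral_mult_right)
  also have "(\<lambda>t. x powr (1 - w) * (indicator {0..} (0 + x * t) * ((0 + x * t) powr (w - 1) / exp (0 + x * t)))) = (\<lambda>t. indicator {0<..} t * (t powr (w - 1) * exp (- (x * t))))"
  proof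
    fix t :: real
    have "x powr (1 - w) * x powr (w - 1) = 1" using assms by (simp add: powr_add[symmetric])
    moreover have "(x * t) powr (w - 1) = x powr (w - 1) * t powr (w - 1)" if "t > 0" using assms that by (simp add: powr_mult)
    ultimately show "x powr (1 - w) * (indicator {0..} (0 + x * t) * ((0 + x * t) powr (w - 1) / exp (0 + x * t))) = indicator {0<..} t * (t powr (w - 1) * exp (- (x * t)))"
      using assms by (cases t "0 :: real" rule: linorder_cases) (auto simp: indicator_def exp_minus divide_inverse zero_le_mult_iff)
  qed
  also have "x powr (1 - w) * (Gamma w /\<^sub>R \<bar>x\<bar>) = Gamma w * x powr (- w)"
    using assms by (simp add: powr_diff powr_minus field_simps)
  finally show ?thesis .
qed

lemma integral_sin_exp:
  fixes t :: real
  assumes t: "t > 0"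
  shows "(\<integral>x. indicator {0<..} x * (sin x * exp (- (x * t))) \<partial>lborel) = 1 / (1 + t\<^sup>2)"
proof -
  have pos: "1 + t\<^sup>2 > 0" by (simp add: add_pos_nonneg)
  \<comment> \<open>The imaginary part of exp ((\<i> - t) x) / (\<i> - t).\<close>
  define F where "F = (\<lambda>x. - (exp (- (x * t)) * (t * sin x + cos x)) / (1 + t\<^sup>2))"
  have e: "integrable lborel (\<lambda>x. indicator {0<..} x * (x powr (1 - 1) * exp (- (t * x))))"
    using has_bochner_integral_Gamma_scaled[of 1 t] t by (simp add: has_bochner_integral_iff)
  have si: "integrable lborel (\<lambda>x. indicator {0<..} x * (sin x * exp (- (x * t))))"
    by (rule Bochner_Integration.integrable_bound[OF e]) (auto simp: indicator_def abs_mult mult.commute intro!: AE_I2 mult_left_le_one_le)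
  have "(LBINT x=ereal 0..\<infinity>. sin x * exp (- (x * t))) = 0 - (- 1 / (1 + t\<^sup>2))"
  proof (rule interval_integral_FTC_integrable[where F = F])
    show "(F has_vector_derivative sin x * exp (- (x * t))) (at x)" for x
    proof -
      define K where "K = 1 / (1 + t\<^sup>2)"
      have F_eq: "F = (\<lambda>x. - (K * (exp (- (x * t)) * (t * sin x + cos x))))"
        by (simp add: F_def K_def fun_eq_iff)
      have "(F has_field_derivative - (K * ((- t * exp (- (x * t))) * (t * sin x + cos x)
          + exp (- (x * t)) * (t * cos x - sin x)))) (at x)"
        unfolding F_eq by (auto intro!: derivative_eq_intros simp: algebra_simps)
      also have "- (K * ((- t * exp (- (x * t))) * (t * sin x + cos x) + exp (- (x * t)) * (t * cos x - sin x)))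
          = (K * (1 + t\<^sup>2)) * (sin x * exp (- (x * t)))"
        by (simp add: algebra_simps power2_eq_square)
      also have "K * (1 + t\<^sup>2) = 1" using pos by (simp add: K_def)
      finally have "(F has_field_derivative sin x * exp (- (x * t))) (at x)" by simp
      thus ?thesis by (simp add: has_real_derivative_iff_has_vector_derivative)
    qed
    show "((F \<circ> real_of_ereal) \<longlongrightarrow> - 1 / (1 + t\<^sup>2)) (at_right (ereal 0))"
    proof -
      have "(F \<longlongrightarrow> F 0) (at_right 0)" unfolding F_def using pos by (intro tendsto_intros) auto
      thus ?thesis by (simp add: ereal_tendsto_simps F_def)
    qed
    show "((F \<circ> real_of_ereal) \<longlongrightarrow> 0) (at_left \<infinity>)"
    proof -
      have "(F \<longlongrightarrow> 0) at_top"
      proof (rule Lim_null_comparison)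
        show "eventually (\<lambda>x. norm (F x) \<le> (t + 1) / (1 + t\<^sup>2) * exp (- (t * x))) at_top"
        proof (intro always_eventually allI)
          fix x
          have "\<bar>t * sin x + cos x\<bar> \<le> \<bar>t * sin x\<bar> + \<bar>cos x\<bar>" by simp
          also have "\<bar>t * sin x\<bar> \<le> t * 1" using t by (simp add: abs_mult)
          also have "\<bar>cos x\<bar> \<le> 1" by simp
          finally have "\<bar>t * sin x + cos x\<bar> \<le> t + 1" by simp
          hence "exp (- (x * t)) * \<bar>t * sin x + cos x\<bar> \<le> exp (- (x * t)) * (t + 1)" by (intro mult_left_mono) auto
          thus "norm (F x) \<le> (t + 1) / (1 + t\<^sup>2) * exp (- (t * x))"
            using pos by (simp add: F_def abs_mult divide_right_mono mult.commute)
        qed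
        have "((\<lambda>x. exp (- (t * x))) \<longlongrightarrow> 0) at_top"
          using t by real_asymp
        thus "((\<lambda>x. (t + 1) / (1 + t\<^sup>2) * exp (- (t * x))) \<longlongrightarrow> 0) at_top"
          by (intro tendsto_mult_right_zero)
      qed
      thus ?thesis by (simp add: ereal_tendsto_simps)
    qed
    show "set_integrable lborel (einterval (ereal 0) \<infinity>) (\<lambda>x. sin x * exp (- (x * t)))"
      using si by (simp add: set_integrable_def einterval_def greaterThan_def)
  qed (auto intro!: continuous_intros)
  thus ?thesis
    by (simp add: interval_lebesgue_integral_def set_lebesgue_integral_def einterval_def greaterThan_def)
qed

text \<open>On (0, 1] the bound |sin x| <= x leaves x^(1-w), integrable for w < 2; from 1 on |sin x|
  <= 1 leaves x^(-w), integrable for w > 1.\<close>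

lemma integrable_sin_powr:
  fixes w :: real
  assumes w: "1 < w" "w < 2"
  shows "integrable lborel (\<lambda>x. indicator {0<..} x * (sin x * x powr (- w)))"
proof -
  have "(\<lambda>x. x powr (1 - w)) absolutely_integrable_on {0..1}"
    using w by (intro nonnegative_absolutely_integrable_1 integrable_on_powr_from_0) auto
  hence 1: "integrable lborel (\<lambda>x. indicator {0..1} x *\<^sub>R (x powr (1 - w)))"
    unfolding set_integrable_def by (subst (asm) integrable_completion) auto
  have "(\<lambda>x. x powr (- w)) absolutely_integrable_on {1..}"
    using w has_integral_powr_to_inf[of "- w" 1] by (intro nonnegative_absolutely_integrable_1) (auto simp: has_integral_iff)
  hence 2: "integrable lborel (\<lambda>x. indicator {1..} x *\<^sub>R (x powr (- w)))"
    unfolding set_integrable_def by (subst (asm) integrable_completion) auto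
  show ?thesis
  proof (rule Bochner_Integration.integrable_bound[OF Bochner_Integration.integrable_add[OF 1 2]])
    show "(\<lambda>x. indicator {0<..} x * (sin x * x powr (- w))) \<in> borel_measurable lborel" by measurable
    show "AE x in lborel. norm (indicator {0<..} x * (sin x * x powr (- w)))
        \<le> norm (indicator {0..1} x *\<^sub>R (x powr (1 - w)) + indicator {1..} x *\<^sub>R (x powr (- w)))"
    proof (intro AE_I2)
      fix x :: real
      show "norm (indicator {0<..} x * (sin x * x powr (- w)))
        \<le> norm (indicator {0..1} x *\<^sub>R (x powr (1 - w)) + indicator {1..} x *\<^sub>R (x powr (- w)))"
      proof (cases "x > 0")
        case True
        have "\<bar>sin x\<bar> * x powr (- w) \<le> x * x powr (- w)"
          using abs_sin_x_le_abs_x[of x] True by (intro mult_right_mono) auto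
        also have "x * x powr (- w) = x powr (1 - w)" using True by (simp add: powr_diff powr_minus divide_inverse)
        finally have a: "\<bar>sin x\<bar> * x powr (- w) \<le> x powr (1 - w)" .
        have b: "\<bar>sin x\<bar> * x powr (- w) \<le> x powr (- w)" by (intro mult_left_le_one_le) auto
        have c: "\<bar>sin x\<bar> \<le> 2" using abs_sin_le_one[of x] by linarith
        show ?thesis using a b c True by (auto simp: indicator_def abs_mult)
      qed simp
    qed
  qed
qed

text \<open>Replacing Gamma(w) x^(-w) by the integral of t^(w-1) exp (- x t) and exchanging the
  order of integration leaves t^(w-1) / (1 + t^2), a Beta integral. The exchange rests on the
  absolute integrability of sin x * x^(-w).\<close>

lemma integral_sin_powr:
  fixes w :: real
  assumes w: "1 < w" "w < 2"
  shows "(\<integral>x. indicator {0<..} x * (sin x * x powr (- w)) \<partial>lborel)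
    = Gamma (w / 2) * Gamma (1 - w / 2) / (2 * Gamma w)"
proof -
  define f :: "real \<Rightarrow> real \<Rightarrow> real" where
    "f = (\<lambda>x t. indicator {0<..} x * (indicator {0<..} t * (sin x * (t powr (w - 1) * exp (- (x * t))))))"
  have G: "Gamma w > 0" using w by (intro Gamma_real_pos) auto
  have inner: "has_bochner_integral lborel (f x) (Gamma w * (indicator {0<..} x * (sin x * x powr (- w))))" for x
  proof (cases "x > 0")
    case True
    have "has_bochner_integral lborel (\<lambda>t. sin x * (indicator {0<..} t * (t powr (w - 1) * exp (- (x * t))))) (sin x * (Gamma w * x powr (- w)))"
      using True w by (intro has_bochner_integral_mult_right has_bochner_integral_Gamma_scaled) auto
    thus ?thesis using True by (simp add: f_def mult_ac)
  qed (simp add: f_def has_bochner_integral_zero)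
  have inner_abs: "has_bochner_integral lborel (\<lambda>t. norm (f x t)) (Gamma w * \<bar>indicator {0<..} x * (sin x * x powr (- w))\<bar>)" for x
  proof (cases "x > 0")
    case True
    have "has_bochner_integral lborel (\<lambda>t. \<bar>sin x\<bar> * (indicator {0<..} t * (t powr (w - 1) * exp (- (x * t))))) (\<bar>sin x\<bar> * (Gamma w * x powr (- w)))"
      using True w by (intro has_bochner_integral_mult_right has_bochner_integral_Gamma_scaled) auto
    thus ?thesis using True by (simp add: f_def abs_mult mult_ac)
  qed (simp add: f_def has_bochner_integral_zero)
  have int: "integrable (lborel \<Otimes>\<^sub>M lborel) (case_prod f)"
  proof (rule lborel_pair.Fubini_integrable)
    show "case_prod f \<in> borel_measurable (lborel \<Otimes>\<^sub>M lborel)" unfolding f_def by measurable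
    have "(\<lambda>x. \<integral>t. norm (case_prod f (x, t)) \<partial>lborel) = (\<lambda>x. Gamma w * \<bar>indicator {0<..} x * (sin x * x powr (- w))\<bar>)"
      using inner_abs by (auto simp: has_bochner_integral_iff)
    thus "integrable lborel (\<lambda>x. \<integral>t. norm (case_prod f (x, t)) \<partial>lborel)"
      using integrable_sin_powr[OF w] by simp
    show "AE x in lborel. integrable lborel (\<lambda>t. case_prod f (x, t))"
      using inner by (auto simp: has_bochner_integral_iff)
  qed
  have "(\<integral>t. (\<integral>x. f x t \<partial>lborel) \<partial>lborel) = (\<integral>x. (\<integral>t. f x t \<partial>lborel) \<partial>lborel)"
    by (rule lborel_pair.Fubini_integral[OF int])
  also have "\<dots> = Gamma w * (\<integral>x. indicator {0<..} x * (sin x * x powr (- w)) \<partial>lborel)"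
    using inner by (simp add: has_bochner_integral_iff)
  also have "(\<lambda>t. \<integral>x. f x t \<partial>lborel) = (\<lambda>t. indicator {0<..} t * (t powr (w - 1) / (1 + t\<^sup>2)))"
  proof
    fix t :: real
    have "(\<integral>x. f x t \<partial>lborel) = (\<integral>x. (indicator {0<..} t * t powr (w - 1)) * (indicator {0<..} x * (sin x * exp (- (x * t)))) \<partial>lborel)"
      by (simp add: f_def mult_ac)
    also have "\<dots> = (indicator {0<..} t * t powr (w - 1)) * (\<integral>x. indicator {0<..} x * (sin x * exp (- (x * t))) \<partial>lborel)" by simp
    finally show "(\<integral>x. f x t \<partial>lborel) = indicator {0<..} t * (t powr (w - 1) / (1 + t\<^sup>2))"
      using integral_sin_exp[of t] by (cases "t > 0") auto
  qed
  also have "(\<integral>t. indicator {0<..} t * (t powr (w - 1) / (1 + t\<^sup>2)) \<partial>lborel) = Beta (w / 2) (1 - w / 2) / 2"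
    using integral_powr_over_one_plus_square(2)[of w] w by (simp add: set_lebesgue_integral_def)
  finally show ?thesis using G by (simp add: Beta_def field_simps)
qed

lemma has_bochner_integral_sin_powr_scaled:
  fixes w a :: real
  assumes w: "1 < w" "w < 2" and a: "a > 0"
  shows "has_bochner_integral lborel (\<lambda>x. indicator {0<..} x * (sin (a * x) * x powr (- w)))
    (a powr (w - 1) * (\<integral>x. indicator {0<..} x * (sin x * x powr (- w)) \<partial>lborel))"
    and "has_bochner_integral lborel (\<lambda>x. \<bar>indicator {0<..} x * (sin (a * x) * x powr (- w))\<bar>)
    (a powr (w - 1) * (\<integral>x. \<bar>indicator {0<..} x * (sin x * x powr (- w))\<bar> \<partial>lborel))"
proof -
  define f where "f = (\<lambda>x::real. indicator {0<..} x * (sin x * x powr (- w)))"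
  have f: "integrable lborel f" unfolding f_def by (rule integrable_sin_powr[OF w])
  have eq: "a powr w * f (0 + a * x) = indicator {0<..} x * (sin (a * x) * x powr (- w))" for x
  proof (cases "x > 0")
    case True
    have "a powr w * (a * x) powr (- w) = x powr (- w)"
      using a True by (simp add: powr_mult powr_minus)
    thus ?thesis using True a by (simp add: f_def)
  next
    case False
    thus ?thesis using a by (simp add: f_def zero_less_mult_iff)
  qed
  have sc: "has_bochner_integral lborel (\<lambda>x. a powr w * F (0 + a * x)) (a powr (w - 1) * integral\<^sup>L lborel F)"
    if "integrable lborel F" for F :: "real \<Rightarrow> real"
  proof -
    have "has_bochner_integral lborel F (integral\<^sup>L lborel F)" using that by (rule has_bochner_integral_integrable)
    hence "has_bochner_integral lborel (\<lambda>x. F (0 + a * x)) (integral\<^sup>L lborel F /\<^sub>R \<bar>a\<bar>)"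
      using a by (subst (asm) lborel_has_bochner_integral_real_affine_iff[of a _ _ 0]) auto
    hence "has_bochner_integral lborel (\<lambda>x. a powr w * F (0 + a * x)) (a powr w * (integral\<^sup>L lborel F /\<^sub>R \<bar>a\<bar>))"
      by (rule has_bochner_integral_mult_right)
    also have "a powr w * (integral\<^sup>L lborel F /\<^sub>R \<bar>a\<bar>) = a powr (w - 1) * integral\<^sup>L lborel F"
      using a by (simp add: powr_diff divide_inverse mult_ac)
    finally show ?thesis .
  qed
  show "has_bochner_integral lborel (\<lambda>x. indicator {0<..} x * (sin (a * x) * x powr (- w)))
    (a powr (w - 1) * (\<integral>x. indicator {0<..} x * (sin x * x powr (- w)) \<partial>lborel))"
    using sc[OF f] unfolding eq by (simp only: f_def)
  have "(\<lambda>x. a powr w * \<bar>f (0 + a * x)\<bar>) = (\<lambda>x. \<bar>indicator {0<..} x * (sin (a * x) * x powr (- w))\<bar>)"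
    unfolding eq[symmetric] by (simp add: abs_mult)
  thus "has_bochner_integral lborel (\<lambda>x. \<bar>indicator {0<..} x * (sin (a * x) * x powr (- w))\<bar>)
    (a powr (w - 1) * (\<integral>x. \<bar>indicator {0<..} x * (sin x * x powr (- w))\<bar> \<partial>lborel))"
    using sc[OF integrable_abs[OF f]] by (simp only: f_def)
qed

text \<open>The n-th term has L1 norm proportional to |c n| (n + 1)^(w-1), so the first summability
  assumption permits termwise integration; the second makes the sine series itself converge at every
  x. It is applied to both f and the periodic B_3.\<close>

lemma sine_series_mellin:
  fixes c :: "nat \<Rightarrow> real" and w :: real
  assumes w: "1 < w" "w < 2"
    and c: "summable (\<lambda>n. \<bar>c n\<bar> * real (Suc n) powr (w - 1))"
    and abs_c: "summable (\<lambda>n. \<bar>c n\<bar>)"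
  shows "has_bochner_integral lborel (\<lambda>x. indicator {0<..} x * ((\<Sum>n. c n * sin (2 * pi * real (Suc n) * x)) * x powr (- w)))
    (Gamma (w / 2) * Gamma (1 - w / 2) / (2 * Gamma w) * (2 * pi) powr (w - 1) * (\<Sum>n. c n * real (Suc n) powr (w - 1)))"
proof -
  define S where "S = (\<integral>x. indicator {0<..} x * (sin x * x powr (- w)) \<partial>lborel)"
  define A where "A = (\<integral>x. \<bar>indicator {0<..} x * (sin x * x powr (- w))\<bar> \<partial>lborel)"
  define f where "f = (\<lambda>n x. c n * (indicator {0<..} x * (sin ((2 * pi * real (Suc n)) * x) * x powr (- w))))"
  have pos: "2 * pi * real (Suc n) > 0" for n by simp
  have powr_eq: "(2 * pi * real (Suc n)) powr (w - 1) = (2 * pi) powr (w - 1) * real (Suc n) powr (w - 1)" for n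
    by (rule powr_mult)
  have f: "has_bochner_integral lborel (f n) (c n * ((2 * pi * real (Suc n)) powr (w - 1) * S))" for n
    unfolding f_def S_def by (intro has_bochner_integral_mult_right has_bochner_integral_sin_powr_scaled(1) w pos)
  have f_abs: "has_bochner_integral lborel (\<lambda>x. \<bar>c n\<bar> * \<bar>indicator {0<..} x * (sin ((2 * pi * real (Suc n)) * x) * x powr (- w))\<bar>)
      (\<bar>c n\<bar> * ((2 * pi * real (Suc n)) powr (w - 1) * A))" for n
    unfolding A_def by (intro has_bochner_integral_mult_right has_bochner_integral_sin_powr_scaled(2) w pos)
  have norm_eq: "(\<lambda>x. norm (f n x)) = (\<lambda>x. \<bar>c n\<bar> * \<bar>indicator {0<..} x * (sin ((2 * pi * real (Suc n)) * x) * x powr (- w))\<bar>)" for n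
    by (simp add: f_def abs_mult fun_eq_iff)
  have f_int: "integrable lborel (f n)" for n using f by (simp add: has_bochner_integral_iff)
  have sm_sin: "summable (\<lambda>n. \<bar>c n * sin (2 * pi * real (Suc n) * x)\<bar>)" for x
    by (rule summable_comparison_test'[OF abs_c]) (simp add: abs_mult mult_left_le)
  have sm: "summable (\<lambda>n. norm (f n x))" for x
  proof -
    have "summable (\<lambda>n. \<bar>indicator {0<..} x * x powr (- w)\<bar> * \<bar>c n * sin (2 * pi * real (Suc n) * x)\<bar>)"
      by (intro summable_mult sm_sin)
    thus ?thesis by (simp add: f_def abs_mult mult_ac)
  qed
  have sm2: "summable (\<lambda>n. \<integral>x. norm (f n x) \<partial>lborel)"
  proof -
    have "summable (\<lambda>n. ((2 * pi) powr (w - 1) * A) * (\<bar>c n\<bar> * real (Suc n) powr (w - 1)))"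
      by (intro summable_mult c)
    also have "(\<lambda>n. ((2 * pi) powr (w - 1) * A) * (\<bar>c n\<bar> * real (Suc n) powr (w - 1))) = (\<lambda>n. \<integral>x. norm (f n x) \<partial>lborel)"
      unfolding norm_eq has_bochner_integral_integral_eq[OF f_abs] powr_eq by (simp only: mult_ac)
    finally show ?thesis .
  qed
  have sum_f: "(\<lambda>x. \<Sum>n. f n x) = (\<lambda>x. indicator {0<..} x * ((\<Sum>n. c n * sin (2 * pi * real (Suc n) * x)) * x powr (- w)))"
  proof
    fix x
    have "(\<lambda>n. (indicator {0<..} x * x powr (- w)) * (c n * sin (2 * pi * real (Suc n) * x))) sums
        ((indicator {0<..} x * x powr (- w)) * (\<Sum>n. c n * sin (2 * pi * real (Suc n) * x)))"
      by (intro sums_mult summable_sums summable_rabs_cancel[OF sm_sin])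
    moreover have "(\<lambda>n. (indicator {0<..} x * x powr (- w)) * (c n * sin (2 * pi * real (Suc n) * x))) = (\<lambda>n. f n x)"
      by (simp add: f_def mult_ac)
    ultimately show "(\<Sum>n. f n x) = indicator {0<..} x * ((\<Sum>n. c n * sin (2 * pi * real (Suc n) * x)) * x powr (- w))"
      by (simp add: sums_iff mult_ac)
  qed
  have "integrable lborel (\<lambda>x. \<Sum>n. f n x)"
    by (rule integrable_suminf[OF f_int _ sm2]) (use sm in auto)
  moreover have "(\<lambda>n. integral\<^sup>L lborel (f n)) sums (\<integral>x. (\<Sum>n. f n x) \<partial>lborel)"
    by (rule sums_integral[OF f_int _ sm2]) (use sm in auto)
  moreover have "(\<lambda>n. integral\<^sup>L lborel (f n)) sums ((S * (2 * pi) powr (w - 1)) * (\<Sum>n. c n * real (Suc n) powr (w - 1)))"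
  proof -
    have "summable (\<lambda>n. \<bar>c n * real (Suc n) powr (w - 1)\<bar>)" using c by (simp add: abs_mult)
    hence "(\<lambda>n. (S * (2 * pi) powr (w - 1)) * (c n * real (Suc n) powr (w - 1))) sums
        ((S * (2 * pi) powr (w - 1)) * (\<Sum>n. c n * real (Suc n) powr (w - 1)))"
      by (intro sums_mult summable_sums) (rule summable_rabs_cancel)
    also have "(\<lambda>n. (S * (2 * pi) powr (w - 1)) * (c n * real (Suc n) powr (w - 1))) = (\<lambda>n. integral\<^sup>L lborel (f n))"
      unfolding has_bochner_integral_integral_eq[OF f] powr_eq by (simp only: mult_ac)
    finally show ?thesis .
  qed
  ultimately have "integrable lborel (\<lambda>x. \<Sum>n. f n x)"
    "(\<integral>x. (\<Sum>n. f n x) \<partial>lborel) = (S * (2 * pi) powr (w - 1)) * (\<Sum>n. c n * real (Suc n) powr (w - 1))"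
    by (auto dest: sums_unique2)
  thus ?thesis
    unfolding sum_f S_def integral_sin_powr[OF w] by (simp add: has_bochner_integral_iff)
qed

subsection \<open>The Fourier series of the third Bernoulli polynomial\<close>

definition bern3 :: "real \<Rightarrow> real" where
  "bern3 x = x ^ 3 - 3 / 2 * x\<^sup>2 + x / 2"

definition pbern3 :: "real \<Rightarrow> real" where
  "pbern3 x = bern3 (frac x)"

text \<open>At r = 1 this is the series of interest; for r < 1 the damping factor permits two
  termwise differentiations.\<close>

definition sine3 :: "real \<Rightarrow> real \<Rightarrow> real" where
  "sine3 r \<theta> = (\<Sum>n. r ^ Suc n * sin (real (Suc n) * \<theta>) / real (Suc n) ^ 3)"

text \<open>From the polar form 1 - cis \<theta> = 2 sin(\<theta>/2) cis((\<theta> - pi)/2), whose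
  angle lies in the principal range. This imaginary part is the sawtooth, the second derivative of
  the undamped sine series.\<close>

lemma Ln_one_minus_cis:
  assumes "0 < \<theta>" "\<theta> < 2 * pi"
  shows "Im (Ln (1 - cis \<theta>)) = (\<theta> - pi) / 2"
proof -
  have s: "sin (\<theta> / 2) > 0" using assms by (intro sin_gt_zero) auto
  have "1 - cis \<theta> = of_real (2 * sin (\<theta> / 2)) * cis ((\<theta> - pi) / 2)"
  proof (rule complex_eqI)
    have c: "cos ((\<theta> - pi) / 2) = sin (\<theta> / 2)" "sin ((\<theta> - pi) / 2) = - cos (\<theta> / 2)"
      by (simp_all add: diff_divide_distrib cos_diff sin_diff)
    have "\<theta> = 2 * (\<theta> / 2)" by simp
    hence "cos \<theta> = 1 - 2 * (sin (\<theta> / 2))\<^sup>2" "sin \<theta> = 2 * sin (\<theta> / 2) * cos (\<theta> / 2)"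
      by (metis cos_double_sin, metis sin_double)
    thus "Re (1 - cis \<theta>) = Re (of_real (2 * sin (\<theta> / 2)) * cis ((\<theta> - pi) / 2))"
      "Im (1 - cis \<theta>) = Im (of_real (2 * sin (\<theta> / 2)) * cis ((\<theta> - pi) / 2))"
      by (simp_all add: c power2_eq_square)
  qed
  also have "\<dots> = exp (of_real (ln (2 * sin (\<theta> / 2))) + \<i> * of_real ((\<theta> - pi) / 2))"
    using s by (simp add: exp_add exp_of_real cis_conv_exp)
  finally have "Ln (1 - cis \<theta>) = of_real (ln (2 * sin (\<theta> / 2))) + \<i> * of_real ((\<theta> - pi) / 2)"
    using assms by (simp only: Ln_exp) (subst Ln_exp, auto)
  thus ?thesis by simp
qed

text \<open>Poisson-regularised second derivative: its limit as \<open>r\<close> tends to 1 is the sawtooth.\<close>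
lemma sine3_taylor:
  assumes r: "0 < r" "r < 1"
  shows "(sine3 r has_field_derivative (\<Sum>n. r ^ Suc n * cos (real (Suc n) * \<theta>) / real (Suc n) ^ 2)) (at \<theta>)"
    and "((\<lambda>\<theta>. \<Sum>n. r ^ Suc n * cos (real (Suc n) * \<theta>) / real (Suc n) ^ 2) has_field_derivative
      Im (Ln (1 - of_real r * cis \<theta>))) (at \<theta>)"
proof -
  have sm: "summable (\<lambda>n. r ^ Suc n)" using r by (simp add: summable_geometric summable_Suc_iff)
  have bound: "\<bar>r ^ Suc n * y / real (Suc n) ^ k\<bar> \<le> r ^ Suc n" if "\<bar>y\<bar> \<le> 1" for y :: real and n k
  proof -
    have "\<bar>r ^ Suc n * y / real (Suc n) ^ k\<bar> = r ^ Suc n * \<bar>y\<bar> / real (Suc n) ^ k"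
      using r by (simp add: abs_mult)
    also have "\<dots> \<le> r ^ Suc n * 1 / 1" using r that by (intro frac_le mult_left_mono) auto
    finally show ?thesis by simp
  qed
  have uc: "uniformly_convergent_on UNIV (\<lambda>n (x::real). \<Sum>i<n. r ^ Suc i * y i x / real (Suc i) ^ k)"
    if "\<And>i x. \<bar>y i x\<bar> \<le> 1" for y :: "nat \<Rightarrow> real \<Rightarrow> real" and k
    by (rule Weierstrass_m_test'[OF _ sm]) (use bound that in auto)
  have smm: "summable (\<lambda>n. r ^ Suc n * y n / real (Suc n) ^ k)" if "\<And>n. \<bar>y n\<bar> \<le> 1" for y :: "nat \<Rightarrow> real" and k
    by (rule summable_comparison_test'[OF sm]) (use bound that in auto)
  define s3 where "s3 = (\<lambda>n \<theta>. r ^ Suc n * sin (real (Suc n) * \<theta>) / real (Suc n) ^ 3)"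
  define c2 where "c2 = (\<lambda>n \<theta>. r ^ Suc n * cos (real (Suc n) * \<theta>) / real (Suc n) ^ 2)"
  define s1 where "s1 = (\<lambda>n \<theta>. r ^ Suc n * (- sin (real (Suc n) * \<theta>)) / real (Suc n) ^ 1)"
  have "((\<lambda>\<theta>. \<Sum>n. s3 n \<theta>) has_field_derivative (\<Sum>n. c2 n \<theta>)) (at \<theta>)"
  proof (rule has_field_derivative_series'(2)[of UNIV _ _ 0])
    show "(s3 n has_field_derivative c2 n \<theta>) (at \<theta> within UNIV)" for n \<theta>
      unfolding s3_def c2_def
      by (auto intro!: derivative_eq_intros simp: power2_eq_square power3_eq_cube simp del: of_nat_Suc)
    show "uniformly_convergent_on UNIV (\<lambda>n x. \<Sum>i<n. c2 i x)"
      unfolding c2_def by (rule uc) simp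
    show "summable (\<lambda>n. s3 n 0)" by (simp add: s3_def)
  qed auto
  thus "(sine3 r has_field_derivative (\<Sum>n. r ^ Suc n * cos (real (Suc n) * \<theta>) / real (Suc n) ^ 2)) (at \<theta>)"
    by (simp only: s3_def c2_def sine3_def [abs_def])
  have d2: "((\<lambda>\<theta>. \<Sum>n. c2 n \<theta>) has_field_derivative (\<Sum>n. s1 n \<theta>)) (at \<theta>)"
  proof (rule has_field_derivative_series'(2)[of UNIV _ _ 0])
    show "(c2 n has_field_derivative s1 n \<theta>) (at \<theta> within UNIV)" for n \<theta>
      unfolding s1_def c2_def
      by (auto intro!: derivative_eq_intros simp: power2_eq_square simp del: of_nat_Suc)
    show "uniformly_convergent_on UNIV (\<lambda>n x. \<Sum>i<n. s1 i x)"
      unfolding s1_def by (rule uc) simp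
    show "summable (\<lambda>n. c2 n 0)" unfolding c2_def by (rule smm) simp
  qed auto
  have "(\<lambda>n. - ((- (- (of_real r * cis \<theta>))) ^ n) / of_nat n) sums Ln (1 + (- (of_real r * cis \<theta>)))"
    using r by (intro Ln_series') (simp add: norm_mult)
  hence "(\<lambda>n. Im (- ((of_real r * cis \<theta>) ^ n) / of_nat n)) sums Im (Ln (1 - of_real r * cis \<theta>))"
    by (intro sums_Im) simp
  also have "(\<lambda>n. Im (- ((of_real r * cis \<theta>) ^ n) / of_nat n)) = (\<lambda>n. r ^ n * (- sin (real n * \<theta>)) / real n)"
  proof
    fix n
    have "- ((of_real r * cis \<theta>) ^ n) / of_nat n = - (of_real (r ^ n / real n) * cis (real n * \<theta>))"
      using Complex.DeMoivre[of \<theta> n] by (simp add: power_mult_distrib)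
    hence "Im (- ((of_real r * cis \<theta>) ^ n) / of_nat n) = Im (- (of_real (r ^ n / real n) * cis (real n * \<theta>)))"
      by (rule arg_cong)
    thus "Im (- ((of_real r * cis \<theta>) ^ n) / of_nat n) = r ^ n * (- sin (real n * \<theta>)) / real n"
      by (simp del: of_real_divide of_real_power)
  qed
  finally have "(\<lambda>n. r ^ Suc n * (- sin (real (Suc n) * \<theta>)) / real (Suc n)) sums Im (Ln (1 - of_real r * cis \<theta>))"
    using sums_Suc_iff[of "\<lambda>n. r ^ n * (- sin (real n * \<theta>)) / real n" "Im (Ln (1 - of_real r * cis \<theta>))"]
    by (simp del: power_Suc of_nat_Suc)
  hence "(\<Sum>n. s1 n \<theta>) = Im (Ln (1 - of_real r * cis \<theta>))"
    by (simp add: s1_def sums_iff del: power_Suc of_nat_Suc)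
  thus "((\<lambda>\<theta>. \<Sum>n. r ^ Suc n * cos (real (Suc n) * \<theta>) / real (Suc n) ^ 2) has_field_derivative
      Im (Ln (1 - of_real r * cis \<theta>))) (at \<theta>)" using d2 by (simp only: c2_def)
qed

text \<open>The majorant 1/(n + 1)^k does not depend on r, so r may tend to 1 inside the
  series.\<close>

lemma continuous_on_regularised_series:
  fixes y :: "nat \<Rightarrow> real"
  assumes "\<And>n. \<bar>y n\<bar> \<le> 1" "k \<ge> 2"
  shows "continuous_on {0..1} (\<lambda>r. \<Sum>n. r ^ Suc n * y n / real (Suc n) ^ k)"
proof (rule uniform_limit_theorem)
  have sm: "summable (\<lambda>n. 1 / real (Suc n) ^ k)"
    using inverse_power_summable[OF assms(2), where 'a = real] by (subst summable_Suc_iff) (simp add: inverse_eq_divide)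
  show "uniform_limit {0..1} (\<lambda>n r. \<Sum>i<n. r ^ Suc i * y i / real (Suc i) ^ k) (\<lambda>r. \<Sum>n. r ^ Suc n * y n / real (Suc n) ^ k) sequentially"
  proof (rule Weierstrass_m_test[OF _ sm])
    fix n and r :: real assume "r \<in> {0..1}"
    hence "\<bar>r ^ Suc n\<bar> * \<bar>y n\<bar> \<le> 1 * 1" using assms by (intro mult_mono) (auto simp: power_le_one simp del: power_Suc)
    thus "norm (r ^ Suc n * y n / real (Suc n) ^ k) \<le> 1 / real (Suc n) ^ k"
      by (simp add: abs_mult divide_right_mono del: power_Suc of_nat_Suc)
  qed
  show "\<forall>\<^sub>F n in sequentially. continuous_on {0..1} (\<lambda>r. \<Sum>i<n. r ^ Suc i * y i / real (Suc i) ^ k)"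
    by (intro always_eventually allI continuous_intros) auto
qed simp

text \<open>Taylor's formula at 0 with integral remainder gives, for r < 1, \<theta> C(r) plus the
  integral of (\<theta> - u) times the second derivative. As r tends to 1 the second derivative
  converges to the sawtooth and is bounded by pi, so dominated convergence applies; C(1) = pi^2/6 is
  Euler's sum.\<close>

lemma sine3_one:
  assumes "0 \<le> \<theta>" "\<theta> \<le> 2 * pi"
  shows "sine3 1 \<theta> = \<theta> * (pi\<^sup>2 / 6) + (\<theta> ^ 3 / 12 - pi * \<theta>\<^sup>2 / 4)"
proof -
  define r where "r = (\<lambda>k::nat. 1 - 1 / real (k + 2))"
  have r: "0 < r k" "r k < 1" for k by (auto simp: r_def field_simps)
  have r_lim: "r \<longlonglongrightarrow> 1" unfolding r_def by real_asymp
  define C where "C = (\<lambda>r. \<Sum>n. r ^ Suc n * 1 / real (Suc n) ^ 2 :: real)"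
  define f where "f = (\<lambda>k u. (\<theta> - u) * Im (Ln (1 - of_real (r k) * cis u)))"
  have f_int: "(f k has_integral (sine3 (r k) \<theta> - \<theta> * C (r k))) {0..\<theta>}" for k
  proof -
    define c where "c = (\<lambda>u. \<Sum>n. r k ^ Suc n * cos (real (Suc n) * u) / real (Suc n) ^ 2)"
    \<comment> \<open>The two occurrences of \<open>c u\<close> cancel in the derivative;
      integrating over [0, \<theta>] is Taylor's formula with remainder.\<close>
    have "((\<lambda>u. (\<theta> - u) * c u + sine3 (r k) u) has_field_derivative f k u) (at u)" for u
      unfolding f_def c_def
      by (rule derivative_eq_intros refl sine3_taylor[OF r[of k]])+ simp
    hence "(f k has_integral (((\<theta> - \<theta>) * c \<theta> + sine3 (r k) \<theta>) - ((\<theta> - 0) * c 0 + sine3 (r k) 0))) {0..\<theta>}"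
      using assms by (intro fundamental_theorem_of_calculus)
        (auto simp: has_real_derivative_iff_has_vector_derivative[symmetric] intro: DERIV_subset)
    moreover have "c 0 = C (r k)" "sine3 (r k) 0 = 0" by (simp_all add: c_def C_def sine3_def)
    ultimately show ?thesis by simp
  qed
  hence f_int': "(f k has_integral (sine3 (r k) \<theta> - \<theta> * C (r k))) {0<..<\<theta>}" for k
    by (simp add: has_integral_Icc_iff_Ioo)
  define g where "g = (\<lambda>u. (\<theta> - u) * ((u - pi) / 2))"
  have "(\<lambda>k. integral {0<..<\<theta>} (f k)) \<longlonglongrightarrow> integral {0<..<\<theta>} g"
  proof (rule dominated_convergence(2)[where h = "\<lambda>_. \<theta> * pi"])
    show "f k integrable_on {0<..<\<theta>}" for k using f_int' by (auto simp: has_integral_iff)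
    have "(\<lambda>_. \<theta> * pi) integrable_on {0..\<theta>}" by (rule integrable_const_ivl)
    thus "(\<lambda>_. \<theta> * pi) integrable_on {0<..<\<theta>}" by (simp add: integrable_on_Icc_iff_Ioo)
    fix k u assume u: "u \<in> {0<..<\<theta>}"
    have "1 - of_real (r k) * cis u \<noteq> 0"
    proof
      assume "1 - of_real (r k) * cis u = 0"
      hence "norm (of_real (r k) * cis u) = norm (1 :: complex)" by simp
      thus False using r[of k] by (simp add: norm_mult)
    qed
    hence "\<bar>Im (Ln (1 - of_real (r k) * cis u))\<bar> \<le> pi"
      using Im_Ln_le_pi mpi_less_Im_Ln by (simp add: abs_le_iff minus_le_iff less_imp_le)
    hence "\<bar>\<theta> - u\<bar> * \<bar>Im (Ln (1 - of_real (r k) * cis u))\<bar> \<le> \<theta> * pi" using u by (intro mult_mono) auto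
    thus "norm (f k u) \<le> \<theta> * pi" by (simp add: f_def abs_mult)
  next
    fix u assume u: "u \<in> {0<..<\<theta>}"
    \<comment> \<open>The limit point 1 - cis u has positive real part, so the principal logarithm
      is continuous there.\<close>
    have ne: "1 - of_real 1 * cis u \<notin> \<real>\<^sub>\<le>\<^sub>0"
    proof -
      have "Re (cis u) < 1"
      proof -
        have "sin (u / 2) > 0" using u assms by (intro sin_gt_zero) auto
        moreover have "cos u = 1 - 2 * (sin (u / 2))\<^sup>2" using cos_double_sin[of "u / 2"] by simp
        ultimately show ?thesis by simp
      qed
      thus ?thesis by (auto simp: complex_nonpos_Reals_iff)
    qed
    have "(\<lambda>k. f k u) \<longlonglongrightarrow> (\<theta> - u) * Im (Ln (1 - of_real 1 * cis u))"
      unfolding f_def by (intro tendsto_intros r_lim ne)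
    also have "Im (Ln (1 - of_real 1 * cis u)) = (u - pi) / 2"
      using Ln_one_minus_cis[of u] u assms by simp
    finally show "(\<lambda>k. f k u) \<longlonglongrightarrow> g u" by (simp add: g_def)
  qed
  also have "(\<lambda>k. integral {0<..<\<theta>} (f k)) = (\<lambda>k. sine3 (r k) \<theta> - \<theta> * C (r k))"
    using f_int' by (auto simp: has_integral_iff)
  also have "integral {0<..<\<theta>} g = \<theta> ^ 3 / 12 - pi * \<theta>\<^sup>2 / 4"
  proof -
    define G where "G = (\<lambda>u. \<theta> * u\<^sup>2 / 4 - pi * \<theta> * u / 2 - u ^ 3 / 6 + pi * u\<^sup>2 / 4)"
    have "(G has_field_derivative g u) (at u)" for u
      unfolding G_def g_def
      by (auto intro!: derivative_eq_intros simp: field_simps power2_eq_square)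
    hence "(g has_integral (G \<theta> - G 0)) {0..\<theta>}"
      using assms by (intro fundamental_theorem_of_calculus)
        (auto simp: has_real_derivative_iff_has_vector_derivative[symmetric] intro: DERIV_subset)
    hence "(g has_integral (G \<theta> - G 0)) {0<..<\<theta>}" by (simp only: has_integral_Icc_iff_Ioo)
    hence "integral {0<..<\<theta>} g = G \<theta> - G 0" by (rule integral_unique)
    thus ?thesis by (simp add: G_def field_simps power2_eq_square power3_eq_cube)
  qed
  finally have lim1: "(\<lambda>k. sine3 (r k) \<theta> - \<theta> * C (r k)) \<longlonglongrightarrow> \<theta> ^ 3 / 12 - pi * \<theta>\<^sup>2 / 4" .
  have mem: "\<forall>\<^sub>F k in sequentially. r k \<in> {0..1}" using r by (intro always_eventually) (auto intro: less_imp_le)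
  have "continuous_on {0..1} (\<lambda>r. sine3 r \<theta>)" "continuous_on {0..1} C"
    unfolding sine3_def C_def by (rule continuous_on_regularised_series; simp)+
  hence "(\<lambda>k. sine3 (r k) \<theta> - \<theta> * C (r k)) \<longlonglongrightarrow> sine3 1 \<theta> - \<theta> * C 1"
    using r_lim mem by (intro tendsto_diff tendsto_mult tendsto_const; elim continuous_on_tendsto_compose) auto
  hence "sine3 1 \<theta> - \<theta> * C 1 = \<theta> ^ 3 / 12 - pi * \<theta>\<^sup>2 / 4" using lim1 by (rule LIMSEQ_unique)
  moreover have "C 1 = pi\<^sup>2 / 6" using inverse_squares_sums by (simp add: C_def sums_iff add.commute)
  ultimately show ?thesis by simp
qed

lemma sine3_eq_pbern3: "sine3 1 (2 * pi * x) = 2 * pi ^ 3 / 3 * pbern3 x"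
proof -
  have "sin (real (Suc n) * (2 * pi * x)) = sin (real (Suc n) * (2 * pi * frac x))" for n
  proof -
    have "real (Suc n) * (2 * pi * x) = real (Suc n) * (2 * pi * frac x) + 2 * pi * of_int (int (Suc n) * \<lfloor>x\<rfloor>)"
      by (simp add: frac_def algebra_simps)
    thus ?thesis by (simp only: sin_add cos_int_2pin sin_int_2pin mult_1_right mult_zero_right add_0_right)
  qed
  hence "sine3 1 (2 * pi * x) = sine3 1 (2 * pi * frac x)" by (simp add: sine3_def)
  also have "\<dots> = 2 * pi ^ 3 / 3 * pbern3 x"
    using frac_lt_1[of x] frac_ge_0[of x]
    by (subst sine3_one) (auto simp: pbern3_def bern3_def field_simps power2_eq_square power3_eq_cube)
  finally show ?thesis .
qed

lemma abs_bern3_le: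
  assumes "0 \<le> x" "x \<le> 1"
  shows "\<bar>bern3 x\<bar> \<le> 1 / 8"
proof -
  have "bern3 x = (x * (1 - x)) * (1 / 2 - x)"
    by (simp add: bern3_def field_simps power2_eq_square power3_eq_cube)
  moreover have "x * (1 - x) \<le> 1 / 4"
    using zero_le_power2[of "x - 1 / 2"] by (simp add: power2_eq_square algebra_simps)
  moreover have nonneg: "0 \<le> x * (1 - x)" using assms by simp
  moreover have "\<bar>1 / 2 - x\<bar> \<le> 1 / 2" using assms by linarith
  ultimately have "\<bar>bern3 x\<bar> \<le> 1 / 4 * (1 / 2)"
    by (simp only: abs_mult[of "x * (1 - x)"] abs_of_nonneg[OF nonneg]) (intro mult_mono; simp)
  thus ?thesis by simp
qed

lemma abs_pbern3_le: "\<bar>pbern3 x\<bar> \<le> 1 / 8"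
  unfolding pbern3_def using frac_lt_1[of x] by (intro abs_bern3_le) (auto intro: less_imp_le)

subsection \<open>The zeta function and its functional equation\<close>

lemma integrable_tail_powr:
  fixes \<sigma> c :: real
  assumes "1 < \<sigma>" "0 < c"
  shows "has_bochner_integral lborel (\<lambda>x. indicator {c..} x * x powr (- \<sigma>)) (c powr (1 - \<sigma>) / (\<sigma> - 1))"
proof -
  have "((\<lambda>x. x powr (- \<sigma>)) has_integral (c powr (1 - \<sigma>) / (\<sigma> - 1))) {c..}"
    using has_integral_powr_to_inf[of "- \<sigma>" c] assms by (simp add: minus_divide_right)
  from nn_integral_has_integral_lebesgue[OF _ this]
  have "(\<integral>\<^sup>+x. ennreal (indicator {c..} x * x powr (- \<sigma>)) \<partial>lborel) = ennreal (c powr (1 - \<sigma>) / (\<sigma> - 1))"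
    by simp
  thus ?thesis using assms by (intro has_bochner_integral_nn_integral) auto
qed

lemma integrable_tail:
  fixes g :: "real \<Rightarrow> real"
  assumes "1 < \<sigma>" "0 < c" and [measurable]: "g \<in> borel_measurable borel" and "\<And>x. \<bar>g x\<bar> \<le> B"
  shows "integrable lborel (\<lambda>x. indicator {c..} x * g x * exp (\<sigma> * - ln x))"
proof (rule Bochner_Integration.integrable_bound)
  show "integrable lborel (\<lambda>x. B * (indicator {c..} x * x powr (- \<sigma>)))"
    using integrable_tail_powr[OF assms(1,2)] by (simp add: has_bochner_integral_iff)
  have "norm (indicator {c..} x * g x * exp (\<sigma> * - ln x)) \<le> B * (indicator {c..} x * x powr (- \<sigma>))" for x
    using assms(2) assms(4)[of x] by (auto simp: indicator_def abs_mult powr_def intro!: mult_right_mono)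
  thus "AE x in lborel. norm (indicator {c..} x * g x * exp (\<sigma> * - ln x)) \<le> norm (B * (indicator {c..} x * x powr (- \<sigma>)))"
    by (intro AE_I2) (auto intro: order_trans[OF _ abs_ge_self])
qed measurable

definition mellin_tail :: "real \<Rightarrow> (real \<Rightarrow> real) \<Rightarrow> complex \<Rightarrow> complex" where
  "mellin_tail c g s = (\<integral>x. of_real (indicator {c..} x * g x) * exp (s * of_real (- ln x)) \<partial>lborel)"

lemma holomorphic_mellin_tail:
  fixes g :: "real \<Rightarrow> real"
  assumes "0 < c" "g \<in> borel_measurable borel" "\<And>x. \<bar>g x\<bar> \<le> B"
  shows "mellin_tail c g holomorphic_on {s. Re s > 1}"
proof -
  have "mellin_tail c g field_differentiable (at s)" if s: "Re s > 1" for s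
  proof -
    define a b where "a = (1 + Re s) / 2" and "b = Re s + 1"
    have ab: "1 < a" "a < Re s" "Re s < b" using s by (auto simp: a_def b_def)
    interpret exp_integrals lborel "\<lambda>x. indicator {c..} x * g x" "\<lambda>x. - ln x" a b
    proof
      show "integrable lborel (\<lambda>x. indicator {c..} x * g x * exp (a * - ln x))"
        "integrable lborel (\<lambda>x. indicator {c..} x * g x * exp (b * - ln x))"
        using assms ab by (intro integrable_tail[where B = B]; simp)+
    qed (use assms in measurable)
    have "F = mellin_tail c g" by (simp add: fun_eq_iff F_def mellin_tail_def)
    thus ?thesis
      using holomorphic ab open_Int[OF open_halfspace_Re_gt[of a] open_halfspace_Re_lt[of b]]
      by (intro holomorphic_on_imp_differentiable_at[of _ "{s. a < Re s \<and> Re s < b}"]) (auto simp: Collect_conj_eq)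
  qed
  thus ?thesis by (auto simp: holomorphic_on_def intro: field_differentiable_at_within)
qed

lemma mellin_tail_of_real:
  assumes "0 < c"
  shows "mellin_tail c g (of_real \<sigma>) = of_real (\<integral>x. indicator {c..} x * (g x * x powr (- \<sigma>)) \<partial>lborel)"
proof -
  have "of_real (indicator {c..} x * g x) * exp (of_real \<sigma> * of_real (- ln x)) =
      complex_of_real (indicator {c..} x * (g x * x powr (- \<sigma>)))" for x
    using assms by (auto simp: indicator_def powr_def exp_of_real[symmetric])
  thus ?thesis by (simp only: mellin_tail_def integral_complex_of_real)
qed

section \<open>The Euler-Maclaurin formula for zeta\<close>

lemma measurable_pbern3 [measurable]: "pbern3 \<in> borel_measurable borel"
  unfolding pbern3_def [abs_def] bern3_def frac_def by measurable

text \<open>The right end point is allowed because \<open>bern3\<close> vanishes at both 0 and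
  1.\<close>

lemma pbern3_eq:
  assumes "real n \<le> x" "x \<le> real (n + 1)"
  shows "pbern3 x = bern3 (x - real n)"
proof (cases "x = real (n + 1)")
  case True
  hence "frac x = 0" by (simp only: frac_eq_0_iff Ints_of_nat)
  hence "pbern3 x = bern3 0" by (simp only: pbern3_def)
  moreover have "bern3 (x - real n) = bern3 1" using True by simp
  ultimately show ?thesis by (simp add: bern3_def)
next
  case False
  hence "\<lfloor>x\<rfloor> = int n" using assms by (intro floor_unique) auto
  thus ?thesis by (simp add: pbern3_def frac_def)
qed

text \<open>Euler-Maclaurin summation on a single interval: the two brackets telescope in n, and the
  last term is one summand of the zeta series.\<close>

lemma integral_pbern3_interval:
  fixes s :: real
  assumes s: "s > 1" and n: "n \<ge> 1"
  shows "s * (s + 1) * (s + 2) / 6 * (\<integral>x. pbern3 x * x powr (- (s + 3)) * indicator {real n..<real (n + 1)} x \<partial>lborel) =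
    (s / 12 * real n powr (- (s + 1)) + real n powr (1 - s) / (s - 1) - real n powr (- s) / 2)
    - (s / 12 * real (n + 1) powr (- (s + 1)) + real (n + 1) powr (1 - s) / (s - 1) - real (n + 1) powr (- s) / 2)
    - real (n + 1) powr (- s)"
proof -
  define K where "K = s * (s + 1) * (s + 2) / 6"
  \<comment> \<open>an antiderivative of \<open>f\<close> below, from repeated integration by parts\<close>
  define D where "D = (\<lambda>x. - (s * (s + 1) / 6 * bern3 (x - real n) * x powr (- s - 2)
     + s / 2 * ((x - real n)\<^sup>2 - (x - real n) + 1 / 6) * x powr (- s - 1)
     + (x - real n - 1 / 2) * x powr (- s) + x powr (1 - s) / (s - 1)))"
  define f where "f = (\<lambda>x. K * (bern3 (x - real n) * x powr (- s - 3)))"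
  have der: "(D has_field_derivative f x) (at x)" if x: "x > 0" for x
  proof -
    define y where "y = x - real n"
    have b: "((\<lambda>x. bern3 (x - real n)) has_field_derivative (3 * y\<^sup>2 - 3 * y + 1 / 2)) (at x)"
      unfolding bern3_def y_def by (auto intro!: derivative_eq_intros simp: algebra_simps power2_eq_square)
    have q: "((\<lambda>x. (x - real n)\<^sup>2 - (x - real n) + 1 / 6) has_field_derivative (2 * y - 1)) (at x)"
      unfolding y_def by (auto intro!: derivative_eq_intros)
    have l: "((\<lambda>x. x - real n - 1 / 2) has_field_derivative 1) (at x)"
      by (auto intro!: derivative_eq_intros)
    have pw: "((\<lambda>x. x powr p) has_field_derivative p * x powr (p - 1)) (at x)" for p
      using x by (rule has_real_derivative_powr)
    have "(D has_field_derivative - (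
        (s * (s + 1) / 6 * (3 * y\<^sup>2 - 3 * y + 1 / 2)) * x powr (- s - 2)
          + ((- s - 2) * x powr (- s - 2 - 1)) * (s * (s + 1) / 6 * bern3 (x - real n))
        + ((s / 2 * (2 * y - 1)) * x powr (- s - 1)
          + ((- s - 1) * x powr (- s - 1 - 1)) * (s / 2 * ((x - real n)\<^sup>2 - (x - real n) + 1 / 6)))
        + (1 * x powr (- s) + (- s * x powr (- s - 1)) * (x - real n - 1 / 2))
        + ((1 - s) * x powr (1 - s - 1)) / (s - 1))) (at x)"
      unfolding D_def by (intro DERIV_minus DERIV_add DERIV_mult DERIV_cmult DERIV_cdivide b q l pw)
    also have "((1 - s) * x powr (1 - s - 1)) / (s - 1) = - (x powr (- s))" using s by (simp add: field_simps)
    also have "- s - 2 - 1 = - s - 3" by simp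
    also have "- s - 1 - 1 = - s - 2" by simp
    also have "- ((s * (s + 1) / 6 * (3 * y\<^sup>2 - 3 * y + 1 / 2)) * x powr (- s - 2)
          + ((- s - 2) * x powr (- s - 3)) * (s * (s + 1) / 6 * bern3 (x - real n))
        + ((s / 2 * (2 * y - 1)) * x powr (- s - 1)
          + ((- s - 1) * x powr (- s - 2)) * (s / 2 * ((x - real n)\<^sup>2 - (x - real n) + 1 / 6)))
        + (1 * x powr (- s) + (- s * x powr (- s - 1)) * (x - real n - 1 / 2))
        + (- (x powr (- s)))) = f x"
      unfolding f_def K_def y_def[symmetric] by (simp add: field_simps power2_eq_square)
    finally show ?thesis .
  qed
  have cont: "isCont f x" if "x > 0" for x
    unfolding f_def bern3_def using that by (intro continuous_intros) auto
  have hb: "has_bochner_integral lborel (\<lambda>x. f x * indicator {real n..real (n + 1)} x) (D (real (n + 1)) - D (real n))"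
    using n by (intro has_bochner_integral_FTC_Icc_real der cont) auto
  have "(\<lambda>x. f x * indicator {real n..real (n + 1)} x) = (\<lambda>x. K * (pbern3 x * x powr (- (s + 3)) * indicator {real n..<real (n + 1)} x))"
  proof
    fix x
    show "f x * indicator {real n..real (n + 1)} x = K * (pbern3 x * x powr (- (s + 3)) * indicator {real n..<real (n + 1)} x)"
    proof (cases "x = real (n + 1)")
      case True
      thus ?thesis by (simp add: f_def bern3_def)
    next
      case False
      thus ?thesis using pbern3_eq[of n x] by (auto simp: f_def indicator_def)
    qed
  qed
  hence "K * (\<integral>x. pbern3 x * x powr (- (s + 3)) * indicator {real n..<real (n + 1)} x \<partial>lborel) = D (real (n + 1)) - D (real n)"
    using hb by (simp add: has_bochner_integral_iff)
  also have "\<dots> = (s / 12 * real n powr (- (s + 1)) + real n powr (1 - s) / (s - 1) - real n powr (- s) / 2)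
    - (s / 12 * real (n + 1) powr (- (s + 1)) + real (n + 1) powr (1 - s) / (s - 1) - real (n + 1) powr (- s) / 2)
    - real (n + 1) powr (- s)"
  proof -
    have e: "- s - 1 = - (s + 1)" by simp
    have n1: "real (n + 1) - real n = 1" by simp
    have "D (real (n + 1)) = - (s / 12 * real (n + 1) powr (- (s + 1)) + real (n + 1) powr (- s) / 2 + real (n + 1) powr (1 - s) / (s - 1))"
      unfolding D_def n1 e by (simp add: bern3_def del: of_nat_add of_nat_Suc minus_add_distrib)
    moreover have "D (real n) = - (s / 12 * real n powr (- (s + 1)) - real n powr (- s) / 2 + real n powr (1 - s) / (s - 1))"
      unfolding D_def e by (simp add: bern3_def del: minus_add_distrib)
    ultimately show ?thesis by simp
  qed
  finally show ?thesis by (simp only: K_def)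
qed

lemma zeta_euler_maclaurin_real:
  fixes s :: real
  assumes s: "s > 1"
  shows "(\<lambda>n. real (Suc n) powr (- s)) sums
    (1 / (s - 1) + 1 / 2 + s / 12 - s * (s + 1) * (s + 2) / 6 * (\<integral>x. indicator {1..} x * (pbern3 x * x powr (- (s + 3))) \<partial>lborel))"
proof -
  define K where "K = s * (s + 1) * (s + 2) / 6"
  define f where "f = (\<lambda>x. pbern3 x * x powr (- (s + 3)))"
  define E where "E = (\<lambda>n. s / 12 * real n powr (- (s + 1)) + real n powr (1 - s) / (s - 1) - real n powr (- s) / 2)"
  have f_int: "integrable lborel (\<lambda>x. indicator {1..} x * f x)"
  proof -
    have "integrable lborel (\<lambda>x. indicator {1..} x * pbern3 x * exp ((s + 3) * - ln x))"
      using s by (intro integrable_tail[where B = "1 / 8"] abs_pbern3_le) auto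
    also have "(\<lambda>x. indicator {1..} x * pbern3 x * exp ((s + 3) * - ln x)) = (\<lambda>x. indicator {1..} x * f x)"
      by (auto simp: fun_eq_iff f_def powr_def indicator_def algebra_simps)
    finally show ?thesis .
  qed
  have [measurable]: "f \<in> borel_measurable borel" unfolding f_def by measurable
  have lim: "(\<lambda>N. \<integral>x. f x * indicator {1..<real (N + 1)} x \<partial>lborel) \<longlonglongrightarrow> (\<integral>x. indicator {1..} x * f x \<partial>lborel)"
  proof (rule integral_dominated_convergence[where w = "\<lambda>x. \<bar>indicator {1..} x * f x\<bar>"])
    show "AE x in lborel. (\<lambda>N. f x * indicator {1..<real (N + 1)} x) \<longlonglongrightarrow> indicator {1..} x * f x"
    proof (intro AE_I2)
      fix x :: real
      have "eventually (\<lambda>N. real N \<ge> x) sequentially" by real_asymp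
      hence "eventually (\<lambda>N. f x * indicator {1..<real (N + 1)} x = indicator {1..} x * f x) sequentially"
        by eventually_elim (auto simp: indicator_def)
      thus "(\<lambda>N. f x * indicator {1..<real (N + 1)} x) \<longlonglongrightarrow> indicator {1..} x * f x"
        by (rule tendsto_eventually)
    qed
  qed (use f_int in \<open>auto simp: indicator_def\<close>)
  have step: "integrable lborel (\<lambda>x. f x * indicator {a..<b} x)" if "1 \<le> a" for a b
    using that by (intro Bochner_Integration.integrable_bound[OF f_int] AE_I2) (auto simp: indicator_def)
  have part: "K * (\<integral>x. f x * indicator {1..<real (N + 1)} x \<partial>lborel) = E 1 - E (N + 1) - (\<Sum>n<N. real (n + 2) powr (- s))" for N
  proof (induction N)
    case (Suc N)
    have "(\<lambda>x. f x * indicator {1..<real (Suc N + 1)} x) =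
        (\<lambda>x. f x * indicator {1..<real (N + 1)} x + f x * indicator {real (N + 1)..<real (N + 1 + 1)} x)"
      by (auto simp: fun_eq_iff indicator_def)
    hence "K * (\<integral>x. f x * indicator {1..<real (Suc N + 1)} x \<partial>lborel) =
       K * (\<integral>x. f x * indicator {1..<real (N + 1)} x \<partial>lborel) + K * (\<integral>x. f x * indicator {real (N + 1)..<real (N + 1 + 1)} x \<partial>lborel)"
      using step by (simp add: distrib_left del: of_nat_Suc of_nat_add)
    also have "K * (\<integral>x. f x * indicator {real (N + 1)..<real (N + 1 + 1)} x \<partial>lborel) = E (N + 1) - E (N + 1 + 1) - real (N + 1 + 1) powr (- s)"
      unfolding K_def f_def E_def by (rule integral_pbern3_interval[OF s]) simp
    finally show ?case unfolding Suc.IH by (simp add: algebra_simps)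
  qed simp
  have E_lim: "(\<lambda>N. E (N + 1)) \<longlonglongrightarrow> 0"
  proof -
    have "(\<lambda>N. s / 12 * real (N + 1) powr (- (s + 1)) + real (N + 1) powr (1 - s) / (s - 1) - real (N + 1) powr (- s) / 2) \<longlonglongrightarrow> s / 12 * 0 + 0 / (s - 1) - 0 / 2"
      using s by (intro tendsto_intros tendsto_neg_powr filterlim_compose[OF filterlim_real_sequentially filterlim_add_const_nat_at_top]) auto
    thus ?thesis by (simp add: E_def)
  qed
  have "(\<lambda>N. E 1 - E (N + 1) - K * (\<integral>x. f x * indicator {1..<real (N + 1)} x \<partial>lborel)) \<longlonglongrightarrow>
      E 1 - 0 - K * (\<integral>x. indicator {1..} x * f x \<partial>lborel)"
    by (intro tendsto_intros E_lim lim)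
  hence "(\<lambda>n. real (n + 2) powr (- s)) sums (E 1 - K * (\<integral>x. indicator {1..} x * f x \<partial>lborel))"
    unfolding part sums_def by simp
  hence "(\<lambda>n. real (Suc (Suc n)) powr (- s)) sums (E 1 - K * (\<integral>x. indicator {1..} x * f x \<partial>lborel))" by simp
  \<comment> \<open>The first term of the zeta series, equal to 1, turns the -1/2 in
    \<open>E 1\<close> into +1/2.\<close>
  from sums_Suc[OF this]
  show ?thesis by (simp add: E_def K_def f_def algebra_simps)
qed

lemma zeta_of_real:
  assumes "s > 1" "(\<lambda>n. real (Suc n) powr (- s)) sums S"
  shows "zeta (of_real s) = of_real S"
proof -
  have "zeta (of_real s) = (\<Sum>n. 1 / of_nat (Suc n) powr (of_real s))"
    using is_zeta_continuation_zeta assms(1) unfolding is_zeta_continuation_def by auto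
  also have "(\<lambda>n. 1 / of_nat (Suc n) powr (complex_of_real s)) = (\<lambda>n. complex_of_real (real (Suc n) powr (- s)))"
  proof
    fix n
    have "complex_of_real (real (Suc n) powr (- s)) = complex_of_real (real (Suc n)) powr of_real (- s)"
      by (rule powr_of_real[symmetric]) simp
    thus "1 / of_nat (Suc n) powr (complex_of_real s) = complex_of_real (real (Suc n) powr (- s))"
      by (simp add: powr_minus inverse_eq_divide)
  qed
  also have "(\<Sum>n. complex_of_real (real (Suc n) powr (- s))) = of_real S"
    using sums_of_real[OF assms(2)] by (rule sums_unique[symmetric])
  finally show ?thesis .
qed

text \<open>The function $(s-1)\zeta(s)$, written by the third-order Euler-Maclaurin formula.\<close>
definition zeta_regularized :: "complex \<Rightarrow> complex" where
  "zeta_regularized s = 1 + (s - 1) * (1 / 2 + s / 12 - s * (s + 1) * (s + 2) / 6 * mellin_tail 1 pbern3 (s + 3))"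

lemma holomorphic_zeta_regularized: "zeta_regularized holomorphic_on {s. Re s > -2}"
proof -
  have "(mellin_tail 1 pbern3 \<circ> (\<lambda>s. s + 3)) holomorphic_on {s. Re s > -2}"
    by (rule holomorphic_on_compose_gen[OF _ holomorphic_mellin_tail[OF zero_less_one measurable_pbern3 abs_pbern3_le]])
       (auto intro!: holomorphic_intros)
  hence "(\<lambda>s. mellin_tail 1 pbern3 (s + 3)) holomorphic_on {s. Re s > -2}" by (simp add: o_def)
  thus ?thesis unfolding zeta_regularized_def [abs_def] by (intro holomorphic_intros) auto
qed

lemma holomorphic_zeta: "1 \<notin> S \<Longrightarrow> zeta holomorphic_on S"
  using is_zeta_continuation_zeta holomorphic_on_subset[of zeta "- {1}" S]
  unfolding is_zeta_continuation_def by auto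

lemma islimpt_of_real_interval:
  fixes a b c :: real
  assumes "a < c" "c < b"
  shows "complex_of_real c islimpt (complex_of_real ` {a<..<b})"
proof -
  have "c islimpt {a<..<b}" using assms by (intro interior_limit_point) (auto simp: interior_open)
  thus ?thesis
    unfolding islimpt_approachable by (simp add: dist_of_real)
qed

text \<open>In the applications \<open>U\<close> is a real interval on which the identity was
  computed, embedded in the complex plane.\<close>

lemma identity_theorem:
  assumes "f holomorphic_on S" "g holomorphic_on S" "open S" "connected S"
    and "U \<subseteq> S" "\<xi> \<in> S" "\<xi> islimpt U" "\<And>z. z \<in> U \<Longrightarrow> f z = g z" "w \<in> S"
  shows "f w = g w"
proof -
  have "(\<lambda>z. f z - g z) holomorphic_on S" by (intro holomorphic_intros assms)
  from analytic_continuation[OF this assms(3-7) _ assms(9)] assms(8) show ?thesis by simp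
qed

lemma zeta_regularized_eq:
  assumes "Re s > -2" "s \<noteq> 1"
  shows "zeta_regularized s = (s - 1) * zeta s"
proof (rule identity_theorem[where f = zeta_regularized and g = "\<lambda>s. (s - 1) * zeta s" and S = "{s. Re s > -2} - {1}"
      and U = "complex_of_real ` {1<..<3}" and \<xi> = "of_real 2"])
  show "zeta_regularized holomorphic_on {s. Re s > -2} - {1}"
    by (rule holomorphic_on_subset[OF holomorphic_zeta_regularized]) auto
  show "(\<lambda>s. (s - 1) * zeta s) holomorphic_on {s. Re s > -2} - {1}"
    by (intro holomorphic_intros holomorphic_zeta) auto
  show "open ({s. Re s > -2} - {1 :: complex})" by (intro open_delete open_halfspace_Re_gt)
  show "connected ({s. Re s > -2} - {1 :: complex})"
    by (intro connected_open_delete open_halfspace_Re_gt convex_connected convex_halfspace_Re_gt) auto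
  show "complex_of_real 2 islimpt complex_of_real ` {1<..<3}" by (rule islimpt_of_real_interval) auto
  fix z assume "z \<in> complex_of_real ` {1<..<3}"
  then obtain t where t: "z = of_real t" "1 < t" "t < 3" by auto
  have "mellin_tail 1 pbern3 (z + 3) = of_real (\<integral>x. indicator {1..} x * (pbern3 x * x powr (- (t + 3))) \<partial>lborel)"
    using mellin_tail_of_real[of 1 pbern3 "t + 3"] t by simp
  moreover have "zeta z = of_real (1 / (t - 1) + 1 / 2 + t / 12 - t * (t + 1) * (t + 2) / 6 * (\<integral>x. indicator {1..} x * (pbern3 x * x powr (- (t + 3))) \<partial>lborel))"
    unfolding t(1) by (rule zeta_of_real[OF t(2) zeta_euler_maclaurin_real[OF t(2)]])
  moreover have "1 + (z - 1) * (1 / 2 + z / 12 - K * J) = (z - 1) * (1 / (z - 1) + 1 / 2 + z / 12 - K * J)" for K J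
  proof -
    have "z - 1 \<noteq> 0" using t by auto
    hence "(z - 1) * (1 / (z - 1)) = 1" by simp
    moreover have "X + A + B - C = X + (A + B - C)" for X A B C :: complex by simp
    ultimately show ?thesis by (simp only: distrib_left)
  qed
  ultimately show "zeta_regularized z = (z - 1) * zeta z"
    by (simp only: zeta_regularized_def t(1) of_real_add of_real_diff of_real_mult of_real_divide of_real_1 of_real_numeral)
qed (use assms in auto)

lemma zeta_real_formula:
  fixes s :: real
  assumes "s > -2" "s \<noteq> 1"
  shows "zeta (of_real s) = of_real (1 / (s - 1) + 1 / 2 + s / 12 - s * (s + 1) * (s + 2) / 6 * (\<integral>x. indicator {1..} x * (pbern3 x * x powr (- (s + 3))) \<partial>lborel))"
proof -
  have "(of_real s - 1) * zeta (of_real s) = zeta_regularized (of_real s)"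
    using zeta_regularized_eq[of "of_real s"] assms by simp
  moreover have "mellin_tail 1 pbern3 (of_real s + 3) = of_real (\<integral>x. indicator {1..} x * (pbern3 x * x powr (- (s + 3))) \<partial>lborel)"
    using mellin_tail_of_real[of 1 pbern3 "s + 3"] by simp
  moreover have "of_real s - (1 :: complex) \<noteq> 0" using assms by auto
  ultimately have "zeta (of_real s) = (1 + (of_real s - 1) * of_real (1 / 2 + s / 12 - s * (s + 1) * (s + 2) / 6 *
      (\<integral>x. indicator {1..} x * (pbern3 x * x powr (- (s + 3))) \<partial>lborel))) / (of_real s - 1)"
    by (subst nonzero_eq_divide_eq) (simp_all add: zeta_regularized_def mult.commute)
  also have "\<dots> = of_real ((1 + (s - 1) * (1 / 2 + s / 12 - s * (s + 1) * (s + 2) / 6 *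
      (\<integral>x. indicator {1..} x * (pbern3 x * x powr (- (s + 3))) \<partial>lborel))) / (s - 1))"
    by (simp only: of_real_1 of_real_add of_real_mult of_real_diff of_real_divide)
  also have "(1 + (s - 1) * R) / (s - 1) = 1 / (s - 1) + R" for R
  proof -
    have "s - 1 \<noteq> 0" using assms by simp
    thus ?thesis by (simp add: add_divide_distrib)
  qed
  also have "X + (A + B - C) = X + A + B - C" for X A B C :: real by simp
  finally show ?thesis .
qed

text \<open>At s = 0 the integral has coefficient 0 and -1 + 1/2 remains. This separates s = 0 from
  the trivial zeros.\<close>

lemma zeta_zero_nonzero: "zeta 0 \<noteq> 0"
proof -
  obtain J :: real where "zeta (of_real 0) = of_real (1 / (0 - 1) + 1 / 2 + 0 / 12 - 0 * (0 + 1) * (0 + 2) / 6 * J)"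
    using zeta_real_formula[of 0, OF _ zero_neq_one] by (simp only: neg_less_0_iff_less zero_less_numeral)
  also have "1 / (0 - 1) + 1 / 2 + 0 / 12 - 0 * (0 + 1) * (0 + 2) / 6 * J = - 1 / 2" by simp
  finally have "zeta 0 = of_real (- 1 / 2)" by simp
  thus ?thesis by simp
qed

lemma zeta_regularized_one: "zeta_regularized 1 = 1"
  by (simp only: zeta_regularized_def diff_self mult_zero_left add_0_right)

text \<open>The polar term 1/(s - 1) is at most -1. The bound 1/8 for the periodic polynomial makes
  the integral term at most 1/24, and 1/2 + 1/12 + 1/24 < 1, so zeta is negative.\<close>

lemma zeta_real_nonzero:
  fixes s :: real
  assumes "0 < s" "s < 1"
  shows "zeta (of_real s) \<noteq> 0"
proof -
  define I where "I = (\<integral>x. indicator {1..} x * (pbern3 x * x powr (- (s + 3))) \<partial>lborel)"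
  have hb: "has_bochner_integral lborel (\<lambda>x. indicator {1..} x * x powr (- (s + 3))) (1 / (s + 2))"
  proof -
    have "s + 3 - 1 = s + 2" by linarith
    moreover have "1 < s + 3" using assms by linarith
    ultimately show ?thesis
      using integrable_tail_powr[OF _ zero_less_one, of "s + 3"] by (simp only: powr_one_eq_one)
  qed
  have "\<bar>I\<bar> \<le> (\<integral>x. 1 / 8 * (indicator {1..} x * x powr (- (s + 3))) \<partial>lborel)"
    unfolding I_def
  proof (rule integral_abs_bound_integral)
    show "integrable lborel (\<lambda>x. 1 / 8 * (indicator {1..} x * x powr (- (s + 3))))"
      using hb by (simp add: has_bochner_integral_iff)
    show bd: "\<bar>indicator {1..} x * (pbern3 x * x powr (- (s + 3)))\<bar> \<le> 1 / 8 * (indicator {1..} x * x powr (- (s + 3)))" for x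
    proof -
      have "\<bar>pbern3 x\<bar> * (indicator {1..} x * x powr (- (s + 3))) \<le> 1 / 8 * (indicator {1..} x * x powr (- (s + 3)))"
        by (intro mult_right_mono abs_pbern3_le) auto
      thus ?thesis by (simp add: abs_mult mult_ac)
    qed
    show "integrable lborel (\<lambda>x. indicator {1..} x * (pbern3 x * x powr (- (s + 3))))"
    proof (rule Bochner_Integration.integrable_bound)
      show "integrable lborel (\<lambda>x. 1 / 8 * (indicator {1..} x * x powr (- (s + 3))))"
        using hb by (simp add: has_bochner_integral_iff)
      show "AE x in lborel. norm (indicator {1..} x * (pbern3 x * x powr (- (s + 3))))
          \<le> norm (1 / 8 * (indicator {1..} x * x powr (- (s + 3))))"
        using bd by (intro AE_I2) (metis abs_ge_self order_trans real_norm_def)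
    qed measurable
  qed
  also have "\<dots> = 1 / (8 * (s + 2))" using hb by (simp add: has_bochner_integral_iff)
  finally have I: "\<bar>I\<bar> \<le> 1 / (8 * (s + 2))" .
  have "\<bar>s * (s + 1) * (s + 2) / 6 * I\<bar> = s * (s + 1) * (s + 2) / 6 * \<bar>I\<bar>"
    using assms by (simp add: abs_mult)
  also have "\<dots> \<le> s * (s + 1) * (s + 2) / 6 * (1 / (8 * (s + 2)))" using assms I by (intro mult_left_mono) auto
  also have "\<dots> = s * (s + 1) / 48" using assms by (simp add: field_simps)
  also have "\<dots> \<le> 1 * 2 / 48" using assms by (intro divide_right_mono mult_mono) auto
  finally have "\<bar>s * (s + 1) * (s + 2) / 6 * I\<bar> \<le> 1 / 24" by simp
  moreover have "1 / (s - 1) \<le> -1" using assms by (simp add: field_simps)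
  ultimately have "1 / (s - 1) + 1 / 2 + s / 12 - s * (s + 1) * (s + 2) / 6 * I < 0"
    using assms by linarith
  moreover have "zeta (of_real s) = of_real (1 / (s - 1) + 1 / 2 + s / 12 - s * (s + 1) * (s + 2) / 6 * I)"
    unfolding I_def by (rule zeta_real_formula) (use assms in auto)
  ultimately show ?thesis by (metis less_irrefl of_real_eq_0_iff)
qed

section \<open>The functional equation\<close>

lemma has_bochner_integral_powr_from_0:
  fixes a :: real
  assumes "a > -1"
  shows "has_bochner_integral lborel (\<lambda>x. indicator {0<..<1} x * x powr a) (1 / (a + 1))"
proof -
  have "((\<lambda>x. x powr a) has_integral (1 / (a + 1))) {0<..<1}"
    using has_integral_powr_from_0[of a 1] assms by (simp add: has_integral_Icc_iff_Ioo)
  from nn_integral_has_integral_lebesgue[OF _ this]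
  have "(\<integral>\<^sup>+x. ennreal (indicator {0<..<1} x * x powr a) \<partial>lborel) = ennreal (1 / (a + 1))"
    by simp
  thus ?thesis using assms by (intro has_bochner_integral_nn_integral) auto
qed

text \<open>On (0, 1) the integrand is a combination of three powers. The linear term x/2 of the
  polynomial is the critical one near 0 and requires s < -1.\<close>

lemma integral_pbern3_head:
  fixes s :: real
  assumes "s < -1"
  shows "has_bochner_integral lborel (\<lambda>x. indicator {0<..<1} x * (pbern3 x * x powr (- (s + 3))))
    (1 / (1 - s) + 3 / (2 * s) - 1 / (2 * (s + 1)))"
proof -
  have "has_bochner_integral lborel (\<lambda>x. indicator {0<..<1} x * x powr (- s)
      + (- 3 / 2) * (indicator {0<..<1} x * x powr (- s - 1)) + 1 / 2 * (indicator {0<..<1} x * x powr (- s - 2)))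
    (1 / (- s + 1) + (- 3 / 2) * (1 / (- s - 1 + 1)) + 1 / 2 * (1 / (- s - 2 + 1)))"
    using assms
    by (intro has_bochner_integral_add has_bochner_integral_mult_right has_bochner_integral_powr_from_0) auto
  also have "(\<lambda>x. indicator {0<..<1} x * x powr (- s)
      + (- 3 / 2) * (indicator {0<..<1} x * x powr (- s - 1)) + 1 / 2 * (indicator {0<..<1} x * x powr (- s - 2)))
    = (\<lambda>x. indicator {0<..<1} x * (pbern3 x * x powr (- (s + 3))))"
  proof
    fix x :: real
    show "indicator {0<..<1} x * x powr (- s)
      + (- 3 / 2) * (indicator {0<..<1} x * x powr (- s - 1)) + 1 / 2 * (indicator {0<..<1} x * x powr (- s - 2))
      = indicator {0<..<1} x * (pbern3 x * x powr (- (s + 3)))"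
    proof (cases "x \<in> {0<..<1}")
      case True
      define P where "P = x powr (- (s + 3))"
      have "- s = 3 + - (s + 3)" "- s - 1 = 2 + - (s + 3)" "- s - 2 = 1 + - (s + 3)" by linarith+
      hence "x powr (- s) = x powr (3 + - (s + 3))" "x powr (- s - 1) = x powr (2 + - (s + 3))"
        "x powr (- s - 2) = x powr (1 + - (s + 3))" by metis+
      hence "x powr (- s) = x ^ 3 * P" "x powr (- s - 1) = x\<^sup>2 * P" "x powr (- s - 2) = x * P"
        using True by (simp_all only: powr_add P_def) (simp_all add: powr_numeral)
      moreover have pb: "pbern3 x = x ^ 3 - 3 / 2 * x\<^sup>2 + x / 2"
        using pbern3_eq[of 0 x] True by (simp add: bern3_def)
      ultimately show ?thesis using True unfolding P_def[symmetric] pb by (simp add: algebra_simps)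
    qed simp
  qed
  also have "1 / (- s + 1) + (- 3 / 2) * (1 / (- s - 1 + 1)) + 1 / 2 * (1 / (- s - 2 + 1))
      = 1 / (1 - s) + 3 / (2 * s) - 1 / (2 * (s + 1))"
  proof -
    have "- s - 1 + 1 = - s" "- s - 2 + 1 = - (s + 1)" "- s + 1 = 1 - s" by simp_all
    thus ?thesis by (simp only: divide_minus_right mult_minus_right mult_minus_left) simp
  qed
  finally show ?thesis .
qed

text \<open>For t < -1 the elementary terms of the Euler-Maclaurin formula are exactly the missing
  integral over (0, 1). Thus zeta is a multiple of one integral over (0, \<infinity>), which the
  sine series evaluates at w = t + 3.\<close>

lemma zeta_reflection_integral:
  fixes t :: real
  assumes t: "-2 < t" "t < -1"
  shows "zeta (of_real t) = of_real (- (t * (t + 1) * (t + 2) / 6) *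
    (Gamma ((t + 3) / 2) * Gamma (1 - (t + 3) / 2) / (2 * Gamma (t + 3)) * (2 * pi) powr (t + 2) *
     (3 / (2 * pi ^ 3) * (\<Sum>n. real (Suc n) powr (- (1 - t))))))"
proof -
  define w where "w = t + 3"
  \<comment> \<open>The Fourier coefficients of the periodic polynomial, from inverting the factor 2
    pi^3 / 3 in \<open>sine3_eq_pbern3\<close>.\<close>
  define c where "c = (\<lambda>n. 3 / (2 * pi ^ 3) / real (Suc n) ^ 3)"
  define Hd where "Hd = (\<integral>x. indicator {0<..<1} x * (pbern3 x * x powr (- (t + 3))) \<partial>lborel)"
  define Tl where "Tl = (\<integral>x. indicator {1..} x * (pbern3 x * x powr (- (t + 3))) \<partial>lborel)"
  have w: "1 < w" "w < 2" using t by (auto simp: w_def)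
  have c0: "c n \<ge> 0" for n by (simp add: c_def)
  have c_powr: "c n * real (Suc n) powr (w - 1) = 3 / (2 * pi ^ 3) * real (Suc n) powr (- (1 - t))" for n
  proof -
    have "real (Suc n) powr (w - 1) = real (Suc n) powr (- (1 - t) + 3)" by (simp add: w_def)
    also have "\<dots> = real (Suc n) powr (- (1 - t)) * real (Suc n) powr 3" by (rule powr_add)
    also have "real (Suc n) powr 3 = real (Suc n) ^ 3" by (simp add: powr_numeral)
    finally show ?thesis by (simp add: c_def del: of_nat_Suc)
  qed
  have sm_t: "summable (\<lambda>n. real (Suc n) powr (- (1 - t)))"
    using t by (subst summable_Suc_iff) (simp add: summable_real_powr_iff)
  have "summable (\<lambda>n. 1 / real (Suc n) ^ 3)"
    using inverse_power_summable[of 3, where 'a = real] by (subst summable_Suc_iff) (simp add: inverse_eq_divide)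
  hence "summable (\<lambda>n. 3 / (2 * pi ^ 3) * (1 / real (Suc n) ^ 3))" by (rule summable_mult)
  hence sm_c: "summable (\<lambda>n. \<bar>c n\<bar>)" using c0 by (simp add: c_def)
  have "summable (\<lambda>n. 3 / (2 * pi ^ 3) * real (Suc n) powr (- (1 - t)))" by (intro summable_mult sm_t)
  hence sm_cw: "summable (\<lambda>n. \<bar>c n\<bar> * real (Suc n) powr (w - 1))" using c0 by (simp only: abs_of_nonneg c_powr)
  have series: "(\<Sum>n. c n * sin (2 * pi * real (Suc n) * x)) = pbern3 x" for x
  proof -
    have "summable (\<lambda>n. \<bar>1 ^ Suc n * sin (real (Suc n) * (2 * pi * x)) / real (Suc n) ^ 3\<bar>)"
      by (rule summable_comparison_test'[OF \<open>summable (\<lambda>n. 1 / real (Suc n) ^ 3)\<close>])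
         (simp add: abs_mult divide_right_mono del: of_nat_Suc)
    hence "(\<lambda>n. 1 ^ Suc n * sin (real (Suc n) * (2 * pi * x)) / real (Suc n) ^ 3) sums sine3 1 (2 * pi * x)"
      unfolding sine3_def by (intro summable_sums) (rule summable_rabs_cancel)
    hence "(\<lambda>n. 3 / (2 * pi ^ 3) * (1 ^ Suc n * sin (real (Suc n) * (2 * pi * x)) / real (Suc n) ^ 3)) sums
        (3 / (2 * pi ^ 3) * sine3 1 (2 * pi * x))"
      by (rule sums_mult)
    moreover have "3 / (2 * pi ^ 3) * sine3 1 (2 * pi * x) = pbern3 x"
      by (simp add: sine3_eq_pbern3)
    moreover have "(\<lambda>n. 3 / (2 * pi ^ 3) * (1 ^ Suc n * sin (real (Suc n) * (2 * pi * x)) / real (Suc n) ^ 3))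
        = (\<lambda>n. c n * sin (2 * pi * real (Suc n) * x))"
      by (simp add: c_def mult_ac del: of_nat_Suc)
    ultimately show ?thesis by (simp add: sums_iff del: of_nat_Suc)
  qed
  have "(\<integral>x. indicator {0<..} x * (pbern3 x * x powr (- w)) \<partial>lborel) =
      Gamma (w / 2) * Gamma (1 - w / 2) / (2 * Gamma w) * (2 * pi) powr (w - 1) * (\<Sum>n. c n * real (Suc n) powr (w - 1))"
    using sine_series_mellin[OF w sm_cw sm_c] unfolding series by (simp only: has_bochner_integral_iff)
  also have "(\<Sum>n. c n * real (Suc n) powr (w - 1)) = 3 / (2 * pi ^ 3) * (\<Sum>n. real (Suc n) powr (- (1 - t)))"
    unfolding c_powr by (rule suminf_mult[OF sm_t])
  also have "(\<integral>x. indicator {0<..} x * (pbern3 x * x powr (- w)) \<partial>lborel) = Hd + Tl"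
  proof -
    have "integrable lborel (\<lambda>x. indicator {1..} x * pbern3 x * exp (w * - ln x))"
      using w by (intro integrable_tail[OF _ _ measurable_pbern3 abs_pbern3_le]) auto
    also have "(\<lambda>x. indicator {1..} x * pbern3 x * exp (w * - ln x)) = (\<lambda>x. indicator {1..} x * (pbern3 x * x powr (- w)))"
      by (auto simp: fun_eq_iff powr_def indicator_def)
    finally have tl: "integrable lborel (\<lambda>x. indicator {1..} x * (pbern3 x * x powr (- w)))" .
    have hd: "integrable lborel (\<lambda>x. indicator {0<..<1} x * (pbern3 x * x powr (- w)))"
      using integral_pbern3_head[OF t(2)] by (simp only: has_bochner_integral_iff w_def)
    have "(\<lambda>x. indicator {0<..} x * (pbern3 x * x powr (- w))) =
        (\<lambda>x. indicator {0<..<1} x * (pbern3 x * x powr (- w)) + indicator {1..} x * (pbern3 x * x powr (- w)))"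
      by (auto simp: fun_eq_iff indicator_def)
    thus ?thesis using hd tl by (simp add: Hd_def Tl_def w_def)
  qed
  finally have sum: "Hd + Tl = Gamma (w / 2) * Gamma (1 - w / 2) / (2 * Gamma w) * (2 * pi) powr (w - 1) *
      (3 / (2 * pi ^ 3) * (\<Sum>n. real (Suc n) powr (- (1 - t))))" .
  have Hd: "Hd = 1 / (1 - t) + 3 / (2 * t) - 1 / (2 * (t + 1))"
    using integral_pbern3_head[OF t(2)] by (simp only: has_bochner_integral_iff Hd_def)
  have "1 / (t - 1) + 1 / 2 + t / 12 = - (t * (t + 1) * (t + 2) / 6) * Hd"
  proof -
    have "t - 1 \<noteq> 0" "1 - t \<noteq> 0" "t \<noteq> 0" "t + 1 \<noteq> 0" using t by auto
    moreover have "1 / (1 - t) = - (1 / (t - 1))" by (metis minus_diff_eq minus_divide_right)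
    ultimately show ?thesis unfolding Hd
      by (simp add: divide_simps) (simp add: algebra_simps power2_eq_square power3_eq_cube)
  qed
  hence "1 / (t - 1) + 1 / 2 + t / 12 - t * (t + 1) * (t + 2) / 6 * Tl = - (t * (t + 1) * (t + 2) / 6) * (Hd + Tl)"
    by (simp only: distrib_left mult_minus_left)
  hence "zeta (of_real t) = of_real (- (t * (t + 1) * (t + 2) / 6) * (Hd + Tl))"
    using zeta_real_formula[of t] t unfolding Tl_def by simp
  moreover have "w - 1 = t + 2" by (simp add: w_def)
  ultimately show ?thesis unfolding sum by (simp only: w_def)
qed

text \<open>The Gamma quotient of the sine transform is brought to symmetric form by the duplication
  formula at t/2 and the recurrence of Gamma. The result is stated with \<open>rGamma\<close>, which
  is entire, so that it can be continued.\<close>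

lemma zeta_functional_equation_real:
  fixes t :: real
  assumes t: "-2 < t" "t < -1"
  shows "zeta (of_real t) * rGamma ((1 - of_real t) / 2) = of_real pi powr (of_real t - 1 / 2) * rGamma (of_real t / 2) * zeta (1 - of_real t)"
proof -
  \<comment> \<open>All Gamma arguments are tied to this point: t/2 + 1/2 = X, (t + 3)/2 = X + 1 and
    1 - (t + 3)/2 = -X.\<close>
  define X where "X = (t + 1) / 2"
  define Z where "Z = (\<Sum>n. real (Suc n) powr (- (1 - t)))"
  have X: "-1 / 2 < X" "X < 0" using t by (auto simp: X_def)
  have nonint: "x \<notin> \<int>\<^sub>\<le>\<^sub>0" if "of_int k < x" "x < of_int k + 1" for x :: real and k
  proof
    assume "x \<in> \<int>\<^sub>\<le>\<^sub>0"
    then obtain m where "x = of_int m" by (auto elim!: nonpos_Ints_cases)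
    thus False using that by auto
  qed
  have nX: "X \<notin> \<int>\<^sub>\<le>\<^sub>0" and nt: "t \<notin> \<int>\<^sub>\<le>\<^sub>0" and nt2: "t / 2 \<notin> \<int>\<^sub>\<le>\<^sub>0"
    using nonint[of "-1" X] nonint[of "-2" t] nonint[of "-1" "t / 2"] X t by auto
  have nmX: "- X \<notin> \<int>\<^sub>\<le>\<^sub>0" using X by (auto elim!: nonpos_Ints_cases)
  have G1: "Gamma ((t + 3) / 2) = X * Gamma X"
    using Gamma_plus1[OF nX] by (simp add: X_def add_divide_distrib add.commute)
  have G2: "Gamma ((1 - t) / 2) = - X * Gamma (1 - (t + 3) / 2)"
  proof -
    have e1: "(1 - t) / 2 = - X + 1" and e2: "1 - (t + 3) / 2 = - X" by (simp_all add: X_def field_simps)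
    show ?thesis unfolding e1 e2 by (rule Gamma_plus1[OF nmX])
  qed
  have "rGamma t = t * ((t + 1) * ((t + 2) * rGamma (t + 3)))"
    using rGamma_plus1[of t] rGamma_plus1[of "t + 1"] rGamma_plus1[of "t + 2"] by (simp add: add.assoc)
  hence G3: "t * (t + 1) * (t + 2) / Gamma (t + 3) = 1 / Gamma t"
    by (simp add: Gamma_def divide_inverse mult.assoc)
  have G4: "Gamma (t / 2) * Gamma X = 2 powr (1 - t) * sqrt pi * Gamma t"
  proof -
    have c: "complex_of_real (t / 2) + 1 / 2 = of_real X" "2 * complex_of_real (t / 2) = of_real t"
      by (simp_all add: X_def add_divide_distrib)
    have "Gamma (complex_of_real (t / 2)) * Gamma (complex_of_real (t / 2) + 1 / 2) =
        exp ((1 - 2 * complex_of_real (t / 2)) * of_real (ln 2)) * of_real (sqrt pi) * Gamma (2 * complex_of_real (t / 2))"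
    proof (rule Gamma_legendre_duplication)
      show "complex_of_real (t / 2) \<notin> \<int>\<^sub>\<le>\<^sub>0" using nt2 of_real_in_nonpos_Ints_iff by blast
      show "complex_of_real (t / 2) + 1 / 2 \<notin> \<int>\<^sub>\<le>\<^sub>0" unfolding c using nX of_real_in_nonpos_Ints_iff by blast
    qed
    hence "complex_of_real (Gamma (t / 2) * Gamma X) = of_real (exp ((1 - t) * ln 2) * sqrt pi * Gamma t)"
      unfolding c by (simp only: Gamma_complex_of_real of_real_mult exp_of_real[symmetric] of_real_diff of_real_1)
    hence "Gamma (t / 2) * Gamma X = exp ((1 - t) * ln 2) * sqrt pi * Gamma t" by (simp only: of_real_eq_iff)
    thus ?thesis by (simp add: powr_def)
  qed
  have Gt: "Gamma t \<noteq> 0" "Gamma (t / 2) \<noteq> 0" using nt nt2 by (simp_all add: Gamma_eq_zero_iff)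
  have Gpos: "Gamma ((1 - t) / 2) > 0" using t by (intro Gamma_real_pos) auto
  have GX: "Gamma X = 2 powr (1 - t) * sqrt pi * Gamma t / Gamma (t / 2)"
    using G4 Gt by (simp add: field_simps)
  have pw: "2 powr (1 - t) * sqrt pi * (2 * pi) powr (t + 2) = 8 * pi ^ 3 * pi powr (t - 1 / 2)"
  proof -
    have "2 powr (1 - t) * sqrt pi * (2 * pi) powr (t + 2) = (2 powr (1 - t) * 2 powr (t + 2)) * (pi powr (1 / 2) * pi powr (t + 2))"
      by (simp add: powr_mult powr_half_sqrt)
    also have "2 powr (1 - t) * 2 powr (t + 2) = (2 :: real) powr 3" by (subst powr_add[symmetric]) simp
    also have "pi powr (1 / 2) * pi powr (t + 2) = pi powr (3 + (t - 1 / 2))" by (subst powr_add[symmetric]) simp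
    also have "\<dots> = pi powr 3 * pi powr (t - 1 / 2)" by (rule powr_add)
    finally show ?thesis by (simp add: powr_numeral)
  qed
  have gen1: "- (A / 6) * (x * G * H / (2 * W) * P * (3 / (2 * Q) * Y)) = (A / W) * G * (- x * H) * P / (8 * Q) * Y"
    for A x G H W P Q Y :: real
    by (cases "W = 0"; cases "Q = 0") (simp_all add: field_simps)
  have gen2: "1 / T * G * H * P / E * Y = (G * P) * H / T / E * Y" for T G H P E Y :: real
    by simp
  have gen3: "8 * Q * R * T / S * H / T / (8 * Q) * Y = R * H / S * Y" if "T \<noteq> 0" "Q \<noteq> 0" for Q R T S H Y :: real
    using that by simp
  have "- (t * (t + 1) * (t + 2) / 6) * (Gamma ((t + 3) / 2) * Gamma (1 - (t + 3) / 2) / (2 * Gamma (t + 3)) * (2 * pi) powr (t + 2) *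
     (3 / (2 * pi ^ 3) * Z))
     = (t * (t + 1) * (t + 2) / Gamma (t + 3)) * Gamma X * (- X * Gamma (1 - (t + 3) / 2)) * (2 * pi) powr (t + 2) / (8 * pi ^ 3) * Z"
    unfolding G1 by (rule gen1)
  also have "\<dots> = (Gamma X * (2 * pi) powr (t + 2)) * Gamma ((1 - t) / 2) / Gamma t / (8 * pi ^ 3) * Z"
    unfolding G3 G2[symmetric] by (rule gen2)
  also have "Gamma X * (2 * pi) powr (t + 2) = (2 powr (1 - t) * sqrt pi * (2 * pi) powr (t + 2)) * Gamma t / Gamma (t / 2)"
    unfolding GX by simp
  also have "\<dots> * Gamma ((1 - t) / 2) / Gamma t / (8 * pi ^ 3) * Z = pi powr (t - 1 / 2) * Gamma ((1 - t) / 2) / Gamma (t / 2) * Z"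
    unfolding pw by (rule gen3) (use Gt in auto)
  finally have zt: "zeta (of_real t) = of_real (pi powr (t - 1 / 2) * Gamma ((1 - t) / 2) / Gamma (t / 2) * Z)"
    using zeta_reflection_integral[OF t] by (simp only: Z_def)
  have z1: "zeta (of_real (1 - t)) = of_real Z"
  proof (rule zeta_of_real)
    show "(\<lambda>n. real (Suc n) powr (- (1 - t))) sums Z"
      unfolding Z_def using t by (intro summable_sums, subst summable_Suc_iff) (simp add: summable_real_powr_iff)
  qed (use t in auto)
  have r: "rGamma ((1 - t) / 2) = 1 / Gamma ((1 - t) / 2)" "rGamma (t / 2) = 1 / Gamma (t / 2)"
    by (simp_all only: rGamma_inverse_Gamma inverse_eq_divide)
  have "zeta (of_real t) * of_real (rGamma ((1 - t) / 2)) = of_real (pi powr (t - 1 / 2) * rGamma (t / 2)) * zeta (of_real (1 - t))"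
    unfolding zt z1 r of_real_mult[symmetric] of_real_eq_iff using Gpos by simp
  moreover have "(of_real (rGamma ((1 - t) / 2)) :: complex) = rGamma ((1 - of_real t) / 2)"
    "(of_real (rGamma (t / 2)) :: complex) = rGamma (of_real t / 2)"
    by (simp_all flip: rGamma_complex_of_real)
  moreover have "complex_of_real (pi powr (t - 1 / 2)) = of_real pi powr (of_real t - 1 / 2)"
    by (subst powr_of_real[symmetric]) auto
  ultimately show ?thesis by simp
qed

text \<open>On the half-plane the only singularity of either side is the pole of zeta(1 - s) at s =
  0. Removing that point keeps the domain connected, and it contains the interval (-2, -1) of the
  real case.\<close>

lemma zeta_functional_equation:
  assumes "Re s < 1 / 2" "s \<noteq> 0"
  shows "zeta s * rGamma ((1 - s) / 2) = of_real pi powr (s - 1 / 2) * rGamma (s / 2) * zeta (1 - s)"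
proof (rule identity_theorem[where S = "{s. Re s < 1 / 2} - {0}" and U = "complex_of_real ` {-2<..<-1}" and \<xi> = "of_real (- 3 / 2)"
      and f = "\<lambda>s. zeta s * rGamma ((1 - s) / 2)" and g = "\<lambda>s. of_real pi powr (s - 1 / 2) * rGamma (s / 2) * zeta (1 - s)"])
  show "(\<lambda>s. zeta s * rGamma ((1 - s) / 2)) holomorphic_on {s. Re s < 1 / 2} - {0}"
    by (intro holomorphic_intros holomorphic_zeta) auto
  have "(zeta \<circ> (\<lambda>s. 1 - s)) holomorphic_on {s. Re s < 1 / 2} - {0}"
    by (rule holomorphic_on_compose_gen[OF _ holomorphic_zeta[of "- {1}"]]) (auto intro!: holomorphic_intros)
  hence "(\<lambda>s. zeta (1 - s)) holomorphic_on {s. Re s < 1 / 2} - {0}" by (simp add: o_def)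
  thus "(\<lambda>s. of_real pi powr (s - 1 / 2) * rGamma (s / 2) * zeta (1 - s)) holomorphic_on {s. Re s < 1 / 2} - {0}"
    by (intro holomorphic_intros) auto
  show "open ({s. Re s < 1 / 2} - {0 :: complex})" by (intro open_delete open_halfspace_Re_lt)
  show "connected ({s. Re s < 1 / 2} - {0 :: complex})"
    by (intro connected_open_delete open_halfspace_Re_lt convex_connected convex_halfspace_Re_lt) auto
  show "complex_of_real (- 3 / 2) islimpt complex_of_real ` {-2<..<-1}"
    by (rule islimpt_of_real_interval) auto
  show "zeta z * rGamma ((1 - z) / 2) = of_real pi powr (z - 1 / 2) * rGamma (z / 2) * zeta (1 - z)"
    if "z \<in> complex_of_real ` {-2<..<-1}" for z
    using that zeta_functional_equation_real by auto
qed (use assms in auto)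

text \<open>Reflection moves s to 1 - s, where zeta does not vanish by assumption. The zero must
  then come from \<open>rGamma (s / 2)\<close>, so s/2 is a nonpositive integer.\<close>

lemma zeta_zeros_left:
  assumes "zeta s = 0" "Re s < 1 / 2" and right: "\<And>z. Re z > 1 / 2 \<Longrightarrow> z \<noteq> 1 \<Longrightarrow> zeta z \<noteq> 0"
  shows "\<exists>n::nat. s = - 2 * of_nat (Suc n)"
proof -
  have s0: "s \<noteq> 0" using assms(1) zeta_zero_nonzero by auto
  have "zeta (1 - s) \<noteq> 0" using assms(2) s0 by (intro right) auto
  moreover have "of_real pi powr (s - 1 / 2) \<noteq> (0 :: complex)" by simp
  ultimately have "rGamma (s / 2) = 0"
    using zeta_functional_equation[OF assms(2) s0] assms(1) by simp
  then obtain m where m: "s / 2 = - of_nat m"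
    by (auto simp: rGamma_eq_zero_iff elim!: nonpos_Ints_cases')
  hence "m \<noteq> 0" using s0 by auto
  then obtain n where "m = Suc n" by (cases m) auto
  moreover have "s = - 2 * of_nat m" using m by (simp add: field_simps)
  ultimately show ?thesis by blast
qed

subsection \<open>The Liouville function\<close>

text \<open>A prime power p^k contributes the alternating sum of (-1)^i for i <= k, which is 1 for
  even k and 0 for odd k; only squares have all exponents even.\<close>

lemma liouville_divisor_sum:
  assumes "m > 0"
  shows "(\<Sum>d | d dvd m. liouville d) = (if \<exists>j. m = j ^ 2 then 1 else 0)"
  using assms
proof (induction m rule: less_induct)
  case (less m)
  show ?case
  proof (cases "m = 1")
    case True
    hence "\<exists>j. m = j ^ 2" by (intro exI[of _ 1]) simp
    thus ?thesis using True by simp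
  next
    case False
    then obtain p where p: "prime p" "p dvd m" using prime_factor_nat by blast
    have u: "\<not> is_unit p" using p by auto
    obtain y where y: "m = p ^ multiplicity p m * y" "\<not> p dvd y"
      using multiplicity_decompose'[of m p] less.prems u by auto
    define k where "k = multiplicity p m"
    have k: "k > 0" using p less.prems u by (auto simp: k_def multiplicity_gt_zero_iff)
    have y0: "y > 0" using y less.prems by (auto intro: Nat.gr0I)
    have "p ^ k > 1" using k p by (metis one_less_power prime_gt_1_nat)
    hence "y < m" using y(1) y0 unfolding k_def[symmetric] by (metis mult_less_cancel2 nat_mult_1)
    note IH = less.IH[OF this y0]
    have pw: "liouville (p ^ i * d) = (-1) ^ i * liouville d" if "d > 0" for i d
    proof (induction i)
      case (Suc i)
      have "liouville (p ^ Suc i * d) = liouville (p * (p ^ i * d))" by (simp add: mult.assoc)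
      also have "\<dots> = - liouville (p ^ i * d)"
        using that p(1) by (subst liouville_mult) (auto simp: liouville_prime prime_gt_0_nat)
      finally show ?case using Suc by simp
    qed simp
    have "(\<Sum>d | d dvd m. liouville d) = (\<Sum>i\<le>k. \<Sum>d | d dvd y. liouville (p ^ i * d))"
      unfolding y(1)[folded k_def] by (rule sum_divisors_prime_power_mult[OF p(1) y(2)])
    also have "\<dots> = (\<Sum>i\<le>k. (-1) ^ i * (\<Sum>d | d dvd y. liouville d))"
      unfolding sum_distrib_left using y0 by (intro sum.cong refl pw) (auto intro: Nat.gr0I)
    also have "\<dots> = (\<Sum>i\<le>k. (-1) ^ i) * (\<Sum>d | d dvd y. liouville d)" by (rule sum_distrib_right[symmetric])
    also have "(\<Sum>i\<le>k. (-1 :: int) ^ i) = (if even k then 1 else 0)" by (induction k) auto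
    finally have eq: "(\<Sum>d | d dvd m. liouville d) = (if even k \<and> (\<exists>j. y = j ^ 2) then 1 else 0)"
      using IH by simp
    have "(\<exists>j. m = j ^ 2) \<longleftrightarrow> even k \<and> (\<exists>j. y = j ^ 2)"
    proof
      assume "\<exists>j. m = j ^ 2"
      then obtain j where j: "m = j ^ 2" by blast
      have j0: "j \<noteq> 0" using j less.prems by (metis power_zero_numeral less_irrefl)
      have k2: "k = 2 * multiplicity p j"
        using j0 p unfolding k_def j by (subst prime_elem_multiplicity_power_distrib) auto
      obtain i where i: "j = p ^ multiplicity p j * i"
        using multiplicity_decompose'[OF j0 u] by blast
      have "p ^ k * y = p ^ k * i ^ 2"
        using y(1)[folded k_def] j i k2 by (metis power_mult power_mult_distrib mult.commute)
      moreover have "p ^ k \<noteq> 0" using \<open>1 < p ^ k\<close> by linarith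
      ultimately show "even k \<and> (\<exists>j. y = j ^ 2)" using k2 by auto
    next
      assume "even k \<and> (\<exists>j. y = j ^ 2)"
      then obtain l j where "k = 2 * l" "y = j ^ 2" by (auto elim!: evenE)
      hence "m = (p ^ l * j) ^ 2" using y(1)[folded k_def] by (simp add: power_mult_distrib power_mult[symmetric] mult.commute)
      thus "\<exists>j. m = j ^ 2" by blast
    qed
    thus ?thesis using eq by simp
  qed
qed

lemma abs_liouville [simp]: "\<bar>liouville n\<bar> = 1"
  by (simp add: liouville_def power_abs)

section \<open>The Dirichlet series of the Liouville function\<close>

definition liouville_series :: "complex \<Rightarrow> complex" where
  "liouville_series s = (\<Sum>n. of_int (liouville n) * of_nat n powr (- s))"

lemma of_nat_powr_mult:
  "(of_nat (m * n) :: complex) powr s = of_nat m powr s * of_nat n powr s"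
  using powr_times_real[of "of_nat m" "of_nat n" s] by simp

lemma summable_norm_nat_powr:
  assumes "Re s > 1"
  shows "summable (\<lambda>n. norm (of_nat n powr (- s) :: complex))"
proof -
  have "norm (of_nat n powr (- s) :: complex) = real n powr (- Re s)" for n
    by (subst norm_powr_real_powr) auto
  thus ?thesis using assms by (simp add: summable_real_powr_iff)
qed

lemma zeta_sums:
  assumes "Re s > 1"
  shows "(\<lambda>n. of_nat n powr (- s)) sums zeta s"
proof -
  have "zeta s = (\<Sum>n. 1 / of_nat (Suc n) powr s)"
    using is_zeta_continuation_zeta assms unfolding is_zeta_continuation_def by auto
  also have "(\<lambda>n. 1 / of_nat (Suc n) powr s) = (\<lambda>n. of_nat (Suc n) powr (- s) :: complex)"
    by (simp add: powr_minus inverse_eq_divide)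
  finally have z: "zeta s = (\<Sum>n. of_nat (Suc n) powr (- s))" .
  have "summable (\<lambda>n. of_nat n powr (- s) :: complex)"
    by (rule summable_norm_cancel[OF summable_norm_nat_powr[OF assms]])
  hence "summable (\<lambda>n. of_nat (Suc n) powr (- s) :: complex)" by (subst summable_Suc_iff)
  hence "(\<lambda>n. of_nat (Suc n) powr (- s)) sums zeta s" unfolding z by (rule summable_sums)
  from sums_Suc[where f = "\<lambda>n. of_nat n powr (- s)", OF this] show ?thesis by simp
qed

text \<open>The product has the divisor sums of \<open>liouville\<close> as coefficients, that is,
  the indicator of the squares; summing n^(-s) over squares gives zeta(2s).\<close>

lemma zeta_liouville:
  assumes s: "Re s > 1"
  shows "liouville_series s * zeta s = zeta (2 * s)"
proof -
  define e :: "nat \<Rightarrow> complex" where "e = (\<lambda>n. of_nat n powr (- s))"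
  have sm: "summable (\<lambda>n. norm (e n))" unfolding e_def by (rule summable_norm_nat_powr[OF s])
  have nl: "norm (of_int (liouville n) * e n) = norm (e n)" for n
    by (simp add: norm_mult flip: of_int_abs)
  have "(\<lambda>m. (\<Sum>d | d dvd m. of_int (liouville d) * 1) * e m) sums
     ((\<Sum>n. of_int (liouville n) * e n) * (\<Sum>n. 1 * e n))"
    by (rule dirichlet_series_mult) (use sm nl in \<open>auto simp: e_def of_nat_powr_mult simp del: of_nat_mult\<close>)
  hence 1: "(\<lambda>m. (\<Sum>d | d dvd m. of_int (liouville d)) * e m) sums (liouville_series s * zeta s)"
    using zeta_sums[OF s] by (simp add: liouville_series_def e_def sums_iff)
  define g :: "nat \<Rightarrow> nat" where "g = (\<lambda>n. Suc n ^ 2)"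
  have mono: "strict_mono g" unfolding g_def by (intro strict_monoI power_strict_mono) auto
  have "(\<lambda>n. (\<Sum>d | d dvd g n. of_int (liouville d)) * e (g n)) sums (liouville_series s * zeta s)"
  proof (subst sums_mono_reindex[OF mono])
    fix m assume m: "m \<notin> range g"
    show "(\<Sum>d | d dvd m. of_int (liouville d)) * e m = 0"
    proof (cases "m = 0")
      case True
      thus ?thesis by (simp add: e_def)
    next
      case False
      have "\<not> (\<exists>j. m = j ^ 2)"
      proof
        assume "\<exists>j. m = j ^ 2"
        then obtain j where j: "m = j ^ 2" by blast
        hence "j \<noteq> 0" using False by auto
        then obtain i where "j = Suc i" by (cases j) auto
        thus False using m j by (auto simp: g_def)
      qed
      hence "(\<Sum>d | d dvd m. liouville d) = 0" using liouville_divisor_sum[of m] False by simp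
      hence "(\<Sum>d | d dvd m. of_int (liouville d) :: complex) = 0" by (simp flip: of_int_sum)
      thus ?thesis by simp
    qed
  qed (rule 1)
  also have "(\<lambda>n. (\<Sum>d | d dvd g n. of_int (liouville d)) * e (g n)) = (\<lambda>n. of_nat (Suc n) powr (- (2 * s)))"
  proof
    fix n
    have "(\<Sum>d | d dvd g n. liouville d) = 1" using liouville_divisor_sum[of "g n"] by (auto simp: g_def)
    hence "(\<Sum>d | d dvd g n. of_int (liouville d) :: complex) = 1" by (simp flip: of_int_sum)
    moreover have "e (g n) = of_nat (Suc n) powr (- s) * of_nat (Suc n) powr (- s)"
      unfolding e_def g_def power2_eq_square by (rule of_nat_powr_mult)
    moreover have "\<dots> = of_nat (Suc n) powr (- s + - s)" by (rule powr_add[symmetric])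
    ultimately show "(\<Sum>d | d dvd g n. of_int (liouville d)) * e (g n) = of_nat (Suc n) powr (- (2 * s))" by simp
  qed
  finally have "(\<lambda>n. of_nat (Suc n) powr (- (2 * s))) sums (liouville_series s * zeta s)" .
  from sums_Suc[where f = "\<lambda>n. of_nat n powr (- (2 * s))", OF this]
  have "(\<lambda>n. of_nat n powr (- (2 * s))) sums (liouville_series s * zeta s)" by simp
  moreover have "(\<lambda>n. of_nat n powr (- (2 * s))) sums zeta (2 * s)" using s by (intro zeta_sums) simp
  ultimately show ?thesis by (rule sums_unique2)
qed

text \<open>A zero at \<open>s\<close> would propagate to \<open>2 ^ k * s\<close> for all \<open>k\<close>, but zeta tends to 1 far to the right.\<close>
lemma zeta_nonzero_right:
  assumes s: "Re s > 1"
  shows "zeta s \<noteq> 0"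
proof
  assume z: "zeta s = 0"
  have zk: "zeta (2 ^ k * s) = 0 \<and> Re (2 ^ k * s) > 1" for k
  proof (induction k)
    case (Suc k)
    have "zeta (2 * (2 ^ k * s)) = liouville_series (2 ^ k * s) * zeta (2 ^ k * s)"
      using Suc by (intro zeta_liouville[symmetric]) auto
    thus ?case using Suc by (simp add: mult.assoc)
  qed (use z s in auto)
  \<comment> \<open>Far to the right the terms from 2 on are at most 2^(2 - Re t) n^(-2), which
    gives |zeta(t) - 1| <= 2^(2 - Re t) C.\<close>
  define C where "C = (\<Sum>n. real (n + 2) powr (- 2))"
  have smC: "summable (\<lambda>n. real (n + 2) powr (- 2))" by (rule summable_shifted_powr) simp
  have C0: "C \<ge> 0" unfolding C_def by (intro suminf_nonneg smC) auto
  have bound: "1 \<le> 2 powr (2 - Re t) * C" if "Re t \<ge> 2" "zeta t = 0" for t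
  proof -
    have t1: "Re t > 1" using that by simp
    have le: "real (n + 2) powr (- Re t) \<le> 2 powr (2 - Re t) * real (n + 2) powr (- 2)" for n
    proof -
      have "real (n + 2) powr (- Re t) = real (n + 2) powr (2 - Re t) * real (n + 2) powr (- 2)"
        by (subst powr_add[symmetric]) simp
      also have "real (n + 2) powr (2 - Re t) \<le> 2 powr (2 - Re t)" using that by (intro powr_mono2') auto
      finally show ?thesis by (simp add: mult_right_mono)
    qed
    have norm_eq: "norm (of_nat (n + 2) powr (- t) :: complex) = real (n + 2) powr (- Re t)" for n
      by (subst norm_powr_real_powr) auto
    have "(\<lambda>n. of_nat n powr (- t)) sums zeta t" by (rule zeta_sums[OF t1])
    hence "(\<lambda>n. of_nat (n + 2) powr (- t)) sums (zeta t - (\<Sum>n<2. of_nat n powr (- t)))"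
      by (rule sums_split_initial_segment)
    hence "(\<lambda>n. of_nat (n + 2) powr (- t) :: complex) sums (- 1)" using that by (simp add: numeral_2_eq_2)
    hence "norm (- 1 :: complex) = norm (\<Sum>n. of_nat (n + 2) powr (- t) :: complex)" by (simp add: sums_iff)
    also have "\<dots> \<le> (\<Sum>n. 2 powr (2 - Re t) * real (n + 2) powr (- 2))"
      by (rule norm_suminf_le[OF _ summable_mult[OF smC]]) (use le norm_eq in auto)
    also have "\<dots> = 2 powr (2 - Re t) * C" unfolding C_def by (rule suminf_mult[OF smC])
    finally show ?thesis by simp
  qed
  have "((\<lambda>x. 2 powr (2 - x) * C) \<longlongrightarrow> 0) at_top" by real_asymp
  hence "eventually (\<lambda>x. 2 powr (2 - x) * C < 1) at_top" by (rule order_tendstoD) simp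
  then obtain x0 where x0: "\<And>x. x \<ge> x0 \<Longrightarrow> 2 powr (2 - x) * C < 1" by (auto simp: eventually_at_top_linorder)
  obtain k where k: "2 ^ k > max x0 2" using real_arch_pow[of 2 "max x0 2"] by auto
  have "Re (2 ^ k * s) \<ge> 2 ^ k"
  proof -
    have "Re (2 ^ k * s) = 2 ^ k * Re s" by (simp add: Re_power_real)
    thus ?thesis using s by simp
  qed
  hence "Re (2 ^ k * s) \<ge> 2" "Re (2 ^ k * s) \<ge> x0" using k by linarith+
  thus False using bound[of "2 ^ k * s"] zk[of k] x0[of "Re (2 ^ k * s)"] by linarith
qed

subsection \<open>The Riemann hypothesis\<close>

definition liouville_sine :: "real \<Rightarrow> real" where
  "liouville_sine x = (\<Sum>n. real_of_int (liouville (Suc n)) / real (Suc n) ^ 2 * sin (2 * pi * real (Suc n) * x))"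

lemma summable_inverse_squares: "summable (\<lambda>n. 1 / real (Suc n) ^ 2)"
  using inverse_power_summable[of 2, where 'a = real] by (subst summable_Suc_iff) (simp add: inverse_eq_divide)

lemma abs_liouville_real: "\<bar>real_of_int (liouville n)\<bar> = 1"
  by (simp flip: of_int_abs)

lemma liouville_sine_term_le:
  "\<bar>real_of_int (liouville (Suc n)) / real (Suc n) ^ 2 * sin (2 * pi * real (Suc n) * x)\<bar> \<le> 1 / real (Suc n) ^ 2"
proof -
  have "1 / real (Suc n) ^ 2 * \<bar>sin (2 * pi * real (Suc n) * x)\<bar> \<le> 1 / real (Suc n) ^ 2 * 1"
    by (intro mult_left_mono) auto
  thus ?thesis by (simp only: abs_mult abs_divide abs_liouville_real abs_power2 power_abs abs_of_nat mult_1_right)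
qed

lemma summable_liouville_sine:
  "summable (\<lambda>n. real_of_int (liouville (Suc n)) / real (Suc n) ^ 2 * sin (2 * pi * real (Suc n) * x))"
  by (rule summable_comparison_test'[OF summable_inverse_squares]) (simp only: real_norm_def liouville_sine_term_le)

lemma abs_liouville_sine_le: "\<bar>liouville_sine x\<bar> \<le> (\<Sum>n. 1 / real (Suc n) ^ 2)"
  unfolding liouville_sine_def real_norm_def[symmetric]
  by (rule norm_suminf_le[OF _ summable_inverse_squares]) (simp only: real_norm_def liouville_sine_term_le)

lemma measurable_liouville_sine [measurable]: "liouville_sine \<in> borel_measurable borel"
  unfolding liouville_sine_def [abs_def] by measurable

text \<open>For each N some admissible prime has a symbol agreeing with the Liouville function up to
  N. Both series have terms of size at most 1/n^2, so they differ by at most twice the tail of that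
  series, which tends to 0.\<close>

lemma liouville_sine_nonneg:
  assumes nonneg: "\<And>q. prime q \<Longrightarrow> [q = 3] (mod 8) \<Longrightarrow> legendre_sine_series q x \<ge> 0"
  shows "liouville_sine x \<ge> 0"
proof -
  define a where "a = (\<lambda>n. real_of_int (liouville (Suc n)) / real (Suc n) ^ 2 * sin (2 * pi * real (Suc n) * x))"
  define R where "R = (\<lambda>N. \<Sum>n. 1 / real (Suc (n + N)) ^ 2)"
  have a: "summable a" unfolding a_def by (rule summable_liouville_sine)
  have "- (2 * R N) \<le> liouville_sine x" for N
  proof -
    obtain q where q: "prime q" "[q = 3] (mod 8)"
      and nonres: "\<And>p. prime p \<Longrightarrow> p \<le> N \<Longrightarrow> Legendre (int p) (int q) = -1"
      using exists_prime_nonresidues[of N] by blast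
    have "q \<noteq> 2" using q(2) by (auto simp: cong_def)
    hence q2: "2 < q" using prime_ge_2_nat[OF q(1)] by simp
    define b where "b = (\<lambda>n. real_of_int (Legendre (int (Suc n)) (int q)) * sin (2 * pi * real (Suc n) * x) / real (Suc n) ^ 2)"
    have b: "summable b" unfolding b_def by (rule summable_norm_cancel[OF summable_legendre_sine_series])
    have ab: "a n = b n" if "n < N" for n
      using Legendre_eq_liouville[OF q(1) q2 nonres, where n = "Suc n" and N = N] that by (simp add: a_def b_def)
    have sm1: "summable (\<lambda>n. 1 / real (Suc (n + N)) ^ 2)"
      using summable_iff_shift[of "\<lambda>n. 1 / real (Suc n) ^ 2" N] summable_inverse_squares by simp
    note smR = summable_mult[OF sm1, of 2]
    have d: "norm (a n - b n) \<le> 2 * (1 / real (Suc n) ^ 2)" for n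
    proof -
      have "\<bar>real_of_int (Legendre (int (Suc n)) (int q))\<bar> \<le> 1"
        using Legendre_values[of "int (Suc n)" "int q"] by auto
      hence "\<bar>real_of_int (Legendre (int (Suc n)) (int q))\<bar> * \<bar>sin (2 * pi * real (Suc n) * x)\<bar> \<le> 1 * 1"
        by (intro mult_mono) auto
      hence "\<bar>b n\<bar> \<le> 1 / real (Suc n) ^ 2"
        unfolding b_def by (simp only: abs_mult abs_divide abs_power2 power_abs abs_of_nat) (intro divide_right_mono; simp)
      moreover have "\<bar>a n\<bar> \<le> 1 / real (Suc n) ^ 2" unfolding a_def by (rule liouville_sine_term_le)
      ultimately show ?thesis unfolding real_norm_def by linarith
    qed
    have "liouville_sine x - legendre_sine_series q x = (\<Sum>n. a n - b n)"
      unfolding liouville_sine_def legendre_sine_series_def a_def[symmetric] b_def[symmetric]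
      using suminf_diff[OF a b] by (simp add: a_def b_def)
    also have "\<dots> = (\<Sum>n. a (n + N) - b (n + N))"
      using suminf_split_initial_segment[OF summable_diff[OF a b], of N] ab by simp
    finally have eq: "liouville_sine x - legendre_sine_series q x = (\<Sum>n. a (n + N) - b (n + N))" .
    have "norm (liouville_sine x - legendre_sine_series q x) \<le> (\<Sum>n. 2 * (1 / real (Suc (n + N)) ^ 2))"
      unfolding eq by (rule norm_suminf_le[OF _ smR]) (rule d)
    also have "\<dots> = 2 * R N" unfolding R_def by (rule suminf_mult[OF sm1])
    finally have "\<bar>liouville_sine x - legendre_sine_series q x\<bar> \<le> 2 * R N" by simp
    thus ?thesis using nonneg[OF q] by linarith
  qed
  moreover have "(\<lambda>N. - (2 * R N)) \<longlonglongrightarrow> - (2 * 0)"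
  proof (intro tendsto_intros)
    have "R = (\<lambda>N. (\<Sum>n. 1 / real (Suc n) ^ 2) - (\<Sum>n<N. 1 / real (Suc n) ^ 2))"
      unfolding R_def using suminf_minus_initial_segment[OF summable_inverse_squares] by auto
    moreover have "(\<lambda>N. (\<Sum>n. 1 / real (Suc n) ^ 2) - (\<Sum>n<N. 1 / real (Suc n) ^ 2)) \<longlonglongrightarrow>
        (\<Sum>n. 1 / real (Suc n) ^ 2) - (\<Sum>n. 1 / real (Suc n) ^ 2)"
      by (intro tendsto_diff tendsto_const summable_LIMSEQ summable_inverse_squares)
    ultimately show "R \<longlonglongrightarrow> 0" by simp
  qed
  ultimately show ?thesis using LIMSEQ_le_const2[of "\<lambda>N. - (2 * R N)" "- (2 * 0)" "liouville_sine x"] by simp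
qed

section \<open>The Mellin identity\<close>

text \<open>The integral \<open>F\<close> does not depend on the ends of the strip, so this is one
  function for all strips; where the integral diverges it has the default value 0.\<close>

definition mellin_head :: "complex \<Rightarrow> complex" where
  "mellin_head = exp_integrals.F lborel (\<lambda>x. indicator {0<..<1/4} x * liouville_sine x) (\<lambda>x. - ln x)"

abbreviation head_integrable :: "real \<Rightarrow> bool" where
  "head_integrable \<sigma> \<equiv> integrable lborel (\<lambda>x. indicator {0<..<1/4} x * liouville_sine x * exp (\<sigma> * - ln x))"

lemma exp_integrals_head:
  assumes "head_integrable a" "head_integrable b"
  shows "exp_integrals lborel (\<lambda>x. indicator {0<..<1/4} x * liouville_sine x) (\<lambda>x. - ln x) a b"
  using assms by unfold_locales measurable

lemma liouville_sine_mellin: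
  fixes w :: real
  assumes w: "1 < w" "w < 2"
  shows "head_integrable w"
    and "mellin_head (of_real w) + mellin_tail (1/4) liouville_sine (of_real w) =
      of_real (Gamma (w / 2) * Gamma (1 - w / 2) / (2 * Gamma w) * (2 * pi) powr (w - 1)) * liouville_series (3 - of_real w)"
proof -
  define f where "f = (\<lambda>x. liouville_sine x * x powr (- w))"
  define c where "c = (\<lambda>n. real_of_int (liouville (Suc n)) / real (Suc n) ^ 2)"
  have abs_c: "\<bar>c n\<bar> = 1 / real (Suc n) ^ 2" for n
    by (simp only: c_def abs_divide abs_liouville_real abs_power2 power_abs abs_of_nat)
  have pw: "1 / real (Suc n) ^ 2 * real (Suc n) powr (w - 1) = real (Suc n) powr (- (3 - w))" for n
  proof -
    have "real (Suc n) powr (w - 1) = real (Suc n) powr (- (3 - w) + 2)" by simp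
    also have "\<dots> = real (Suc n) powr (- (3 - w)) * real (Suc n) powr 2" by (rule powr_add)
    also have "real (Suc n) powr 2 = real (Suc n) ^ 2" by (simp add: powr_numeral)
    finally show ?thesis by (simp del: of_nat_Suc)
  qed
  have sm_w: "summable (\<lambda>n. \<bar>c n\<bar> * real (Suc n) powr (w - 1))"
    unfolding abs_c pw using w by (subst summable_Suc_iff) (simp add: summable_real_powr_iff)
  have sm_c: "summable (\<lambda>n. \<bar>c n\<bar>)" unfolding abs_c by (rule summable_inverse_squares)
  have total: "has_bochner_integral lborel (\<lambda>x. indicator {0<..} x * f x)
    (Gamma (w / 2) * Gamma (1 - w / 2) / (2 * Gamma w) * (2 * pi) powr (w - 1) * (\<Sum>n. c n * real (Suc n) powr (w - 1)))"
    using sine_series_mellin[OF w sm_w sm_c] unfolding f_def liouville_sine_def c_def by simp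
  have head_eq: "(\<lambda>x. indicator {0<..<1/4} x * liouville_sine x * exp (w * - ln x)) = (\<lambda>x. indicator {0<..<1/4} x * f x)"
    by (auto simp: fun_eq_iff f_def powr_def indicator_def)
  have [measurable]: "f \<in> borel_measurable borel" unfolding f_def by measurable
  have tot_int: "integrable lborel (\<lambda>x. indicator {0<..} x * f x)" using total by (simp add: has_bochner_integral_iff)
  have hd: "integrable lborel (\<lambda>x. indicator {0<..<1/4} x * f x)" "integrable lborel (\<lambda>x. indicator {1/4..} x * f x)"
    by (rule Bochner_Integration.integrable_bound[OF tot_int]; auto simp: indicator_def)+
  show head: "head_integrable w" unfolding head_eq by (rule hd)
  \<comment> \<open>The degenerate strip with both ends at w serves to unfold \<open>F\<close> at
    that point.\<close>
  interpret exp_integrals lborel "\<lambda>x. indicator {0<..<1/4} x * liouville_sine x" "\<lambda>x. - ln x" w w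
    by (rule exp_integrals_head[OF head head])
  have mh: "mellin_head (of_real w) = of_real (\<integral>x. indicator {0<..<1/4} x * f x \<partial>lborel)"
  proof -
    have "mellin_head (of_real w) = (\<integral>x. complex_of_real (indicator {0<..<1/4} x * liouville_sine x * exp (w * - ln x)) \<partial>lborel)"
      unfolding mellin_head_def F_def by (simp add: exp_of_real[symmetric])
    thus ?thesis by (simp only: head_eq integral_complex_of_real)
  qed
  have mt: "mellin_tail (1/4) liouville_sine (of_real w) = of_real (\<integral>x. indicator {1/4..} x * f x \<partial>lborel)"
    unfolding f_def by (rule mellin_tail_of_real) simp
  have split: "(\<integral>x. indicator {0<..} x * f x \<partial>lborel) = (\<integral>x. indicator {0<..<1/4} x * f x \<partial>lborel) + (\<integral>x. indicator {1/4..} x * f x \<partial>lborel)"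
  proof -
    have "(\<lambda>x. indicator {0<..} x * f x) = (\<lambda>x. indicator {0<..<1/4} x * f x + indicator {1/4..} x * f x)"
      by (auto simp: fun_eq_iff indicator_def)
    thus ?thesis using hd by simp
  qed
  have series: "of_real (\<Sum>n. c n * real (Suc n) powr (w - 1)) = liouville_series (3 - of_real w)"
  proof -
    have "c n * real (Suc n) powr (w - 1) = real_of_int (liouville (Suc n)) * real (Suc n) powr (- (3 - w))" for n
    proof -
      have "c n * real (Suc n) powr (w - 1) = real_of_int (liouville (Suc n)) * (1 / real (Suc n) ^ 2 * real (Suc n) powr (w - 1))"
        by (simp add: c_def del: of_nat_Suc)
      thus ?thesis unfolding pw .
    qed
    moreover have "summable (\<lambda>n. c n * real (Suc n) powr (w - 1))"
      by (rule summable_comparison_test'[OF sm_w]) (simp add: abs_mult)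
    ultimately have "(\<lambda>n. real_of_int (liouville (Suc n)) * real (Suc n) powr (- (3 - w))) sums (\<Sum>n. c n * real (Suc n) powr (w - 1))"
      by (simp add: summable_sums)
    hence "(\<lambda>n. complex_of_real (real_of_int (liouville (Suc n)) * real (Suc n) powr (- (3 - w)))) sums of_real (\<Sum>n. c n * real (Suc n) powr (w - 1))"
      by (rule sums_of_real)
    also have "(\<lambda>n. complex_of_real (real_of_int (liouville (Suc n)) * real (Suc n) powr (- (3 - w)))) =
        (\<lambda>n. of_int (liouville (Suc n)) * of_nat (Suc n) powr (- (3 - of_real w)))"
    proof
      fix n
      have "complex_of_real (real (Suc n) powr (- (3 - w))) = of_real (real (Suc n)) powr of_real (- (3 - w))"
        by (rule powr_of_real[symmetric]) simp
      thus "complex_of_real (real_of_int (liouville (Suc n)) * real (Suc n) powr (- (3 - w))) =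
          of_int (liouville (Suc n)) * of_nat (Suc n) powr (- (3 - of_real w))" by simp
    qed
    finally have "(\<lambda>n. of_int (liouville (Suc n)) * of_nat (Suc n) powr (- (3 - of_real w)) :: complex) sums of_real (\<Sum>n. c n * real (Suc n) powr (w - 1))" .
    from sums_Suc[where f = "\<lambda>n. of_int (liouville n) * of_nat n powr (- (3 - of_real w))", OF this]
    show ?thesis by (simp add: liouville_series_def sums_iff)
  qed
  show "mellin_head (of_real w) + mellin_tail (1/4) liouville_sine (of_real w) =
      of_real (Gamma (w / 2) * Gamma (1 - w / 2) / (2 * Gamma w) * (2 * pi) powr (w - 1)) * liouville_series (3 - of_real w)"
    unfolding mh mt of_real_add[symmetric] split[symmetric] has_bochner_integral_integral_eq[OF total]
    by (simp only: of_real_mult series)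
qed

text \<open>By the recurrence, 2 Gamma(2 - w/2) = (2 - w) Gamma(1 - w/2), and the factor 2 - w is
  the one contained in \<open>zeta_regularized (3 - w)\<close>. So w = 2 is neither a pole nor a
  zero here.\<close>

definition mellin_denominator :: "complex \<Rightarrow> complex" where
  "mellin_denominator w = rGamma (w / 2) * rGamma (2 - w / 2) * zeta_regularized (3 - w)"

definition mellin_numerator :: "complex \<Rightarrow> complex" where
  "mellin_numerator w = rGamma w * of_real (2 * pi) powr (w - 1) * zeta (6 - 2 * w)"

lemma mellin_identity_real:
  fixes w :: real
  assumes w: "1 < w" "w < 2"
  shows "mellin_denominator (of_real w) * (mellin_head (of_real w) + mellin_tail (1/4) liouville_sine (of_real w)) = mellin_numerator (of_real w)"
proof -
  have G: "Gamma (w / 2) > 0" "Gamma w > 0" "Gamma (1 - w / 2) > 0" using w by (auto intro!: Gamma_real_pos)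
  have "(1 - w / 2) * rGamma (1 - w / 2 + 1) = rGamma (1 - w / 2)" by (rule rGamma_plus1)
  moreover have "1 - w / 2 + 1 = 2 - w / 2" by simp
  ultimately have r2: "(1 - w / 2) * rGamma (2 - w / 2) = rGamma (1 - w / 2)" by simp
  have inv: "rGamma (w / 2) * Gamma (w / 2) = 1" "rGamma (1 - w / 2) * Gamma (1 - w / 2) = 1" "1 / Gamma w = rGamma w"
    using G by (simp_all only: rGamma_inverse_Gamma inverse_eq_divide) auto
  have "rGamma (w / 2) * rGamma (2 - w / 2) * (2 - w) * (Gamma (w / 2) * Gamma (1 - w / 2) / (2 * Gamma w))
      = (rGamma (w / 2) * Gamma (w / 2)) * (((1 - w / 2) * rGamma (2 - w / 2)) * Gamma (1 - w / 2)) * (1 / Gamma w)"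
  proof -
    have "a * b * (2 - w) * (x * y / (2 * z)) = (a * x) * (((1 - w / 2) * b) * y) * (1 / z)" for a b x y z :: real
      by (cases "z = 0") (simp_all add: field_simps)
    thus ?thesis .
  qed
  also have "\<dots> = rGamma w" unfolding r2 inv by simp
  finally have real_id: "rGamma (w / 2) * rGamma (2 - w / 2) * (2 - w) * (Gamma (w / 2) * Gamma (1 - w / 2) / (2 * Gamma w)) = rGamma w" .
  have cG: "rGamma (of_real w / 2) = complex_of_real (rGamma (w / 2))" "rGamma (2 - of_real w / 2) = complex_of_real (rGamma (2 - w / 2))"
    "rGamma (of_real w) = complex_of_real (rGamma w)"
    by (simp_all flip: rGamma_complex_of_real)
  have ze: "zeta_regularized (3 - of_real w) = of_real (2 - w) * zeta (3 - of_real w)"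
    using zeta_regularized_eq[of "3 - of_real w"] w by (auto simp: complex_eq_iff)
  have zl: "liouville_series (3 - of_real w) * zeta (3 - of_real w) = zeta (6 - 2 * of_real w)"
    using zeta_liouville[of "3 - of_real w"] w by (simp add: algebra_simps)
  have "mellin_denominator (of_real w) * (mellin_head (of_real w) + mellin_tail (1/4) liouville_sine (of_real w)) =
     of_real (rGamma (w / 2) * rGamma (2 - w / 2) * (2 - w) * (Gamma (w / 2) * Gamma (1 - w / 2) / (2 * Gamma w)))
     * of_real ((2 * pi) powr (w - 1)) * (liouville_series (3 - of_real w) * zeta (3 - of_real w))"
    unfolding mellin_denominator_def cG ze liouville_sine_mellin(2)[OF w] by (simp only: of_real_mult mult_ac)
  also have "\<dots> = of_real (rGamma w) * of_real ((2 * pi) powr (w - 1)) * zeta (6 - 2 * of_real w)"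
    unfolding real_id zl ..
  also have "complex_of_real ((2 * pi) powr (w - 1)) = of_real (2 * pi) powr (of_real w - 1)"
    by (subst powr_of_real[symmetric]) auto
  finally show ?thesis unfolding mellin_numerator_def cG by simp
qed

lemma holomorphic_mellin_quotient:
  "mellin_denominator holomorphic_on {w. 1 < Re w \<and> Re w < 5 / 2}" "mellin_numerator holomorphic_on {w. 1 < Re w \<and> Re w < 5 / 2}"
proof -
  have "(zeta_regularized \<circ> (\<lambda>w. 3 - w)) holomorphic_on {w. 1 < Re w \<and> Re w < 5 / 2}"
    by (rule holomorphic_on_compose_gen[OF _ holomorphic_zeta_regularized]) (auto intro!: holomorphic_intros)
  hence "(\<lambda>w. zeta_regularized (3 - w)) holomorphic_on {w. 1 < Re w \<and> Re w < 5 / 2}" by (simp add: o_def)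
  thus "mellin_denominator holomorphic_on {w. 1 < Re w \<and> Re w < 5 / 2}"
    unfolding mellin_denominator_def [abs_def] by (intro holomorphic_intros) auto
  have "(zeta \<circ> (\<lambda>w. 6 - 2 * w)) holomorphic_on {w. 1 < Re w \<and> Re w < 5 / 2}"
    by (rule holomorphic_on_compose_gen[OF _ holomorphic_zeta[of "{s. Re s > 1}"]]) (auto intro!: holomorphic_intros)
  hence "(\<lambda>w. zeta (6 - 2 * w)) holomorphic_on {w. 1 < Re w \<and> Re w < 5 / 2}" by (simp add: o_def)
  thus "mellin_numerator holomorphic_on {w. 1 < Re w \<and> Re w < 5 / 2}"
    unfolding mellin_numerator_def [abs_def] by (intro holomorphic_intros) auto
qed

text \<open>Landau's lemma asks for regularity at the real boundary point only. With s = 3 - w there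
  are three cases: no zeros for s > 1, the value 1 of (s - 1) zeta(s) at s = 1, and negativity of
  zeta on (0, 1).\<close>

lemma mellin_denominator_real_nonzero:
  fixes w :: real
  assumes "1 < w" "w < 5 / 2"
  shows "mellin_denominator (of_real w) \<noteq> 0"
proof -
  have "zeta_regularized (3 - of_real w) \<noteq> 0"
  proof (cases "w = 2")
    case True
    thus ?thesis using zeta_regularized_one by simp
  next
    case False
    have "zeta (of_real (3 - w)) \<noteq> 0"
    proof (cases "w < 2")
      case True
      thus ?thesis by (intro zeta_nonzero_right) simp
    next
      case False
      thus ?thesis using assms \<open>w \<noteq> 2\<close> by (intro zeta_real_nonzero) auto
    qed
    moreover have "3 - complex_of_real w \<noteq> 1" using False by (auto simp: complex_eq_iff)
    ultimately show ?thesis using zeta_regularized_eq[of "3 - of_real w"] assms by auto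
  qed
  moreover have nz: "rGamma (complex_of_real x) \<noteq> 0" if "x > 0" for x
    using that by (auto simp: rGamma_eq_zero_iff of_real_in_nonpos_Ints_iff elim!: nonpos_Ints_cases)
  have "rGamma (complex_of_real w / 2) \<noteq> 0" "rGamma (2 - complex_of_real w / 2) \<noteq> 0"
    using nz[of "w / 2"] nz[of "2 - w / 2"] assms by simp_all
  ultimately show ?thesis by (simp add: mellin_denominator_def)
qed

lemma holomorphic_liouville_tail: "mellin_tail (1/4) liouville_sine holomorphic_on {w. Re w > 1}"
  by (rule holomorphic_mellin_tail[OF _ measurable_liouville_sine abs_liouville_sine_le]) simp

text \<open>The bound a < 2 makes the strip meet the interval (1, 2) where the identity has been
  computed; the rest of the strip follows by uniqueness.\<close>

lemma mellin_identity:
  assumes "1 < a" "a < 2" "a < b" "b < 5 / 2" and int: "head_integrable a" "head_integrable b"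
    and w: "a < Re w" "Re w < b"
  shows "mellin_denominator w * (mellin_head w + mellin_tail (1/4) liouville_sine w) = mellin_numerator w"
proof -
  interpret exp_integrals lborel "\<lambda>x. indicator {0<..<1/4} x * liouville_sine x" "\<lambda>x. - ln x" a b
    by (rule exp_integrals_head[OF int])
  define S where "S = {w. a < Re w \<and> Re w < b}"
  have sub: "S \<subseteq> {w. 1 < Re w \<and> Re w < 5 / 2}" "S \<subseteq> {w. 1 < Re w}" using assms by (auto simp: S_def)
  define m where "m = (a + min b 2) / 2"
  show ?thesis
  proof (rule identity_theorem[where S = S and U = "complex_of_real ` {a<..<min b 2}" and \<xi> = "of_real m"
        and f = "\<lambda>w. mellin_denominator w * (mellin_head w + mellin_tail (1/4) liouville_sine w)"])
    have "mellin_head holomorphic_on S" unfolding mellin_head_def S_def by (rule holomorphic)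
    thus "(\<lambda>w. mellin_denominator w * (mellin_head w + mellin_tail (1/4) liouville_sine w)) holomorphic_on S"
      using holomorphic_mellin_quotient(1) holomorphic_liouville_tail sub
      by (intro holomorphic_on_mult holomorphic_on_add) (auto intro: holomorphic_on_subset)
    show "mellin_numerator holomorphic_on S" by (rule holomorphic_on_subset[OF holomorphic_mellin_quotient(2) sub(1)])
    have S_eq: "S = {w. Re w > a} \<inter> {w. Re w < b}" by (auto simp: S_def)
    show "open S" unfolding S_eq by (intro open_Int open_halfspace_Re_gt open_halfspace_Re_lt)
    show "connected S" unfolding S_eq
      by (intro convex_connected convex_Int convex_halfspace_Re_gt convex_halfspace_Re_lt)
    show "complex_of_real ` {a<..<min b 2} \<subseteq> S" by (auto simp: S_def)
    show "complex_of_real m \<in> S" using assms by (auto simp: S_def m_def min_def)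
    show "complex_of_real m islimpt complex_of_real ` {a<..<min b 2}"
      using assms by (intro islimpt_of_real_interval) (auto simp: m_def min_def)
    show "w \<in> S" using w by (simp add: S_def)
    fix z assume "z \<in> complex_of_real ` {a<..<min b 2}"
    thus "mellin_denominator z * (mellin_head z + mellin_tail (1/4) liouville_sine z) = mellin_numerator z"
      using mellin_identity_real assms by auto
  qed
qed

lemma head_integrable_between:
  assumes "head_integrable a" "head_integrable b" "a \<le> \<sigma>" "\<sigma> \<le> b"
  shows "head_integrable \<sigma>"
  using exp_integrals.integrable_exp_real[OF exp_integrals_head[OF assms(1,2)] assms(3,4)] .

text \<open>If the abscissa of convergence were smaller than 5/2, the right-hand side of the Mellin
  identity would continue the transform of a nonnegative function past its real singularity.\<close>
lemma head_integrable_all: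
  assumes nonneg: "\<And>x. 0 \<le> x \<Longrightarrow> x \<le> 1 / 4 \<Longrightarrow> liouville_sine x \<ge> 0"
    and \<sigma>: "1 < \<sigma>" "\<sigma> < 5 / 2"
  shows "head_integrable \<sigma>"
proof (rule ccontr)
  assume not_int: "\<not> head_integrable \<sigma>"
  define T where "T = {\<tau>. 1 < \<tau> \<and> head_integrable \<tau>}"
  have T_less: "\<tau> < \<sigma>" if "\<tau> \<in> T" for \<tau>
  proof (rule ccontr)
    assume "\<not> \<tau> < \<sigma>"
    \<comment> \<open>A point of (1, 2) below \<sigma>, where convergence is known; the integral
      then converges at everything up to \<tau>.\<close>
    have "head_integrable ((1 + min \<sigma> 2) / 2)" using \<sigma> by (intro liouville_sine_mellin(1)) (auto simp: min_def)
    moreover have "head_integrable \<tau>" using that by (simp add: T_def)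
    ultimately have "head_integrable \<sigma>"
      by (rule head_integrable_between) (use \<open>\<not> \<tau> < \<sigma>\<close> \<sigma> in \<open>auto simp: min_def\<close>)
    thus False using not_int by simp
  qed
  \<comment> \<open>The abscissa of convergence of the head integral.\<close>
  define s where "s = Sup T"
  have bdd: "bdd_above T" using T_less by (intro bdd_aboveI[of _ \<sigma>]) (auto intro: less_imp_le)
  have T_low: "\<tau> \<in> T" if "1 < \<tau>" "\<tau> < 2" for \<tau> using liouville_sine_mellin(1)[OF that] that by (simp add: T_def)
  have s_ge: "2 \<le> s"
  proof (rule field_le_epsilon)
    fix e :: real assume e: "e > 0"
    have "2 - min e (1/2) \<le> s" unfolding s_def by (intro cSup_upper bdd T_low) (use e in auto)
    thus "2 \<le> s + e" by linarith
  qed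
  have s_le: "s \<le> \<sigma>" 
    unfolding s_def
  proof (rule cSup_least)
    show "T \<noteq> {}" using T_low[of "3/2"] by auto
    show "\<tau> \<le> \<sigma>" if "\<tau> \<in> T" for \<tau> using T_less[OF that] by simp
  qed
  hence s: "1 < s" "s < 5 / 2" using s_ge \<sigma> by auto
  define D where "D = {w. 1 < Re w \<and> Re w < 5 / 2}"
  have D_open: "open D"
  proof -
    have "D = {w. Re w > 1} \<inter> {w. Re w < 5 / 2}" by (auto simp: D_def)
    thus ?thesis by (simp only: open_Int open_halfspace_Re_gt open_halfspace_Re_lt)
  qed
  have "open (D \<inter> mellin_denominator -` (- {0}))"
    using holomorphic_on_imp_continuous_on[OF holomorphic_mellin_quotient(1)] D_open
    unfolding D_def by (rule continuous_open_preimage) auto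
  moreover have "of_real s \<in> D \<inter> mellin_denominator -` (- {0})" using s mellin_denominator_real_nonzero[OF s] by (auto simp: D_def)
  ultimately obtain e0 where e0: "e0 > 0" "ball (of_real s) e0 \<subseteq> D \<inter> mellin_denominator -` (- {0})"
    by (rule openE)
  \<comment> \<open>Since s >= 2, capping the radius at 1 keeps the centre \<open>c\<close> below
    above 3/2, the left end of the strip.\<close>
  define e where "e = min e0 1"
  have e: "e > 0" "e \<le> 1" "ball (of_real s) e \<subseteq> D \<inter> mellin_denominator -` (- {0})" using e0 by (auto simp: e_def)
  define \<Phi> where "\<Phi> = (\<lambda>w. mellin_numerator w / mellin_denominator w - mellin_tail (1/4) liouville_sine w)"
  \<comment> \<open>The disc of radius e/2 about \<open>c\<close> stays within distance 3e/4 of s,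
    where \<Phi> is regular, yet it contains c + 3e/8 = s + e/8, beyond the abscissa.\<close>
  define c where "c = s - e / 4"
  have "c < Sup T" using e by (simp add: c_def s_def)
  then obtain b where b: "b \<in> T" "c < b" using less_cSupE[of c T] T_low[of "3/2"] by auto
  have b_le: "b \<le> s" unfolding s_def by (rule cSup_upper[OF b(1) bdd])
  have int: "head_integrable (3/2)" "head_integrable b" using liouville_sine_mellin(1)[of "3/2"] b by (auto simp: T_def)
  have c: "3 / 2 < c" using s_ge e by (simp add: c_def)
  interpret exp_integrals lborel "\<lambda>x. indicator {0<..<1/4} x * liouville_sine x" "\<lambda>x. - ln x" "3/2" b
    by (rule exp_integrals_head[OF int])
  have sub: "ball (of_real c) (e / 2) \<subseteq> ball (complex_of_real s) e"
  proof
    fix z assume "z \<in> ball (complex_of_real c) (e / 2)"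
    moreover have "dist (complex_of_real s) (of_real c) = e / 4" using e by (simp add: dist_of_real c_def dist_real_def)
    ultimately show "z \<in> ball (complex_of_real s) e"
      using dist_triangle[of "complex_of_real s" z "of_real c"] e by simp
  qed
  have "integrable lborel (\<lambda>x. indicator {0<..<1/4} x * liouville_sine x * exp ((c + 3 * e / 8) * - ln x))"
  \<comment> \<open>The choice of \<delta> keeps w in the strip between 3/2 and b, where \<Phi> is
    the convergent head integral by the Mellin identity.\<close>
  proof (rule landau[where \<Phi> = \<Phi> and R = "e / 2" and \<delta> = "min (e / 2) (min (c - 3 / 2) (b - c))"])
    show "0 \<le> indicator {0<..<1/4} x * liouville_sine x" for x
      using nonneg[of x] by (auto simp: indicator_def)
    show "0 \<le> - ln x" if "indicator {0<..<1/4} x * liouville_sine x \<noteq> 0" for x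
      using that by (auto simp: indicator_def split: if_splits)
    have nz: "mellin_denominator w \<noteq> 0" "w \<in> D" if "w \<in> ball (of_real c) (e / 2)" for w
      using that sub e(3) by auto
    have "ball (complex_of_real c) (e / 2) \<subseteq> D" "ball (complex_of_real c) (e / 2) \<subseteq> {w. Re w > 1}"
      using nz(2) by (auto simp: D_def)
    thus "\<Phi> holomorphic_on ball (complex_of_real c) (e / 2)"
      unfolding \<Phi>_def using nz(1) holomorphic_mellin_quotient holomorphic_liouville_tail
      by (intro holomorphic_on_diff holomorphic_on_divide) (auto intro: holomorphic_on_subset simp: D_def)
    fix w :: complex assume w: "norm (w - of_real c) < min (e / 2) (min (c - 3 / 2) (b - c))"
    have "\<bar>Re (w - of_real c)\<bar> \<le> norm (w - of_real c)" by (rule abs_Re_le_cmod)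
    hence Re_w: "3 / 2 < Re w" "Re w < b" using w by auto
    have "w \<in> ball (of_real c) (e / 2)" using w by (simp add: dist_norm norm_minus_commute)
    note nz = nz(1)[OF this]
    have "mellin_denominator w * (mellin_head w + mellin_tail (1/4) liouville_sine w) = mellin_numerator w"
      using Re_w int b c b_le s by (intro mellin_identity[of "3/2" b]) auto
    hence "mellin_numerator w / mellin_denominator w = mellin_head w + mellin_tail (1/4) liouville_sine w"
      using nz by (simp add: field_simps)
    thus "\<Phi> w = F w" by (simp add: \<Phi>_def mellin_head_def)
  qed (use c b e in auto)
  hence "c + 3 * e / 8 \<in> T" using c e by (simp add: T_def)
  hence "c + 3 * e / 8 \<le> s" unfolding s_def by (intro cSup_upper bdd)
  thus False using e by (simp add: c_def)
qed

text \<open>At w = 3 - s the right-hand side of the identity contains zeta(6 - 2w) = zeta(2s) with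
  Re (2s) > 1 and does not vanish. The left-hand side has (s - 1) zeta(s) as a factor, which
  therefore cannot vanish either.\<close>

lemma zeta_nonzero_of_nonneg:
  assumes nonneg: "\<And>x. 0 \<le> x \<Longrightarrow> x \<le> 1 / 4 \<Longrightarrow> liouville_sine x \<ge> 0"
    and s: "Re s > 1 / 2" "s \<noteq> 1"
  shows "zeta s \<noteq> 0"
proof (cases "Re s > 1")
  case True
  thus ?thesis by (rule zeta_nonzero_right)
next
  case False
  define w where "w = 3 - s"
  have w: "2 \<le> Re w" "Re w < 5 / 2" using s False by (auto simp: w_def)
  define b where "b = (Re w + 5 / 2) / 2"
  have b: "Re w < b" "b < 5 / 2" using w by (auto simp: b_def)
  have eq: "mellin_denominator w * (mellin_head w + mellin_tail (1/4) liouville_sine w) = mellin_numerator w"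
    using w b by (intro mellin_identity[of "3/2" b] head_integrable_all[OF nonneg]) auto
  have "zeta (6 - 2 * w) \<noteq> 0" using w by (intro zeta_nonzero_right) simp
  moreover have "rGamma w \<noteq> 0" using w by (auto simp: rGamma_eq_zero_iff elim!: nonpos_Ints_cases)
  moreover have "complex_of_real (2 * pi) powr (w - 1) \<noteq> 0" by simp
  ultimately have "mellin_numerator w \<noteq> 0" by (simp add: mellin_numerator_def)
  hence "zeta_regularized s \<noteq> 0" using eq by (auto simp: mellin_denominator_def w_def)
  thus ?thesis using zeta_regularized_eq[of s] s by auto
qed

theorem theorem3:
  assumes "\<And>(q::nat) (x::real). prime q \<Longrightarrow> [q = 3] (mod 8) \<Longrightarrow> 0 \<le> x \<Longrightarrow> x \<le> 1 / 4 \<Longrightarrow>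
             legendre_sine_series q x \<ge> 0"
  shows "Riemann_Hypothesis"
  unfolding Riemann_Hypothesis_def
proof (intro allI impI)
  fix s assume s: "s \<noteq> 1" "zeta s = 0" "\<nexists>n::nat. s = - 2 * of_nat (Suc n)"
  have right: "zeta z \<noteq> 0" if "Re z > 1 / 2" "z \<noteq> 1" for z
    using that by (intro zeta_nonzero_of_nonneg liouville_sine_nonneg assms)
  have "\<not> Re s > 1 / 2" using right s by blast
  moreover have "\<not> Re s < 1 / 2" using zeta_zeros_left[OF s(2) _ right] s(3) by blast
  ultimately show "Re s = 1 / 2" by simp
qed

end
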